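(* Let $\varphi:\mathbb{R}^n\to(-\infty,\infty]$ be proper and lower semicontinuous and let $\tau>0$. Assume that $\varphi$ is $C^2$-strictly decomposable at $\bar x$ for $\bar\lambda\in\mathcal Q=\partial\varphi_d(0)$ with decomposition pair $(\varphi_d,F)$, $\varphi_d=\sigma_{\mathcal Q}$, and let $\bar v=DF(\bar x)^\top\bar\lambda\in\partial\varphi(\bar x)$. Suppose that $\varphi$ is globally prox-regular at $\bar x$ for $\bar v$ with constant $\rho\ge0$ and $\tau\rho<1$. Then the following statements are equivalent: (i) $\varphi$ is strictly twice epi-differentiable at $\bar x$ for $\bar v$. (ii) There is a neighborhood $U$ of $(\bar x,\bar v)$ such that for all $(x,v)\in U\cap\mathrm{gph}(\partial\varphi)$, $\varphi$ is strictly twice epi-differentiable at $x$ for $v$. (iii) $\bar v\in\mathrm{ri}(\partial\varphi(\bar x))$. (iv) $\bar\lambda\in\mathrm{ri}(\mathcal Q)$. (v) The proximity operator $\mathrm{prox}_{\tau\varphi}$ is continuously differentiable around $\bar x+\tau\bar v$. (vi) The proximity operator $\mathrm{prox}_{\tau\varphi}$ is differentiable at $\bar x+\tau\bar v$.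
   Context: $\partial$ is the limiting subdifferential, $\sigma_{\mathcal Q}$ the support function, $N_{\mathcal Q}$ the normal cone of a convex set, $\mathrm{ri}$ the relative interior. $\mathrm{prox}_{\tau\varphi}(x)=\operatorname{argmin}_y\varphi(y)+\frac1{2\tau}\|y-x\|^2$ (single-valued near $\bar x+\tau\bar v$ under the assumptions). Decomposability: $\varphi$ is $C^\ell$-decomposable at $\bar x\in\mathrm{dom}(\varphi)$ with decomposition pair $(\varphi_d,F)$ if there is an open neighborhood $U$ of $\bar x$ with $\varphi(x)=\varphi(\bar x)+\varphi_d(F(x))$ for all $x\in U$, where (i) $F:U\to\mathbb{R}^m$ is $\ell$-times continuously differentiable and $F(\bar x)=0$; (ii) $\varphi_d=\sigma_{\mathcal Q}:\mathbb{R}^m\to(-\infty,\infty]$ for some nonempty closed convex set $\mathcal Q\subseteq\mathbb{R}^m$; (iii) $0\in\mathrm{int}\{DF(\bar x)\mathbb{R}^n-\mathrm{dom}(\varphi_d)\}$. It is $C^\ell$-strictly decomposable at $\bar x$ for $\bar\lambda\in\mathcal Q$ if in addition $DF(\bar x)\mathbb{R}^n-N_{\mathcal Q}(\bar\lambda)=\mathbb{R}^m$. Global prox-regularity: $\varphi$ is globally prox-regular at $\bar x$ for $\bar v\in\partial\varphi(\bar x)$ with constant $\rho\ge 0$ if $\varphi$ is locally lsc at $\bar x$ and there is $\varepsilon>0$ such that $\varphi(x')\ge\varphi(x)+\langle v,x'-x\rangle-\frac\rho2\|x'-x\|^2$ for all $x'\in\mathbb{R}^n$ whenever $\|x-\bar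 x\|<\varepsilon$, $\|v-\bar v\|<\varepsilon$, $v\in\partial\varphi(x)$, $\varphi(x)<\varphi(\bar x)+\varepsilon$. Strict twice epi-differentiability: with $\Delta_t^2\varphi(x|v)(h):=\frac{\varphi(x+th)-\varphi(x)-t\langle v,h\rangle}{\frac12t^2}$, $\varphi$ is strictly twice epi-differentiable at $\bar x$ for $\bar v\in\partial\varphi(\bar x)$ if the functions $\Delta_t^2\varphi(x|v)$ epi-converge to a function as $t\downarrow0$, $\mathrm{gph}(\partial\varphi)\ni(x,v)\to(\bar x,\bar v)$ with $\varphi(x)\to\varphi(\bar x)$ (i.e., the same epi-limit is obtained along all such sequences). Epi-convergence $\theta_k\xrightarrow{e}\theta$ means: for every $x$, $\liminf_k\theta_k(x^k)\ge\theta(x)$ for every sequence $x^k\to x$ and $\limsup_k\theta_k(x^k)\le\theta(x)$ for some sequence $x^k\to x$. *)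

theory Defs
  imports "HOL-Analysis.Analysis"
begin

text \<open>
  Functions into \<open>(-\<infinity>, \<infinity>]\<close> are \<open>ereal\<close>-valued functions; that the value \<open>-\<infinity>\<close> is not attained
  is part of properness.
\<close>

definition proper_fun :: "('a \<Rightarrow> ereal) \<Rightarrow> bool" where
  "proper_fun f \<longleftrightarrow> (\<forall>x. f x \<noteq> -\<infinity>) \<and> (\<exists>x. f x < \<infinity>)"

definition lsc :: "('a::topological_space \<Rightarrow> ereal) \<Rightarrow> bool" where
  "lsc f \<longleftrightarrow> (\<forall>x. f x \<le> Liminf (at x) f)"

text \<open>Local lower semicontinuity in the sense of Rockafellar and Wets (Variational Analysis, 1.33).\<close>

definition locally_lsc_at :: "('a::metric_space \<Rightarrow> ereal) \<Rightarrow> 'a \<Rightarrow> bool" where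
  "locally_lsc_at f xbar \<longleftrightarrow>
     \<bar>f xbar\<bar> \<noteq> \<infinity> \<and>
     (\<exists>e>0. \<forall>a::real. ereal a \<le> f xbar + ereal e \<longrightarrow> closed {x \<in> cball xbar e. f x \<le> ereal a})"

text \<open>
  The limiting subdifferential is obtained from the regular (Frechet) one by limits along
  sequences with converging function values. Both are empty where \<open>f\<close> is not finite. Note that
  \<open>at x\<close> is the punctured neighbourhood filter.
\<close>

definition regular_subdifferential :: "('a::euclidean_space \<Rightarrow> ereal) \<Rightarrow> 'a \<Rightarrow> 'a set" where
  "regular_subdifferential f x =
     {v. \<bar>f x\<bar> \<noteq> \<infinity> \<and>
         0 \<le> Liminf (at x) (\<lambda>y. (f y - f x - ereal (v \<bullet> (y - x))) / ereal (norm (y - x)))}"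

definition limiting_subdifferential :: "('a::euclidean_space \<Rightarrow> ereal) \<Rightarrow> 'a \<Rightarrow> 'a set" where
  "limiting_subdifferential f x =
     {v. \<bar>f x\<bar> \<noteq> \<infinity> \<and>
         (\<exists>xs vs. xs \<longlonglongrightarrow> x \<and> (\<lambda>k. f (xs k)) \<longlonglongrightarrow> f x \<and> vs \<longlonglongrightarrow> v \<and>
                  (\<forall>k. vs k \<in> regular_subdifferential f (xs k)))}"

definition support_function :: "'a::euclidean_space set \<Rightarrow> 'a \<Rightarrow> ereal" where
  "support_function Q y = (SUP q\<in>Q. ereal (q \<bullet> y))"

definition normal_cone :: "'a::euclidean_space set \<Rightarrow> 'a \<Rightarrow> 'a set" where
  "normal_cone Q q = {w. q \<in> Q \<and> (\<forall>q'\<in>Q. w \<bullet> (q' - q) \<le> 0)}"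

text \<open>
  \<open>k\<close>-fold continuous differentiability; to be used for open sets \<open>S\<close>. In finite dimensions the
  derivative is \<open>C\<^sup>k\<close> iff all directional derivatives are.
\<close>

primrec Ck_on ::
  "nat \<Rightarrow> ('a::euclidean_space \<Rightarrow> 'b::euclidean_space) \<Rightarrow> 'a set \<Rightarrow> bool" where
  "Ck_on 0 f S \<longleftrightarrow> continuous_on S f"
| "Ck_on (Suc k) f S \<longleftrightarrow>
     (\<forall>x\<in>S. f differentiable (at x)) \<and> (\<forall>h. Ck_on k (\<lambda>x. frechet_derivative f (at x) h) S)"

text \<open>
  The set \<open>Q\<close> is an explicit argument; it is determined by \<open>phid\<close>, being the subdifferential of
  \<open>phid\<close> at \<open>0\<close>.
\<close>

definition Ck_decomposable ::
  "nat \<Rightarrow> ('a::euclidean_space \<Rightarrow> ereal) \<Rightarrow> 'a \<Rightarrow> ('b::euclidean_space \<Rightarrow> ereal) \<Rightarrow> ('a \<Rightarrow> 'b) \<Rightarrow> 'b set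
     \<Rightarrow> bool" where
  "Ck_decomposable k phi xbar phid F Q \<longleftrightarrow>
     phi xbar < \<infinity> \<and>
     (\<exists>U. open U \<and> xbar \<in> U \<and> Ck_on k F U \<and> (\<forall>x\<in>U. phi x = phi xbar + phid (F x))) \<and>
     F xbar = 0 \<and>
     Q \<noteq> {} \<and> closed Q \<and> convex Q \<and> phid = support_function Q \<and>
     0 \<in> interior {frechet_derivative F (at xbar) h - y |h y. phid y < \<infinity>}"

definition Ck_strictly_decomposable ::
  "nat \<Rightarrow> ('a::euclidean_space \<Rightarrow> ereal) \<Rightarrow> 'a \<Rightarrow> 'b::euclidean_space \<Rightarrow> ('b \<Rightarrow> ereal) \<Rightarrow> ('a \<Rightarrow> 'b)
     \<Rightarrow> 'b set \<Rightarrow> bool" where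
  "Ck_strictly_decomposable k phi xbar lam phid F Q \<longleftrightarrow>
     Ck_decomposable k phi xbar phid F Q \<and> lam \<in> Q \<and>
     {frechet_derivative F (at xbar) h - w |h w. w \<in> normal_cone Q lam} = UNIV"

definition globally_prox_regular ::
  "('a::euclidean_space \<Rightarrow> ereal) \<Rightarrow> 'a \<Rightarrow> 'a \<Rightarrow> real \<Rightarrow> bool" where
  "globally_prox_regular phi xbar vbar rho \<longleftrightarrow>
     vbar \<in> limiting_subdifferential phi xbar \<and> 0 \<le> rho \<and> locally_lsc_at phi xbar \<and>
     (\<exists>e>0. \<forall>x v. norm (x - xbar) < e \<and> norm (v - vbar) < e \<and>
        v \<in> limiting_subdifferential phi x \<and> phi x < phi xbar + ereal e \<longrightarrow>
        (\<forall>x'. phi x' \<ge> phi x + ereal (v \<bullet> (x' - x) - rho / 2 * (norm (x' - x))\<^sup>2)))"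

definition second_diff_quot ::
  "('a::euclidean_space \<Rightarrow> ereal) \<Rightarrow> real \<Rightarrow> 'a \<Rightarrow> 'a \<Rightarrow> 'a \<Rightarrow> ereal" where
  "second_diff_quot phi t x v h =
     (phi (x + t *\<^sub>R h) - phi x - ereal (t * (v \<bullet> h))) / ereal (1 / 2 * t\<^sup>2)"

definition epi_converges ::
  "(nat \<Rightarrow> 'a::euclidean_space \<Rightarrow> ereal) \<Rightarrow> ('a \<Rightarrow> ereal) \<Rightarrow> bool" where
  "epi_converges theta theta' \<longleftrightarrow>
     (\<forall>x. (\<forall>xs. xs \<longlonglongrightarrow> x \<longrightarrow> liminf (\<lambda>k. theta k (xs k)) \<ge> theta' x) \<and>
          (\<exists>xs. xs \<longlonglongrightarrow> x \<and> limsup (\<lambda>k. theta k (xs k)) \<le> theta' x))"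

definition strictly_twice_epi_differentiable ::
  "('a::euclidean_space \<Rightarrow> ereal) \<Rightarrow> 'a \<Rightarrow> 'a \<Rightarrow> bool" where
  "strictly_twice_epi_differentiable phi xbar vbar \<longleftrightarrow>
     vbar \<in> limiting_subdifferential phi xbar \<and>
     (\<exists>theta. \<forall>ts xs vs.
        (\<forall>k. ts k > 0) \<and> ts \<longlonglongrightarrow> 0 \<and>
        (\<forall>k. vs k \<in> limiting_subdifferential phi (xs k)) \<and> xs \<longlonglongrightarrow> xbar \<and> vs \<longlonglongrightarrow> vbar \<and>
        (\<lambda>k. phi (xs k)) \<longlonglongrightarrow> phi xbar \<longrightarrow>
        epi_converges (\<lambda>k. second_diff_quot phi (ts k) (xs k) (vs k)) theta)"

text \<open>
  The proximity operator is set-valued in general. Its smoothness properties are those of a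
  single-valued representative on a neighbourhood of the point in question.
\<close>

definition prox :: "real \<Rightarrow> ('a::euclidean_space \<Rightarrow> ereal) \<Rightarrow> 'a \<Rightarrow> 'a set" where
  "prox tau phi x =
     {y. is_arg_min (\<lambda>y. phi y + ereal (1 / (2 * tau) * (norm (y - x))\<^sup>2)) (\<lambda>_. True) y}"

definition C1_around ::
  "('a::euclidean_space \<Rightarrow> 'b::euclidean_space set) \<Rightarrow> 'a \<Rightarrow> bool" where
  "C1_around P z \<longleftrightarrow>
     (\<exists>W p. open W \<and> z \<in> W \<and> (\<forall>x\<in>W. P x = {p x}) \<and> Ck_on 1 p W)"

definition differentiable_at_point ::
  "('a::euclidean_space \<Rightarrow> 'b::euclidean_space set) \<Rightarrow> 'a \<Rightarrow> bool" where
  "differentiable_at_point P z \<longleftrightarrow>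
     (\<exists>W p. open W \<and> z \<in> W \<and> (\<forall>x\<in>W. P x = {p x}) \<and> p differentiable (at z))"

end

theory Submission
  imports Defs
begin

text \<open>
  Write \<open>A\<close> for the derivative of \<open>F\<close> at \<open>xbar\<close> and \<open>N\<close> for the normal cone of \<open>Q\<close> at \<open>lam\<close>. The
  nondegeneracy condition provides a Lipschitz map \<open>g\<close> with \<open>A (g e) - e \<in> N\<close>. A contraction argument
  then shows that constraints of the form \<open>F x \<in> q + N\<close> can be satisfied by corrections of the size
  of the residual, and testing with \<open>g\<close> bounds multipliers by subgradients. Hence near \<open>xbar\<close> the
  subgradients of \<open>phi\<close> at \<open>x\<close> are exactly the images under the adjoint derivative at \<open>x\<close> of those
  \<open>q\<close> with \<open>F x\<close> in the normal cone of \<open>Q\<close> at \<open>q\<close>.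

  All conditions are compared with \<open>lam \<in> rel_interior Q\<close>, which holds iff \<open>A h \<in> N\<close> implies that
  \<open>A h\<close> is orthogonal to \<open>Q - lam\<close>. If it holds, then \<open>N\<close> is a subspace. The difference quotients
  then converge by a Taylor expansion to the quadratic form of the second derivative of \<open>F\<close> weighted by \<open>lam\<close>,
  restricted to \<open>A h \<in> N\<close>. The prox is locally the solution of a square \<open>C\<^sup>1\<close> system, which is
  nonsingular because prox-regularity with \<open>tau * rho < 1\<close> bounds that quadratic form from below.

  Conversely, if \<open>A h \<in> N\<close> is not orthogonal to \<open>q - lam\<close>, then the epi-limit at \<open>h\<close> is finite
  for fixed subgradients but infinite along subgradients tilted towards \<open>q\<close>. A derivative of the prox
  would be a monotone linear map that has \<open>h\<close> in its range but annihilates the image of \<open>q - lam\<close>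
  under the adjoint of \<open>A\<close>, which makes these two vectors orthogonal.
\<close>

section \<open>Twice continuously differentiable maps\<close>

locale C2_map =
  fixes F :: "'a::euclidean_space \<Rightarrow> 'b::euclidean_space" and U :: "'a set"
  assumes open_domain: "open U" and C2: "Ck_on 2 F U"
begin

abbreviation F1 :: "'a \<Rightarrow> 'a \<Rightarrow> 'b" where
  "F1 x h \<equiv> frechet_derivative F (at x) h"

abbreviation F2 :: "'a \<Rightarrow> 'a \<Rightarrow> 'a \<Rightarrow> 'b" where
  "F2 x h k \<equiv> frechet_derivative (\<lambda>y. F1 y h) (at x) k"

lemma
  shows F_differentiable: "x \<in> U \<Longrightarrow> F differentiable (at x)"
    and F1_differentiable: "x \<in> U \<Longrightarrow> (\<lambda>y. F1 y h) differentiable (at x)"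
    and F2_continuous_on: "continuous_on U (\<lambda>x. F2 x h k)"
  using C2 by (auto simp: numeral_2_eq_2)

lemma has_derivative_F: "x \<in> U \<Longrightarrow> (F has_derivative F1 x) (at x)"
  using F_differentiable frechet_derivative_works by blast

lemma has_derivative_F1: "x \<in> U \<Longrightarrow> ((\<lambda>y. F1 y h) has_derivative F2 x h) (at x)"
  using F1_differentiable frechet_derivative_works by blast

lemma linear_F1: "x \<in> U \<Longrightarrow> linear (F1 x)"
  using has_derivative_F has_derivative_linear by blast

lemma linear_F2_right: "x \<in> U \<Longrightarrow> linear (F2 x h)"
  using has_derivative_F1 has_derivative_linear by blast

text \<open>\<open>F2 x h\<close> arises by differentiating \<open>F1 y h\<close> for each fixed
  \<open>h\<close> separately, so linearity in \<open>h\<close> is not built in. It follows from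
  linearity of all \<open>F1 y\<close> on the open set \<open>U\<close> and uniqueness of
  derivatives.\<close>

lemma linear_F2_left: assumes "x \<in> U" shows "linear (\<lambda>h. F2 x h k)"
proof (rule linearI)
  fix h l
  have "((\<lambda>y. F1 y (h + l)) has_derivative (\<lambda>k. F2 x h k + F2 x l k)) (at x)"
    using has_derivative_add[OF has_derivative_F1[OF assms, of h] has_derivative_F1[OF assms, of l]]
    by (rule has_derivative_transform_within_open[OF _ open_domain assms])
       (simp add: linear_add[OF linear_F1])
  then show "F2 x (h + l) k = F2 x h k + F2 x l k"
    using frechet_derivative_at by (metis (no_types, lifting))
next
  fix c :: real and h
  have "((\<lambda>y. F1 y (c *\<^sub>R h)) has_derivative (\<lambda>k. c *\<^sub>R F2 x h k)) (at x)"
    using has_derivative_scaleR_right[OF has_derivative_F1[OF assms, of h], of c]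
    by (rule has_derivative_transform_within_open[OF _ open_domain assms])
       (simp add: linear_cmul[OF linear_F1])
  then show "F2 x (c *\<^sub>R h) k = c *\<^sub>R F2 x h k"
    using frechet_derivative_at by (metis (no_types, lifting))
qed

lemma F1_expand: "x \<in> U \<Longrightarrow> F1 x h = (\<Sum>b\<in>Basis. (h \<bullet> b) *\<^sub>R F1 x b)"
  using linear_F1[of x] by (subst euclidean_representation[of h, symmetric])
    (simp add: linear_sum linear_cmul)

lemma F2_expand_left:
  "x \<in> U \<Longrightarrow> F2 x h k = (\<Sum>b\<in>Basis. (h \<bullet> b) *\<^sub>R F2 x b k)"
  using linear_F2_left[of x k] by (subst euclidean_representation[of h, symmetric])
    (simp add: linear_sum[of "\<lambda>h. F2 x h k"] linear_cmul[of "\<lambda>h. F2 x h k"])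

lemma F2_expand:
  assumes "x \<in> U"
  shows "F2 x h k = (\<Sum>b\<in>Basis. \<Sum>c\<in>Basis. (h \<bullet> b) *\<^sub>R (k \<bullet> c) *\<^sub>R F2 x b c)"
proof -
  have "F2 x h k = (\<Sum>b\<in>Basis. (h \<bullet> b) *\<^sub>R F2 x b k)"
    by (rule F2_expand_left[OF assms])
  moreover have "F2 x b k = (\<Sum>c\<in>Basis. (k \<bullet> c) *\<^sub>R F2 x b c)" for b
    using linear_F2_right[OF assms] by (subst euclidean_representation[of k, symmetric])
      (simp add: linear_sum linear_cmul)
  ultimately show ?thesis by (simp add: scaleR_sum_right)
qed

text \<open>\<open>Ck_on\<close> provides continuity in the base point for each fixed direction.
  Since finitely many basis directions determine a linear map, joint continuity in point and
  direction follows; the bilinear \<open>F2\<close> is treated alike.\<close>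

lemma tendsto_F1:
  assumes "(f \<longlongrightarrow> x) G" "(g \<longlongrightarrow> h) G" "x \<in> U"
  shows "((\<lambda>i. F1 (f i) (g i)) \<longlongrightarrow> F1 x h) G"
proof -
  have ev: "eventually (\<lambda>i. f i \<in> U) G"
    using assms open_domain topological_tendstoD by blast
  have "isCont (\<lambda>y. F1 y b) x" for b
    using assms(3) F1_differentiable differentiable_imp_continuous_within by blast
  then have "((\<lambda>i. F1 (f i) b) \<longlongrightarrow> F1 x b) G" for b
    using assms(1) isCont_tendsto_compose by blast
  then have "((\<lambda>i. \<Sum>b\<in>Basis. (g i \<bullet> b) *\<^sub>R F1 (f i) b) \<longlongrightarrow> (\<Sum>b\<in>Basis. (h \<bullet> b) *\<^sub>R F1 x b)) G"
    by (intro tendsto_intros assms)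
  then have "((\<lambda>i. \<Sum>b\<in>Basis. (g i \<bullet> b) *\<^sub>R F1 (f i) b) \<longlongrightarrow> F1 x h) G"
    using F1_expand[OF assms(3), of h] by simp
  then show ?thesis
    by (rule tendsto_cong[THEN iffD1, rotated])
      (use ev F1_expand in \<open>auto elim!: eventually_mono\<close>)
qed

lemma tendsto_F2:
  assumes "(f \<longlongrightarrow> x) G" "(g \<longlongrightarrow> h) G" "(l \<longlongrightarrow> k) G" "x \<in> U"
  shows "((\<lambda>i. F2 (f i) (g i) (l i)) \<longlongrightarrow> F2 x h k) G"
proof -
  have ev: "eventually (\<lambda>i. f i \<in> U) G"
    using assms open_domain topological_tendstoD by blast
  have "isCont (\<lambda>y. F2 y b c) x" for b c
    using F2_continuous_on assms(4) open_domain continuous_on_eq_continuous_at by blast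
  then have "((\<lambda>i. F2 (f i) b c) \<longlongrightarrow> F2 x b c) G" for b c
    using assms(1) isCont_tendsto_compose by blast
  then have "((\<lambda>i. \<Sum>b\<in>Basis. \<Sum>c\<in>Basis. (g i \<bullet> b) *\<^sub>R (l i \<bullet> c) *\<^sub>R F2 (f i) b c)
     \<longlongrightarrow> (\<Sum>b\<in>Basis. \<Sum>c\<in>Basis. (h \<bullet> b) *\<^sub>R (k \<bullet> c) *\<^sub>R F2 x b c)) G"
    by (intro tendsto_intros assms)
  then have "((\<lambda>i. \<Sum>b\<in>Basis. \<Sum>c\<in>Basis. (g i \<bullet> b) *\<^sub>R (l i \<bullet> c) *\<^sub>R F2 (f i) b c) \<longlongrightarrow> F2 x h k) G"
    using F2_expand[OF assms(4), of h k] by simp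
  then show ?thesis
    by (rule tendsto_cong[THEN iffD1, rotated])
      (use ev F2_expand in \<open>auto elim!: eventually_mono\<close>)
qed

text \<open>A finite basis turns continuity in each direction into an operator-norm estimate: every
  basis vector contributes at most \<open>norm h * c\<close> to the error.\<close>

lemma F1_near:
  assumes "x0 \<in> U" "e > 0"
  obtains r where "r > 0" "ball x0 r \<subseteq> U" "\<And>x h. x \<in> ball x0 r \<Longrightarrow> norm (F1 x h - F1 x0 h) \<le> e * norm h"
proof -
  define c where "c = e / real DIM('a)"
  have c: "c > 0" using assms by (simp add: c_def)
  have "\<forall>\<^sub>F x in nhds x0. norm (F1 x b - F1 x0 b) < c" for b
    using tendsto_F1[OF filterlim_ident tendsto_const assms(1), of b] c
    by (simp add: tendsto_iff dist_norm)
  then have "\<forall>\<^sub>F x in nhds x0. \<forall>b\<in>Basis. norm (F1 x b - F1 x0 b) < c"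
    by (simp add: eventually_ball_finite)
  moreover have "\<forall>\<^sub>F x in nhds x0. x \<in> U"
    using assms open_domain eventually_nhds by blast
  ultimately have "\<forall>\<^sub>F x in nhds x0. (\<forall>b\<in>Basis. norm (F1 x b - F1 x0 b) < c) \<and> x \<in> U"
    by eventually_elim simp
  then obtain r where r: "r > 0"
    "\<And>x. x \<in> ball x0 r \<Longrightarrow> (\<forall>b\<in>Basis. norm (F1 x b - F1 x0 b) < c) \<and> x \<in> U"
    unfolding eventually_nhds_metric by (auto simp: dist_commute)
  show thesis
  proof
    show "r > 0" "ball x0 r \<subseteq> U" using r by auto
    fix x h assume x: "x \<in> ball x0 r"
    have "F1 x h - F1 x0 h = (\<Sum>b\<in>Basis. (h \<bullet> b) *\<^sub>R (F1 x b - F1 x0 b))"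
      using F1_expand[of x h] F1_expand[OF assms(1), of h] r(2)[OF x]
      by (simp add: sum_subtractf scaleR_diff_right)
    also have "norm \<dots> \<le> (\<Sum>b\<in>(Basis::'a set). norm h * c)"
    proof (rule sum_norm_le)
      fix b :: 'a assume b: "b \<in> Basis"
      then have "norm (F1 x b - F1 x0 b) \<le> c" using r(2)[OF x] by (simp add: less_imp_le)
      with Basis_le_norm[OF b, of h] show "norm ((h \<bullet> b) *\<^sub>R (F1 x b - F1 x0 b)) \<le> norm h * c"
        by (simp add: mult_mono)
    qed
    also have "\<dots> = e * norm h" by (simp add: c_def)
    finally show "norm (F1 x h - F1 x0 h) \<le> e * norm h" .
  qed
qed

section \<open>Taylor expansions along moving segments\<close>

lemma has_derivative_F_line:
  assumes "x + s *\<^sub>R h \<in> U"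
  shows "((\<lambda>s. F (x + s *\<^sub>R h)) has_derivative (\<lambda>u. u *\<^sub>R F1 (x + s *\<^sub>R h) h)) (at s)"
proof -
  have "((\<lambda>s. x + s *\<^sub>R h) has_derivative (\<lambda>u. u *\<^sub>R h)) (at s)"
    by (auto intro!: derivative_eq_intros)
  from has_derivative_compose[OF this has_derivative_F[OF assms]]
  show ?thesis by (simp add: linear_cmul[OF linear_F1[OF assms]])
qed

lemma has_derivative_F1_line:
  assumes "x + s *\<^sub>R h \<in> U"
  shows "((\<lambda>s. F1 (x + s *\<^sub>R h) k) has_derivative (\<lambda>u. u *\<^sub>R F2 (x + s *\<^sub>R h) k h)) (at s)"
proof -
  have "((\<lambda>s. x + s *\<^sub>R h) has_derivative (\<lambda>u. u *\<^sub>R h)) (at s)"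
    by (auto intro!: derivative_eq_intros)
  from has_derivative_compose[OF this has_derivative_F1[OF assms]]
  show ?thesis by (simp add: linear_cmul[OF linear_F2_right[OF assms]])
qed

text \<open>For vector values the remainder cannot in general be written with a single intermediate
  point, so the expansion is made for the scalar function obtained by pairing with
  \<open>b\<close>.\<close>

lemma Taylor_component:
  assumes "t > 0" "\<And>s. 0 \<le> s \<Longrightarrow> s \<le> t \<Longrightarrow> x + s *\<^sub>R h \<in> U"
  obtains s where "0 < s" "s < t"
    "(F (x + t *\<^sub>R h) - F x - t *\<^sub>R F1 x h) \<bullet> b = t\<^sup>2 / 2 * (F2 (x + s *\<^sub>R h) h h \<bullet> b)"
proof -
  define df where "df = (\<lambda>m::nat. if m = 0 then (\<lambda>s. F (x + s *\<^sub>R h) \<bullet> b)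
    else if m = 1 then (\<lambda>s. F1 (x + s *\<^sub>R h) h \<bullet> b) else (\<lambda>s. F2 (x + s *\<^sub>R h) h h \<bullet> b))"
  have "\<exists>s>0. s < t \<and> df 0 t = (\<Sum>m<2. df m 0 / fact m * t ^ m) + df 2 s / fact 2 * t ^ 2"
  proof (rule Maclaurin)
    show "\<forall>m s. m < 2 \<and> 0 \<le> s \<and> s \<le> t \<longrightarrow> DERIV (df m) s :> df (Suc m) s"
    proof (intro allI impI)
      fix m :: nat and s assume A: "m < 2 \<and> 0 \<le> s \<and> s \<le> t"
      then have sU: "x + s *\<^sub>R h \<in> U" using assms by simp
      consider "m = 0" | "m = 1" using A by linarith
      then show "DERIV (df m) s :> df (Suc m) s"
        using has_derivative_inner_left[OF has_derivative_F_line[OF sU], of b]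
          has_derivative_inner_left[OF has_derivative_F1_line[OF sU], of h b]
        by cases (simp_all add: df_def has_field_derivative_def mult_commute_abs)
    qed
  qed (use assms in auto)
  then obtain s where "s > 0" "s < t" "df 0 t = (\<Sum>m<2. df m 0 / fact m * t ^ m) + df 2 s / fact 2 * t ^ 2"
    by blast
  then show thesis
    by (intro that[of s]) (auto simp: df_def numeral_2_eq_2 inner_diff_left)
qed

text \<open>Base point, step and direction all vary. The intermediate points of the componentwise
  expansions still converge to \<open>x\<close>, so continuity of \<open>F2\<close> gives the
  limit.\<close>

lemma Taylor_limit:
  assumes "xs \<longlonglongrightarrow> x" "x \<in> U" "ts \<longlonglongrightarrow> 0" "\<And>k. ts k > 0" "hs \<longlonglongrightarrow> h"
  shows "(\<lambda>k. (2 / (ts k)\<^sup>2) *\<^sub>R (F (xs k + ts k *\<^sub>R hs k) - F (xs k) - ts k *\<^sub>R F1 (xs k) (hs k)))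
     \<longlonglongrightarrow> F2 x h h"
proof (rule tendsto_componentwise_iff[THEN iffD2], rule ballI)
  fix b :: 'b assume "b \<in> Basis"
  obtain r where r: "r > 0" "ball x r \<subseteq> U"
    using assms(2) open_domain open_contains_ball by blast
  \<comment> \<open>The segment is known to lie in \<open>U\<close> only for large \<open>k\<close>.
    Otherwise \<open>s = 0\<close> serves as a dummy value, so that \<open>s\<close> becomes a total
    sequence squeezed between \<open>0\<close> and \<open>ts k\<close>.\<close>
  have "\<exists>s. 0 \<le> s \<and> s \<le> ts k \<and> ((\<forall>u. 0 \<le> u \<longrightarrow> u \<le> ts k \<longrightarrow> xs k + u *\<^sub>R hs k \<in> U) \<longrightarrow>
     (F (xs k + ts k *\<^sub>R hs k) - F (xs k) - ts k *\<^sub>R F1 (xs k) (hs k)) \<bullet> b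
       = (ts k)\<^sup>2 / 2 * (F2 (xs k + s *\<^sub>R hs k) (hs k) (hs k) \<bullet> b))" for k
  proof (cases "\<forall>u. 0 \<le> u \<longrightarrow> u \<le> ts k \<longrightarrow> xs k + u *\<^sub>R hs k \<in> U")
    case True
    then obtain s where "0 < s" "s < ts k" "(F (xs k + ts k *\<^sub>R hs k) - F (xs k) - ts k *\<^sub>R F1 (xs k) (hs k)) \<bullet> b
       = (ts k)\<^sup>2 / 2 * (F2 (xs k + s *\<^sub>R hs k) (hs k) (hs k) \<bullet> b)"
      using Taylor_component[OF assms(4)[of k], of "xs k" "hs k" b] by blast
    then show ?thesis by (intro exI[of _ s]) auto
  next
    case False
    then show ?thesis using assms(4)[of k] by (intro exI[of _ 0]) auto
  qed
  then obtain s where s: "\<And>k. 0 \<le> s k \<and> s k \<le> ts k \<and>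
     ((\<forall>u. 0 \<le> u \<longrightarrow> u \<le> ts k \<longrightarrow> xs k + u *\<^sub>R hs k \<in> U) \<longrightarrow>
     (F (xs k + ts k *\<^sub>R hs k) - F (xs k) - ts k *\<^sub>R F1 (xs k) (hs k)) \<bullet> b
       = (ts k)\<^sup>2 / 2 * (F2 (xs k + s k *\<^sub>R hs k) (hs k) (hs k) \<bullet> b))"
    by metis
  have s0: "s \<longlonglongrightarrow> 0"
    by (rule tendsto_sandwich[OF _ _ tendsto_const assms(3)]) (use s in auto)
  have lim: "(\<lambda>k. F2 (xs k + s k *\<^sub>R hs k) (hs k) (hs k) \<bullet> b) \<longlonglongrightarrow> F2 x h h \<bullet> b"
  proof -
    have "(\<lambda>k. xs k + s k *\<^sub>R hs k) \<longlonglongrightarrow> x + 0 *\<^sub>R h"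
      by (intro tendsto_intros s0 assms)
    then show ?thesis by (intro tendsto_intros tendsto_F2 assms) simp
  qed
  have "(\<lambda>k. norm (xs k - x) + ts k * norm (hs k)) \<longlonglongrightarrow> norm (x - x) + 0 * norm h"
    by (intro tendsto_intros assms)
  then have "\<forall>\<^sub>F k in sequentially. norm (xs k - x) + ts k * norm (hs k) < r"
    using r(1) by (auto dest: order_tendstoD(2))
  then have "\<forall>\<^sub>F k in sequentially. F2 (xs k + s k *\<^sub>R hs k) (hs k) (hs k) \<bullet> b =
    ((2 / (ts k)\<^sup>2) *\<^sub>R (F (xs k + ts k *\<^sub>R hs k) - F (xs k) - ts k *\<^sub>R F1 (xs k) (hs k))) \<bullet> b"
  proof eventually_elim
    case (elim k)
    have "xs k + u *\<^sub>R hs k \<in> U" if "0 \<le> u" "u \<le> ts k" for u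
    proof -
      have "norm (xs k + u *\<^sub>R hs k - x) \<le> norm (xs k - x) + u * norm (hs k)"
        using norm_triangle_ineq[of "xs k - x" "u *\<^sub>R hs k"] that by (simp add: algebra_simps)
      also have "\<dots> \<le> norm (xs k - x) + ts k * norm (hs k)"
        using that by (intro add_left_mono mult_right_mono) auto
      finally show ?thesis using elim r(2) by (auto simp: dist_norm norm_minus_commute)
    qed
    then have eq: "(F (xs k + ts k *\<^sub>R hs k) - F (xs k) - ts k *\<^sub>R F1 (xs k) (hs k)) \<bullet> b
       = (ts k)\<^sup>2 / 2 * (F2 (xs k + s k *\<^sub>R hs k) (hs k) (hs k) \<bullet> b)"
      using s[of k] by blast
    have "z = 2 / (ts k)\<^sup>2 * ((ts k)\<^sup>2 / 2 * z)" for z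
      using assms(4)[of k] by simp
    then show ?case unfolding inner_scaleR_left eq .
  qed
  then show "(\<lambda>k. ((2 / (ts k)\<^sup>2) *\<^sub>R (F (xs k + ts k *\<^sub>R hs k) - F (xs k) - ts k *\<^sub>R F1 (xs k) (hs k))) \<bullet> b)
     \<longlonglongrightarrow> F2 x h h \<bullet> b"
    using tendsto_cong lim by fastforce
qed

text \<open>Multiplying the second-order limit by \<open>ts k / 2\<close> makes the remainder
  vanish. Since the base points may move, this is strict differentiability in sequential
  form.\<close>

lemma first_order_limit:
  assumes "xs \<longlonglongrightarrow> x" "x \<in> U" "ts \<longlonglongrightarrow> 0" "\<And>k. ts k > 0" "hs \<longlonglongrightarrow> h"
  shows "(\<lambda>k. (F (xs k + ts k *\<^sub>R hs k) - F (xs k)) /\<^sub>R ts k) \<longlonglongrightarrow> F1 x h"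
proof -
  have lim: "(\<lambda>k. (ts k / 2) *\<^sub>R ((2 / (ts k)\<^sup>2) *\<^sub>R (F (xs k + ts k *\<^sub>R hs k) - F (xs k) - ts k *\<^sub>R F1 (xs k) (hs k)))
      + F1 (xs k) (hs k)) \<longlonglongrightarrow> (0 / 2) *\<^sub>R F2 x h h + F1 x h"
    by (intro tendsto_intros Taylor_limit tendsto_F1 assms) auto
  have eq: "(ts k / 2) *\<^sub>R ((2 / (ts k)\<^sup>2) *\<^sub>R (F (xs k + ts k *\<^sub>R hs k) - F (xs k) - ts k *\<^sub>R F1 (xs k) (hs k)))
      + F1 (xs k) (hs k) = (F (xs k + ts k *\<^sub>R hs k) - F (xs k)) /\<^sub>R ts k" for k
  proof -
    have "(t / 2) * (2 / t\<^sup>2) = inverse t" if "t > 0" for t :: real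
      using that by (simp add: power2_eq_square divide_simps)
    then have "(ts k / 2) *\<^sub>R ((2 / (ts k)\<^sup>2) *\<^sub>R w) = w /\<^sub>R ts k" for w :: 'b
      by (metis assms(4) scaleR_scaleR)
    moreover have "(w - ts k *\<^sub>R v) /\<^sub>R ts k + v = w /\<^sub>R ts k" for v w :: 'b
      using assms(4)[of k] by (simp add: scaleR_diff_right)
    ultimately show ?thesis by metis
  qed
  show ?thesis using lim unfolding eq by (simp only: div_0 scaleR_zero_left add_0_left)
qed

section \<open>The adjoint of the derivative\<close>

lemma adjoint_F1_works: "x \<in> U \<Longrightarrow> h \<bullet> adjoint (F1 x) l = F1 x h \<bullet> l"
  using adjoint_works linear_F1 by blast

text \<open>Coordinates express the adjoint through \<open>F1\<close>, from which it inherits joint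
  continuity in point and multiplier.\<close>

lemma adjoint_F1_expand: "x \<in> U \<Longrightarrow> adjoint (F1 x) l = (\<Sum>b\<in>Basis. (F1 x b \<bullet> l) *\<^sub>R b)"
  by (subst euclidean_representation[symmetric]) (simp only: inner_commute[of "adjoint _ _"] adjoint_F1_works)

lemma linear_adjoint_F1: "x \<in> U \<Longrightarrow> linear (adjoint (F1 x))"
  by (simp add: adjoint_linear linear_F1)

lemma tendsto_adjoint_F1:
  assumes "(f \<longlongrightarrow> x) G" "(g \<longlongrightarrow> l) G" "x \<in> U"
  shows "((\<lambda>i. adjoint (F1 (f i)) (g i)) \<longlongrightarrow> adjoint (F1 x) l) G"
proof -
  have ev: "eventually (\<lambda>i. f i \<in> U) G"
    using assms open_domain topological_tendstoD by blast
  have "((\<lambda>i. \<Sum>b\<in>Basis. (F1 (f i) b \<bullet> g i) *\<^sub>R b) \<longlongrightarrow> (\<Sum>b\<in>Basis. (F1 x b \<bullet> l) *\<^sub>R b)) G"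
    by (intro tendsto_intros tendsto_F1 assms)
  then show ?thesis unfolding adjoint_F1_expand[OF assms(3)]
    by (rule tendsto_cong[THEN iffD1, rotated])
      (use ev adjoint_F1_expand in \<open>auto elim!: eventually_mono\<close>)
qed

end

section \<open>Metric regularity of the constraint system\<close>

lemma support_function_le_iff:
  "support_function Q y \<le> ereal a \<longleftrightarrow> (\<forall>q\<in>Q. q \<bullet> y \<le> a)"
  by (simp add: support_function_def SUP_le_iff)

lemma support_function_ge: "q \<in> Q \<Longrightarrow> ereal (q \<bullet> y) \<le> support_function Q y"
  unfolding support_function_def by (rule SUP_upper)

lemma support_function_eq_iff:
  "q \<in> Q \<Longrightarrow> support_function Q y = ereal (q \<bullet> y) \<longleftrightarrow> y \<in> normal_cone Q q"
  using support_function_ge[of q Q y] support_function_le_iff[of Q y "q \<bullet> y"]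
  by (auto simp: normal_cone_def inner_diff_right inner_commute intro: antisym)

lemma normal_cone_zero: "q \<in> Q \<Longrightarrow> 0 \<in> normal_cone Q q"
  by (simp add: normal_cone_def)

lemma normal_cone_add: "v \<in> normal_cone Q q \<Longrightarrow> w \<in> normal_cone Q q \<Longrightarrow> v + w \<in> normal_cone Q q"
  unfolding normal_cone_def mem_Collect_eq inner_add_left by (metis add_nonpos_nonpos)

lemma normal_cone_scale: "v \<in> normal_cone Q q \<Longrightarrow> 0 \<le> a \<Longrightarrow> a *\<^sub>R v \<in> normal_cone Q q"
  by (auto simp: normal_cone_def mult_nonneg_nonpos)

lemma mem_normal_coneD: "w \<in> normal_cone Q q \<Longrightarrow> q' \<in> Q \<Longrightarrow> q' \<bullet> w \<le> q \<bullet> w"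
  by (auto simp: normal_cone_def inner_diff_right inner_commute)

text \<open>
  The selection is the positively homogeneous piecewise linear map that is prescribed on the
  vectors \<open>b\<close> and \<open>-b\<close> for \<open>b\<close> in the standard basis.
\<close>

lemma Lipschitz_cone_selection:
  fixes A :: "'a::euclidean_space \<Rightarrow> 'b::euclidean_space"
  assumes "linear A"
    and N: "0 \<in> N" "\<And>v w. v \<in> N \<Longrightarrow> w \<in> N \<Longrightarrow> v + w \<in> N" "\<And>v a. v \<in> N \<Longrightarrow> 0 \<le> a \<Longrightarrow> a *\<^sub>R v \<in> N"
    and onto: "{A h - w |h w. w \<in> N} = UNIV"
  shows "\<exists>g C::real. C > 0 \<and> g 0 = 0 \<and> (\<forall>e. A (g e) - e \<in> N) \<and> (\<forall>e e'. norm (g e - g e') \<le> C * norm (e - e'))"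
proof -
  have "\<exists>h. A h - e \<in> N" for e
  proof -
    have "e \<in> {A h - w |h w. w \<in> N}" unfolding onto ..
    then obtain h w where "e = A h - w" "w \<in> N" by blast
    then show ?thesis by (intro exI[of _ h]) simp
  qed
  then obtain s where s: "A (s e) - e \<in> N" for e by metis
  \<comment> \<open>As \<open>N\<close> is only a convex cone, its elements may be combined with
    nonnegative coefficients only. Hence positive and negative parts of the coordinates are treated
    separately.\<close>
  define g where "g e = (\<Sum>b\<in>Basis. max 0 (e \<bullet> b) *\<^sub>R s b + max 0 (- (e \<bullet> b)) *\<^sub>R s (- b))" for e
  define C where "C = 1 + (\<Sum>b\<in>Basis. norm (s b) + norm (s (- b)))"
  have sumN: "(\<And>b. b \<in> B \<Longrightarrow> f b \<in> N) \<Longrightarrow> sum f B \<in> N" for f :: "'b \<Rightarrow> 'b" and B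
    by (induction B rule: infinite_finite_induct) (auto intro: N)
  show ?thesis
  proof (intro exI conjI allI)
    show "C > 0" by (simp add: C_def sum_nonneg add_pos_nonneg)
    show "g 0 = 0" by (simp add: g_def)
    fix e e' :: 'b
    have "A (g e) - e = (\<Sum>b\<in>Basis. max 0 (e \<bullet> b) *\<^sub>R A (s b) + max 0 (- (e \<bullet> b)) *\<^sub>R A (s (- b)))
        - (\<Sum>b\<in>Basis. (e \<bullet> b) *\<^sub>R b)"
      by (simp only: g_def linear_sum[OF assms(1)] linear_add[OF assms(1)] linear_cmul[OF assms(1)]
          euclidean_representation)
    also have "\<dots> = (\<Sum>b\<in>Basis. max 0 (e \<bullet> b) *\<^sub>R (A (s b) - b) + max 0 (- (e \<bullet> b)) *\<^sub>R (A (s (- b)) - (- b)))"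
      unfolding sum_subtractf[symmetric]
    proof (rule sum.cong[OF refl])
      fix b :: 'b
      have "e \<bullet> b = max 0 (e \<bullet> b) - max 0 (- (e \<bullet> b))" by simp
      then have "(e \<bullet> b) *\<^sub>R b = max 0 (e \<bullet> b) *\<^sub>R b - max 0 (- (e \<bullet> b)) *\<^sub>R b"
        by (metis scaleR_diff_left)
      then show "max 0 (e \<bullet> b) *\<^sub>R A (s b) + max 0 (- (e \<bullet> b)) *\<^sub>R A (s (- b)) - (e \<bullet> b) *\<^sub>R b =
         max 0 (e \<bullet> b) *\<^sub>R (A (s b) - b) + max 0 (- (e \<bullet> b)) *\<^sub>R (A (s (- b)) - (- b))"
        by (simp add: scaleR_diff_right scaleR_add_right)
    qed
    also have "\<dots> \<in> N" by (intro sumN N s) auto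
    finally show "A (g e) - e \<in> N" .
    have "g e - g e' = (\<Sum>b\<in>Basis. (max 0 (e \<bullet> b) - max 0 (e' \<bullet> b)) *\<^sub>R s b
        + (max 0 (- (e \<bullet> b)) - max 0 (- (e' \<bullet> b))) *\<^sub>R s (- b))"
      by (simp add: g_def sum_subtractf[symmetric] scaleR_diff_left add_diff_add)
    also have "norm \<dots> \<le> (\<Sum>b\<in>Basis. norm (e - e') * (norm (s b) + norm (s (- b))))"
    proof (rule sum_norm_le)
      fix b :: 'b assume "b \<in> Basis"
      then have b: "\<bar>e \<bullet> b - e' \<bullet> b\<bar> \<le> norm (e - e')"
        by (metis Basis_le_norm inner_diff_left)
      have 1: "\<bar>max 0 (e \<bullet> b) - max 0 (e' \<bullet> b)\<bar> \<le> norm (e - e')"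
        "\<bar>max 0 (- (e \<bullet> b)) - max 0 (- (e' \<bullet> b))\<bar> \<le> norm (e - e')"
        using b by linarith+
      then have "\<bar>max 0 (e \<bullet> b) - max 0 (e' \<bullet> b)\<bar> * norm (s b)
        + \<bar>max 0 (- (e \<bullet> b)) - max 0 (- (e' \<bullet> b))\<bar> * norm (s (- b))
        \<le> norm (e - e') * norm (s b) + norm (e - e') * norm (s (- b))"
        by (intro add_mono mult_right_mono) auto
      then show "norm ((max 0 (e \<bullet> b) - max 0 (e' \<bullet> b)) *\<^sub>R s b
        + (max 0 (- (e \<bullet> b)) - max 0 (- (e' \<bullet> b))) *\<^sub>R s (- b)) \<le> norm (e - e') * (norm (s b) + norm (s (- b)))"
        by (intro norm_triangle_le) (simp add: distrib_left)
    qed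
    also have "\<dots> = (C - 1) * norm (e - e')"
      by (simp add: C_def sum_distrib_left mult.commute)
    also have "\<dots> \<le> C * norm (e - e')" by (simp add: mult_right_mono)
    finally show "norm (g e - g e') \<le> C * norm (e - e')" .
  qed
qed

locale strict_decomposition = C2_map F U
  for F :: "'a::euclidean_space \<Rightarrow> 'b::euclidean_space" and U +
  fixes phi :: "'a \<Rightarrow> ereal" and xbar :: 'a and lam :: 'b and Q :: "'b set"
  assumes xbar_domain: "xbar \<in> U"
    and F_xbar: "F xbar = 0"
    and decomposition: "x \<in> U \<Longrightarrow> phi x = phi xbar + support_function Q (F x)"
    and phi_xbar_finite: "\<bar>phi xbar\<bar> \<noteq> \<infinity>"
    and closed_Q: "closed Q" and convex_Q: "convex Q" and lam_Q: "lam \<in> Q"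
    and nondegenerate: "{F1 xbar h - w |h w. w \<in> normal_cone Q lam} = UNIV"
begin

abbreviation "N \<equiv> normal_cone Q lam"

lemma metric_regularity:
  obtains C r where "C > 0" "r > 0" "ball xbar r \<subseteq> U"
    "\<And>y u. y \<in> ball xbar r \<Longrightarrow> norm u < r \<Longrightarrow> \<exists>g. norm g \<le> C * norm u \<and> F (y + g) - (F y - u) \<in> N"
    "\<And>x \<mu>. x \<in> ball xbar r \<Longrightarrow> (\<And>d. d \<in> N \<Longrightarrow> \<mu> \<bullet> d \<le> 0) \<Longrightarrow> norm \<mu> \<le> C * norm (adjoint (F1 x) \<mu>)"
proof -
  txt \<open>
    With the selection \<open>g\<close>, the point \<open>y + g e\<close> is as required as soon as \<open>e\<close> is a fixed point of
    \<open>T\<close> below, and \<open>T\<close> contracts because \<open>F - ?A\<close> has a small Lipschitz constant near \<open>xbar\<close>. For the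
    second estimate, test with \<open>g (- \<mu>)\<close>.
  \<close>
  let ?A = "F1 xbar"
  have add: "\<And>v w. v \<in> N \<Longrightarrow> w \<in> N \<Longrightarrow> v + w \<in> N" by (rule normal_cone_add)
  have scale: "\<And>v a. v \<in> N \<Longrightarrow> 0 \<le> a \<Longrightarrow> a *\<^sub>R v \<in> N" by (rule normal_cone_scale)
  obtain g C0 where C0: "C0 > (0::real)" and g0: "g 0 = 0" and gN: "\<And>e. ?A (g e) - e \<in> N"
    and gL: "\<And>e e'. norm (g e - g e') \<le> C0 * norm (e - e')"
    using Lipschitz_cone_selection[OF linear_F1[OF xbar_domain] normal_cone_zero[OF lam_Q]
        add scale nondegenerate] by blast
  have g_le: "norm (g e) \<le> C0 * norm e" for e using gL[of e 0] g0 by simp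
  \<comment> \<open>The selection has Lipschitz constant \<open>C0\<close> and the remainder
    \<open>F - ?A\<close> will have constant \<epsilon>, so their composition contracts by the
    factor \<open>1 / 2\<close>.\<close>
  define \<epsilon> where "\<epsilon> = 1 / (2 * C0)"
  have "\<epsilon> > 0" using C0 by (simp add: \<epsilon>_def)
  then obtain r0 where r0: "r0 > 0" "ball xbar r0 \<subseteq> U"
    and near: "\<And>x h. x \<in> ball xbar r0 \<Longrightarrow> norm (F1 x h - ?A h) \<le> \<epsilon> * norm h"
    using F1_near[OF xbar_domain] by blast
  \<comment> \<open>The fixed point will satisfy \<open>norm e \<le> 2 * norm u < 2 * r\<close>,
    hence \<open>norm (g e) \<le> 2 * C0 * r \<le> r0 / 2\<close>. Together with
    \<open>r \<le> r0 / 2\<close> this keeps \<open>y + g e\<close> in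
    \<open>ball xbar r0\<close>.\<close>
  define r where "r = min (r0 / 2) (r0 / (4 * C0))"
  have r: "r > 0" "r \<le> r0 / 2" "2 * C0 * r \<le> r0 / 2"
    using r0 C0 by (auto simp: r_def field_simps min_def)
  have lip: "norm ((F x - ?A x) - (F y - ?A y)) \<le> \<epsilon> * norm (x - y)"
    if "x \<in> ball xbar r0" "y \<in> ball xbar r0" for x y
  proof (rule differentiable_bound[OF convex_ball _ _ that])
    fix x assume x: "x \<in> ball xbar r0"
    have "(?A has_derivative ?A) (at x)"
      using linear_F1[OF xbar_domain] by (simp add: linear_imp_has_derivative)
    then have "((\<lambda>x. F x - ?A x) has_derivative (\<lambda>h. F1 x h - ?A h)) (at x)"
      using has_derivative_F x r0(2) by (intro has_derivative_diff) auto
    then show "((\<lambda>x. F x - ?A x) has_derivative (\<lambda>h. F1 x h - ?A h)) (at x within ball xbar r0)"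
      by (rule has_derivative_at_withinI)
    show "onorm (\<lambda>h. F1 x h - ?A h) \<le> \<epsilon>"
      by (rule onorm_le) (rule near[OF x])
  qed
  show thesis
  proof
    show "2 * C0 > 0" "r > 0" using C0 r by auto
    show "ball xbar r \<subseteq> U" using r0 r(1,2) by auto
  next
    fix y and u :: 'b assume y: "y \<in> ball xbar r" and u: "norm u < r"
    define T where "T e = ?A (g e) - (F (y + g e) - F y) - u" for e
    have inball: "y + g e \<in> ball xbar r0" if "norm e \<le> 2 * norm u" for e
    proof -
      have "norm (g e) \<le> C0 * (2 * r)"
        using g_le[of e] that u C0 by (smt (verit) mult_left_mono)
      then have "norm (g e) \<le> r0 / 2" using r(3) by (simp add: mult.assoc mult.left_commute)
      moreover have "norm (xbar - y) < r0 / 2" using y r(2) by (simp add: dist_norm)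
      ultimately show ?thesis
        using norm_triangle_ineq4[of "xbar - y" "g e"] by (simp add: dist_norm algebra_simps)
    qed
    have TL: "norm (T e - T e') \<le> 1 / 2 * norm (e - e')" if "norm e \<le> 2 * norm u" "norm e' \<le> 2 * norm u" for e e'
    proof -
      have "T e - T e' = - ((F (y + g e) - ?A (y + g e)) - (F (y + g e') - ?A (y + g e')))"
        unfolding T_def linear_add[OF linear_F1[OF xbar_domain]] by (simp add: algebra_simps)
      then have "norm (T e - T e') \<le> \<epsilon> * norm (g e - g e')"
        using lip[OF inball[OF that(1)] inball[OF that(2)]] by (simp add: norm_minus_commute)
      also have "\<dots> \<le> \<epsilon> * (C0 * norm (e - e'))"
        using \<open>\<epsilon> > 0\<close> gL by (simp add: mult_left_mono)
      finally show ?thesis using C0 by (simp add: \<epsilon>_def)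
    qed
    have "\<exists>!e. e \<in> cball 0 (2 * norm u) \<and> T e = e"
    proof (rule Banach_fix[where c = "1/2"])
      show "complete (cball (0::'b) (2 * norm u))" by (simp add: compact_imp_complete)
      show "T ` cball 0 (2 * norm u) \<subseteq> cball 0 (2 * norm u)"
      proof (intro image_subsetI)
        fix e assume e: "e \<in> cball (0::'b) (2 * norm u)"
        \<comment> \<open>The contraction estimate now gives
          \<open>norm (T e) \<le> norm u + norm e / 2\<close>, which explains the radius
          \<open>2 * norm u\<close> of the invariant ball.\<close>
        have "T 0 = - u" using g0 linear_0[OF linear_F1[OF xbar_domain]] by (simp add: T_def)
        with TL[of e 0] e have "norm (T e + u) \<le> 1 / 2 * norm e" by simp
        then show "T e \<in> cball 0 (2 * norm u)"
          using e norm_triangle_ineq4[of "T e + u" u] by simp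
      qed
      show "dist (T x) (T y) \<le> 1/2 * dist x y" if "x \<in> cball 0 (2 * norm u)" "y \<in> cball 0 (2 * norm u)" for x y
        using TL[of x y] that by (simp add: dist_norm)
    qed auto
    then obtain e where e: "norm e \<le> 2 * norm u" "T e = e" by auto
    show "\<exists>g. norm g \<le> 2 * C0 * norm u \<and> F (y + g) - (F y - u) \<in> N"
    proof (intro exI[of _ "g e"] conjI)
      have "C0 * norm e \<le> C0 * (2 * norm u)" using e C0 by (intro mult_left_mono) auto
      then show "norm (g e) \<le> 2 * C0 * norm u" using g_le[of e] by linarith
      have "F (y + g e) - (F y - u) = ?A (g e) - T e" by (simp add: T_def)
      then show "F (y + g e) - (F y - u) \<in> N" using gN[of e] e by simp
    qed
  next
    fix x \<mu> assume "x \<in> ball xbar r" and \<mu>: "\<And>d. d \<in> N \<Longrightarrow> \<mu> \<bullet> d \<le> 0"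
    then have x: "x \<in> ball xbar r0" using r by auto
    then have xU: "x \<in> U" using r0 by auto
    let ?h = "g (- \<mu>)"
    \<comment> \<open>This bounds the square of \<open>norm \<mu>\<close> by
      \<open>- (?A ?h \<bullet> \<mu>)\<close>. Replacing \<open>?A\<close> by \<open>F1 x\<close>
      costs at most half of that square, which is absorbed on the left.\<close>
    have "\<mu> \<bullet> (?A ?h - (- \<mu>)) \<le> 0" by (rule \<mu>[OF gN])
    then have "(norm \<mu>)\<^sup>2 \<le> - (?A ?h \<bullet> \<mu>)"
      by (simp add: inner_add_right inner_commute power2_norm_eq_inner)
    also have "\<dots> = (F1 x ?h - ?A ?h) \<bullet> \<mu> - ?h \<bullet> adjoint (F1 x) \<mu>"
      by (simp add: adjoint_F1_works[OF xU] inner_diff_left)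
    also have "\<dots> \<le> norm (F1 x ?h - ?A ?h) * norm \<mu> + norm ?h * norm (adjoint (F1 x) \<mu>)"
      by (smt (verit) norm_cauchy_schwarz Cauchy_Schwarz_ineq2)
    also have "\<dots> \<le> (\<epsilon> * (C0 * norm \<mu>)) * norm \<mu> + (C0 * norm \<mu>) * norm (adjoint (F1 x) \<mu>)"
    proof -
      have "norm ?h \<le> C0 * norm \<mu>" using g_le[of "- \<mu>"] by simp
      moreover from this have "norm (F1 x ?h - ?A ?h) \<le> \<epsilon> * (C0 * norm \<mu>)"
        using near[OF x, of ?h] \<open>\<epsilon> > 0\<close> by (smt (verit) mult_left_mono)
      ultimately show ?thesis by (intro add_mono mult_right_mono) auto
    qed
    also have "\<dots> = (norm \<mu>)\<^sup>2 / 2 + C0 * norm \<mu> * norm (adjoint (F1 x) \<mu>)"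
      using C0 by (simp add: \<epsilon>_def power2_eq_square)
    finally have "norm \<mu> * norm \<mu> \<le> norm \<mu> * (2 * C0 * norm (adjoint (F1 x) \<mu>))"
      unfolding power2_eq_square by argo
    then show "norm \<mu> \<le> 2 * C0 * norm (adjoint (F1 x) \<mu>)"
      using C0 by (cases "\<mu> = 0") auto
  qed
qed

end

text \<open>Fixes the constants from \<open>metric_regularity\<close>, so that all later estimates
  share one modulus \<open>C\<close> and one ball.\<close>

locale regular_decomposition = strict_decomposition F U phi xbar lam Q
  for F :: "'a::euclidean_space \<Rightarrow> 'b::euclidean_space" and U phi xbar lam Q +
  fixes C r :: real
  assumes C_pos: "C > 0" and r_pos: "r > 0" and ball_domain: "ball xbar r \<subseteq> U"
    and Robinson: "y \<in> ball xbar r \<Longrightarrow> norm u < r \<Longrightarrow>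
      \<exists>g. norm g \<le> C * norm u \<and> F (y + g) - (F y - u) \<in> N"
    and multiplier_bound: "x \<in> ball xbar r \<Longrightarrow> (\<And>d. d \<in> N \<Longrightarrow> \<mu> \<bullet> d \<le> 0) \<Longrightarrow>
      norm \<mu> \<le> C * norm (adjoint (F1 x) \<mu>)"
begin

lemma ball_domainD: "x \<in> ball xbar r \<Longrightarrow> x \<in> U" using ball_domain by blast

text \<open>Linearization leaves an error \<open>u k\<close> that is small compared with
  \<open>ts k\<close>. \<open>Robinson\<close> removes it up to an element of \<open>N\<close> by a
  correction of order \<open>norm (u k)\<close>, so the corrected directions still converge to
  \<open>h\<close>.\<close>

lemma feasible_directions:
  assumes "xs \<longlonglongrightarrow> x" "x \<in> ball xbar r" "ts \<longlonglongrightarrow> 0" "\<And>k. ts k > 0"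
  obtains hs where "hs \<longlonglongrightarrow> h"
    "\<forall>\<^sub>F k in sequentially. F (xs k + ts k *\<^sub>R hs k) - F (xs k) - ts k *\<^sub>R F1 x h \<in> N"
proof -
  define u where "u k = F (xs k + ts k *\<^sub>R h) - F (xs k) - ts k *\<^sub>R F1 x h" for k
  have "(\<lambda>k. (F (xs k + ts k *\<^sub>R h) - F (xs k)) /\<^sub>R ts k - F1 x h) \<longlonglongrightarrow> F1 x h - F1 x h"
    using ball_domainD[OF assms(2)] by (intro tendsto_intros first_order_limit assms)
  moreover have "(F (xs k + ts k *\<^sub>R h) - F (xs k)) /\<^sub>R ts k - F1 x h = u k /\<^sub>R ts k" for k
    using assms(4)[of k] by (simp add: u_def scaleR_diff_right)
  ultimately have ut: "(\<lambda>k. u k /\<^sub>R ts k) \<longlonglongrightarrow> 0" by simp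
  have "(\<lambda>k. ts k *\<^sub>R (u k /\<^sub>R ts k)) \<longlonglongrightarrow> 0 *\<^sub>R 0" by (intro tendsto_intros ut assms)
  moreover have "ts k *\<^sub>R (u k /\<^sub>R ts k) = u k" for k using assms(4)[of k] by simp
  ultimately have "u \<longlonglongrightarrow> 0" by simp
  then have ev1: "\<forall>\<^sub>F k in sequentially. norm (u k) < r"
    using r_pos by (simp add: tendsto_iff)
  have "(\<lambda>k. xs k + ts k *\<^sub>R h) \<longlonglongrightarrow> x + 0 *\<^sub>R h" by (intro tendsto_intros assms)
  then have ev2: "\<forall>\<^sub>F k in sequentially. xs k + ts k *\<^sub>R h \<in> ball xbar r"
    using assms(2) by (intro topological_tendstoD) auto
  have "\<forall>k. \<exists>g. xs k + ts k *\<^sub>R h \<in> ball xbar r \<and> norm (u k) < r \<longrightarrow>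
    norm g \<le> C * norm (u k) \<and> F (xs k + ts k *\<^sub>R h + g) - (F (xs k + ts k *\<^sub>R h) - u k) \<in> N"
    using Robinson by blast
  then obtain gs where gs: "\<And>k. xs k + ts k *\<^sub>R h \<in> ball xbar r \<and> norm (u k) < r \<Longrightarrow>
    norm (gs k) \<le> C * norm (u k) \<and> F (xs k + ts k *\<^sub>R h + gs k) - (F (xs k + ts k *\<^sub>R h) - u k) \<in> N"
    by metis
  show thesis
  proof
    have "(\<lambda>k. gs k /\<^sub>R ts k) \<longlonglongrightarrow> 0"
    proof (rule Lim_null_comparison)
      show "\<forall>\<^sub>F k in sequentially. norm (gs k /\<^sub>R ts k) \<le> C * norm (u k /\<^sub>R ts k)"
        using ev1 ev2
      proof eventually_elim
        case (elim k)
        then have "norm (gs k) * inverse (ts k) \<le> C * norm (u k) * inverse (ts k)"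
          using gs[of k] assms(4)[of k] by (intro mult_right_mono) auto
        then show ?case using assms(4)[of k] by (simp add: mult_ac)
      qed
      show "(\<lambda>k. C * norm (u k /\<^sub>R ts k)) \<longlonglongrightarrow> 0"
        by (intro tendsto_mult_right_zero tendsto_norm_zero ut)
    qed
    then have "(\<lambda>k. h + gs k /\<^sub>R ts k) \<longlonglongrightarrow> h + 0" by (intro tendsto_intros)
    then show "(\<lambda>k. h + gs k /\<^sub>R ts k) \<longlonglongrightarrow> h" by simp
    show "\<forall>\<^sub>F k in sequentially. F (xs k + ts k *\<^sub>R (h + gs k /\<^sub>R ts k)) - F (xs k) - ts k *\<^sub>R F1 x h \<in> N"
      using ev1 ev2
    proof eventually_elim
      case (elim k)
      have "xs k + ts k *\<^sub>R (h + gs k /\<^sub>R ts k) = xs k + ts k *\<^sub>R h + gs k"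
        using assms(4)[of k] by (simp add: scaleR_add_right)
      moreover have "F (xs k + ts k *\<^sub>R h) - u k = F (xs k) + ts k *\<^sub>R F1 x h" by (simp add: u_def)
      ultimately show ?case using gs[of k] elim by (simp add: diff_diff_eq add.assoc)
    qed
  qed
qed

end

section \<open>Subgradients and multipliers\<close>

lemma regular_imp_limiting:
  assumes "v \<in> regular_subdifferential f x"
  shows "v \<in> limiting_subdifferential f x"
proof -
  have "\<bar>f x\<bar> \<noteq> \<infinity>" using assms
    unfolding regular_subdifferential_def mem_Collect_eq by (rule conjunct1)
  then show ?thesis
    unfolding limiting_subdifferential_def mem_Collect_eq
    by (intro conjI exI[of _ "\<lambda>_. x"] exI[of _ "\<lambda>_. v"] tendsto_const allI assms)
qed

section \<open>Values and regular subgradients of the decomposed function\<close>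

context strict_decomposition
begin

definition phi0 where "phi0 = real_of_ereal (phi xbar)"

lemma phi_xbar: "phi xbar = ereal phi0"
  using phi_xbar_finite by (auto simp: phi0_def ereal_real)

lemma phi_le: "x \<in> U \<Longrightarrow> support_function Q (F x) \<le> ereal s \<Longrightarrow> phi x \<le> ereal (phi0 + s)"
  using decomposition[of x] add_left_mono[of "support_function Q (F x)" "ereal s" "ereal phi0"]
  by (simp add: phi_xbar)

lemma phi_ge: "x \<in> U \<Longrightarrow> q \<in> Q \<Longrightarrow> ereal (phi0 + q \<bullet> F x) \<le> phi x"
  using decomposition[of x] add_left_mono[OF support_function_ge[of q Q "F x"], of "ereal phi0"]
  by (simp add: phi_xbar)

lemma phi_normal: "x \<in> U \<Longrightarrow> F x \<in> normal_cone Q q \<Longrightarrow> phi x = ereal (phi0 + q \<bullet> F x)"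
  using decomposition[of x] support_function_eq_iff[of q Q "F x"]
  by (auto simp: phi_xbar normal_cone_def)

lemma finite_phiE:
  assumes "x \<in> U" "\<bar>phi x\<bar> \<noteq> \<infinity>"
  obtains c where "support_function Q (F x) = ereal c" "phi x = ereal (phi0 + c)"
proof -
  have "support_function Q (F x) \<noteq> -\<infinity>" using support_function_ge[OF lam_Q, of "F x"] by auto
  moreover have "support_function Q (F x) \<noteq> \<infinity>" using assms decomposition[of x] by (auto simp: phi_xbar)
  ultimately show thesis
    using that decomposition[OF assms(1)] by (cases "support_function Q (F x)") (auto simp: phi_xbar)
qed

text \<open>The lower limit in the definition becomes a real inequality with slack \<open>e\<close>.
  Quantifying over real upper bounds \<open>s\<close> of the support function makes the claim
  vacuous where \<open>phi\<close> is infinite.\<close>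

lemma regular_subgradient_bound:
  assumes v: "v \<in> regular_subdifferential phi x" and x: "x \<in> U" and c: "phi x = ereal (phi0 + c)" and "e > 0"
  shows "\<forall>\<^sub>F y in nhds x. \<forall>s. support_function Q (F y) \<le> ereal s \<longrightarrow> v \<bullet> (y - x) - e * norm (y - x) \<le> s - c"
proof -
  have "0 \<le> Liminf (at x) (\<lambda>y. (phi y - phi x - ereal (v \<bullet> (y - x))) / ereal (norm (y - x)))"
    using v by (simp add: regular_subdifferential_def)
  then have "\<forall>\<^sub>F y in at x. ereal (- e) < (phi y - phi x - ereal (v \<bullet> (y - x))) / ereal (norm (y - x))"
    using \<open>e > 0\<close> le_Liminf_iff[THEN iffD1, rule_format, of 0 _ _ "ereal (- e)"] by simp
  moreover have "\<forall>\<^sub>F y in at x. y \<in> U"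
    using x open_domain by (simp add: eventually_at_in_open')
  moreover have "\<forall>\<^sub>F y in at x. y \<noteq> x" by (simp add: eventually_at_filter)
  ultimately have "\<forall>\<^sub>F y in at x. \<forall>s. support_function Q (F y) \<le> ereal s \<longrightarrow> v \<bullet> (y - x) - e * norm (y - x) \<le> s - c"
  proof eventually_elim
    case (elim y)
    show ?case
    proof (intro allI impI)
      fix s assume "support_function Q (F y) \<le> ereal s"
      then have "phi y \<le> ereal (phi0 + s)" using phi_le elim by blast
      then have "phi y - phi x - ereal (v \<bullet> (y - x)) \<le> ereal (phi0 + s) - phi x - ereal (v \<bullet> (y - x))"
        by (intro ereal_minus_mono) auto
      also have "\<dots> = ereal (s - c - v \<bullet> (y - x))" by (simp add: c)
      finally have "(phi y - phi x - ereal (v \<bullet> (y - x))) / ereal (norm (y - x))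
          \<le> ereal (s - c - v \<bullet> (y - x)) / ereal (norm (y - x))"
        using elim by (intro ereal_divide_right_mono) auto
      also have "\<dots> = ereal ((s - c - v \<bullet> (y - x)) / norm (y - x))" using elim by simp
      finally have "- e < (s - c - v \<bullet> (y - x)) / norm (y - x)"
        using elim(1) by (metis less_ereal.simps(1) order_less_le_trans)
      then show "v \<bullet> (y - x) - e * norm (y - x) \<le> s - c"
        using elim by (simp add: pos_less_divide_eq)
    qed
  qed
  \<comment> \<open>Including \<open>y = x\<close> passes from the punctured filter to
    \<open>nhds x\<close>, so the estimate can be used along arbitrary sequences converging to
    \<open>x\<close>.\<close>
  moreover have "\<forall>s. support_function Q (F x) \<le> ereal s \<longrightarrow> v \<bullet> (x - x) - e * norm (x - x) \<le> s - c"
    using decomposition[OF x] c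
    by (cases "support_function Q (F x)") (auto simp: phi_xbar)
  ultimately show ?thesis unfolding eventually_at_filter
    by (auto elim!: eventually_mono)
qed

text \<open>The smooth function \<open>phi0 + q \<bullet> F y\<close> minorizes \<open>phi\<close>
  on \<open>U\<close> and touches it at \<open>x\<close>, so its gradient is a regular
  subgradient.\<close>

lemma normal_imp_regular_subgradient:
  assumes x: "x \<in> U" and q: "F x \<in> normal_cone Q q"
  shows "adjoint (F1 x) q \<in> regular_subdifferential phi x"
proof -
  have qQ: "q \<in> Q" using q by (simp add: normal_cone_def)
  have fx: "phi x = ereal (phi0 + q \<bullet> F x)" using phi_normal[OF x q] .
  have "0 \<le> Liminf (at x) (\<lambda>y. (phi y - phi x - ereal (adjoint (F1 x) q \<bullet> (y - x))) / ereal (norm (y - x)))"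
    unfolding le_Liminf_iff
  proof (intro allI impI)
    fix a :: ereal assume "a < 0"
    then obtain e where e: "e < 0" "a < ereal e"
      by (metis ereal_dense2 zero_ereal_def less_ereal.simps(1))
    have "((\<lambda>y. (F y - F x - F1 x (y - x)) /\<^sub>R norm (y - x)) \<longlongrightarrow> 0) (at x)"
      using has_derivative_F[OF x] by (simp add: has_derivative_at')
         (simp add: tendsto_iff eventually_at dist_norm divide_inverse mult.commute)
    then have "((\<lambda>y. q \<bullet> ((F y - F x - F1 x (y - x)) /\<^sub>R norm (y - x))) \<longlongrightarrow> q \<bullet> 0) (at x)"
      by (intro tendsto_intros)
    then have "\<forall>\<^sub>F y in at x. e < q \<bullet> ((F y - F x - F1 x (y - x)) /\<^sub>R norm (y - x))"
      using e(1) by (simp add: order_tendstoD(1))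
    moreover have "\<forall>\<^sub>F y in at x. y \<in> U"
      using x open_domain by (simp add: eventually_at_in_open')
    moreover have "\<forall>\<^sub>F y in at x. y \<noteq> x" by (simp add: eventually_at_filter)
    ultimately show "\<forall>\<^sub>F y in at x. a < (phi y - phi x - ereal (adjoint (F1 x) q \<bullet> (y - x))) / ereal (norm (y - x))"
    proof eventually_elim
      case (elim y)
      have "ereal (q \<bullet> (F y - F x - F1 x (y - x))) = ereal (phi0 + q \<bullet> F y) - phi x - ereal (adjoint (F1 x) q \<bullet> (y - x))"
        using adjoint_F1_works[OF x, of "y - x" q] by (simp add: fx inner_diff_right inner_commute)
      also have "\<dots> \<le> phi y - phi x - ereal (adjoint (F1 x) q \<bullet> (y - x))"
        using phi_ge[OF elim(2) qQ] by (intro ereal_minus_mono) auto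
      finally have le: "ereal (q \<bullet> (F y - F x - F1 x (y - x))) / ereal (norm (y - x))
          \<le> (phi y - phi x - ereal (adjoint (F1 x) q \<bullet> (y - x))) / ereal (norm (y - x))"
        using elim by (intro ereal_divide_right_mono) auto
      have eq: "ereal (q \<bullet> (F y - F x - F1 x (y - x))) / ereal (norm (y - x))
        = ereal (q \<bullet> ((F y - F x - F1 x (y - x)) /\<^sub>R norm (y - x)))"
        using elim by (simp add: divide_inverse)
      have "ereal e < ereal (q \<bullet> ((F y - F x - F1 x (y - x)) /\<^sub>R norm (y - x)))"
        using elim(1) by (simp only: less_ereal.simps(1))
      with e(2) have lt: "a < ereal (q \<bullet> ((F y - F x - F1 x (y - x)) /\<^sub>R norm (y - x)))"
        by (rule order_less_trans)
      show ?case using lt le unfolding eq by (rule order_less_le_trans)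
    qed
  qed
  then show ?thesis by (simp add: regular_subdifferential_def fx)
qed

end

section \<open>Multipliers of regular and limiting subgradients\<close>

context regular_decomposition
begin

text \<open>Along feasible directions the image under \<open>F\<close> is a convex combination of
  \<open>F x\<close> and \<open>F x + F1 x h\<close> plus some \<open>d k\<close> in
  \<open>N\<close>. Sublinearity of the support function bounds its value there; \<open>d k\<close>
  contributes at most \<open>lam \<bullet> d k\<close>, which is negligible against
  \<open>ts k\<close>.\<close>

lemma regular_subgradient_linearization:
  assumes x: "x \<in> ball xbar r" and v: "v \<in> regular_subdifferential phi x"
    and c: "support_function Q (F x) = ereal c"
    and a: "support_function Q (F x + F1 x h) \<le> ereal a"
  shows "v \<bullet> h \<le> a - c"
proof -
  have xU: "x \<in> U" using x ball_domainD by blast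
  have phix: "phi x = ereal (phi0 + c)" using decomposition[OF xU] c by (simp add: phi_xbar)
  define ts where "ts k = 1 / real (Suc k)" for k
  have ts: "ts \<longlonglongrightarrow> 0" "\<And>k. ts k > 0" "\<And>k. ts k \<le> 1"
    unfolding ts_def using LIMSEQ_inverse_real_of_nat by (simp_all add: inverse_eq_divide field_simps)
  obtain hs where hs: "hs \<longlonglongrightarrow> h"
    and N: "\<forall>\<^sub>F k in sequentially. F (x + ts k *\<^sub>R hs k) - F x - ts k *\<^sub>R F1 x h \<in> N"
    using feasible_directions[OF tendsto_const x ts(1,2)] .
  define d where "d k = F (x + ts k *\<^sub>R hs k) - F x - ts k *\<^sub>R F1 x h" for k
  have "(\<lambda>k. (F (x + ts k *\<^sub>R hs k) - F x) /\<^sub>R ts k - F1 x h) \<longlonglongrightarrow> F1 x h - F1 x h"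
    by (intro tendsto_intros first_order_limit[OF _ xU] ts hs)
  moreover have "(F (x + ts k *\<^sub>R hs k) - F x) /\<^sub>R ts k - F1 x h = d k /\<^sub>R ts k" for k
    using ts(2)[of k] by (simp add: d_def scaleR_diff_right)
  ultimately have d0: "(\<lambda>k. d k /\<^sub>R ts k) \<longlonglongrightarrow> 0" by simp
  have lim_x: "(\<lambda>k. x + ts k *\<^sub>R hs k) \<longlonglongrightarrow> x"
    using tendsto_add[OF tendsto_const tendsto_scaleR[OF ts(1) hs], of x] by simp
  have main: "v \<bullet> h - e * norm h \<le> a - c" if "e > 0" for e
  proof -
    have "\<forall>\<^sub>F k in sequentially. \<forall>s. support_function Q (F (x + ts k *\<^sub>R hs k)) \<le> ereal s \<longrightarrow>
      v \<bullet> ((x + ts k *\<^sub>R hs k) - x) - e * norm ((x + ts k *\<^sub>R hs k) - x) \<le> s - c"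
      using regular_subgradient_bound[OF v xU phix that] lim_x
      by (rule eventually_compose_filterlim)
    with N have ev: "\<forall>\<^sub>F k in sequentially. v \<bullet> hs k - e * norm (hs k) \<le> a - c + lam \<bullet> (d k /\<^sub>R ts k)"
    proof eventually_elim
      case (elim k)
      let ?t = "ts k"
      have "support_function Q (F (x + ?t *\<^sub>R hs k)) \<le> ereal ((1 - ?t) * c + ?t * a + lam \<bullet> d k)"
        unfolding support_function_le_iff
      proof
        fix q assume q: "q \<in> Q"
        have "F (x + ?t *\<^sub>R hs k) = (1 - ?t) *\<^sub>R F x + ?t *\<^sub>R (F x + F1 x h) + d k"
          by (simp add: d_def algebra_simps)
        moreover have "q \<bullet> F x \<le> c" "q \<bullet> (F x + F1 x h) \<le> a" "q \<bullet> d k \<le> lam \<bullet> d k"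
          using c a q elim(1) mem_normal_coneD[of "d k"] support_function_le_iff
          by (metis order_refl, metis, simp add: d_def[symmetric])
        then have "(1 - ?t) * (q \<bullet> F x) + ?t * (q \<bullet> (F x + F1 x h)) + q \<bullet> d k
          \<le> (1 - ?t) * c + ?t * a + lam \<bullet> d k"
          using ts(2,3)[of k] by (intro add_mono mult_left_mono) auto
        ultimately show "q \<bullet> F (x + ?t *\<^sub>R hs k) \<le> (1 - ?t) * c + ?t * a + lam \<bullet> d k"
          by (simp only: inner_add_right inner_scaleR_right)
      qed
      with elim have "v \<bullet> ((x + ?t *\<^sub>R hs k) - x) - e * norm ((x + ?t *\<^sub>R hs k) - x)
          \<le> (1 - ?t) * c + ?t * a + lam \<bullet> d k - c" by blast
      then have "?t * (v \<bullet> hs k) - e * (?t * norm (hs k)) \<le> (1 - ?t) * c + ?t * a + lam \<bullet> d k - c"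
        using ts(2)[of k] by simp
      moreover have eq: "?t * (lam \<bullet> (d k /\<^sub>R ?t)) = lam \<bullet> d k" using ts(2)[of k] by simp
      ultimately have "?t * (v \<bullet> hs k - e * norm (hs k)) \<le> ?t * (a - c + lam \<bullet> (d k /\<^sub>R ?t))"
        unfolding distrib_left[of ?t "a - c"] eq by (simp add: algebra_simps)
      then show ?case using ts(2)[of k] by simp
    qed
    show ?thesis
    proof (rule tendsto_le[OF sequentially_bot _ _ ev])
      have "(\<lambda>k. a - c + lam \<bullet> (d k /\<^sub>R ts k)) \<longlonglongrightarrow> a - c + lam \<bullet> 0"
        by (intro tendsto_intros d0)
      then show "(\<lambda>k. a - c + lam \<bullet> (d k /\<^sub>R ts k)) \<longlonglongrightarrow> a - c" by simp
      show "(\<lambda>k. v \<bullet> hs k - e * norm (hs k)) \<longlonglongrightarrow> v \<bullet> h - e * norm h"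
        by (intro tendsto_intros hs)
    qed
  qed
  show ?thesis
  proof (rule field_le_epsilon)
    fix \<eta> :: real assume "\<eta> > 0"
    then have "v \<bullet> h - (\<eta> / (norm h + 1)) * norm h \<le> a - c"
      by (intro main divide_pos_pos) (auto simp: add_nonneg_pos)
    moreover have "(\<eta> / (norm h + 1)) * norm h \<le> \<eta>"
      using \<open>\<eta> > 0\<close> by (simp add: divide_simps add_nonneg_pos)
    ultimately show "v \<bullet> h \<le> a - c + \<eta>" by linarith
  qed
qed

text \<open>
  The multiplier is found by separating \<open>0\<close> from a convex set in the product of the image space and the
  reals; the separating functional is not vertical because of \<open>multiplier_bound\<close>.
\<close>

lemma regular_subgradient_multiplier:
  assumes x: "x \<in> ball xbar r" and v: "v \<in> regular_subdifferential phi x"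
  obtains q where "F x \<in> normal_cone Q q" "v = adjoint (F1 x) q"
proof -
  have xU: "x \<in> U" using x ball_domainD by blast
  have "\<bar>phi x\<bar> \<noteq> \<infinity>" using v
    unfolding regular_subdifferential_def mem_Collect_eq by (rule conjunct1)
  with xU obtain c where c: "support_function Q (F x) = ereal c" by (rule finite_phiE)
  have cq: "q \<bullet> F x \<le> c" if "q \<in> Q" for q
    using c support_function_le_iff that by (metis order_refl)
  \<comment> \<open>Here \<open>a\<close> bounds the increment of the support function from
    \<open>F x\<close> to \<open>F x + y\<close>. The strict inequality \<open>a < s\<close> keeps
    the origin out of \<open>S\<close>, since \<open>0 \<in> S\<close> would mean
    \<open>a < v \<bullet> h\<close>, against the linearized inequality.\<close>
  define S where "S = {(y - F1 x h, s - v \<bullet> h) |y h s. \<exists>a<s. \<forall>q\<in>Q. q \<bullet> (F x + y) \<le> c + a}"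
  have convS: "convex S"
    unfolding convex_def
  proof (intro ballI allI impI)
    fix z1 z2 and \<alpha> \<beta> :: real
    assume "z1 \<in> S" "z2 \<in> S" and ab: "0 \<le> \<alpha>" "0 \<le> \<beta>" "\<alpha> + \<beta> = 1"
    then obtain y1 h1 s1 a1 y2 h2 s2 a2 where
      1: "z1 = (y1 - F1 x h1, s1 - v \<bullet> h1)" "a1 < s1" "\<forall>q\<in>Q. q \<bullet> (F x + y1) \<le> c + a1" and
      2: "z2 = (y2 - F1 x h2, s2 - v \<bullet> h2)" "a2 < s2" "\<forall>q\<in>Q. q \<bullet> (F x + y2) \<le> c + a2"
      unfolding S_def by blast
    let ?y = "\<alpha> *\<^sub>R y1 + \<beta> *\<^sub>R y2" and ?h = "\<alpha> *\<^sub>R h1 + \<beta> *\<^sub>R h2"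
    let ?s = "\<alpha> * s1 + \<beta> * s2" and ?a = "\<alpha> * a1 + \<beta> * a2"
    have "\<alpha> *\<^sub>R z1 + \<beta> *\<^sub>R z2 = (?y - F1 x ?h, ?s - v \<bullet> ?h)"
      by (simp add: 1 2 linear_add[OF linear_F1[OF xU]] linear_cmul[OF linear_F1[OF xU]] algebra_simps)
    moreover have "?a < ?s"
    proof (cases "\<alpha> = 0")
      case False
      then show ?thesis using ab 1(2) 2(2) by (intro add_less_le_mono mult_strict_left_mono mult_left_mono) auto
    qed (use ab 2(2) in simp)
    moreover have "q \<bullet> (F x + ?y) \<le> c + ?a" if "q \<in> Q" for q
    proof -
      have z: "\<alpha> * z + \<beta> * z = z" for z using ab(3) by (metis distrib_right mult_1)
      have "q \<bullet> (F x + ?y) = \<alpha> * (q \<bullet> (F x + y1)) + \<beta> * (q \<bullet> (F x + y2))"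
        using z[of "q \<bullet> F x"] by (simp add: inner_add_right distrib_left)
      moreover have "c + ?a = \<alpha> * (c + a1) + \<beta> * (c + a2)"
        using z[of c] by (simp add: distrib_left)
      ultimately show ?thesis using 1(3) 2(3) that ab by (simp add: add_mono mult_left_mono)
    qed
    ultimately show "\<alpha> *\<^sub>R z1 + \<beta> *\<^sub>R z2 \<in> S" unfolding S_def by blast
  qed
  have zS: "0 \<notin> S"
  proof
    assume "0 \<in> S"
    then obtain h a where "a < v \<bullet> h" "\<forall>q\<in>Q. q \<bullet> (F x + F1 x h) \<le> c + a"
      unfolding S_def by (auto simp: zero_prod_def)
    then show False
      using regular_subgradient_linearization[OF x v c, of h "c + a"]
      by (simp add: support_function_le_iff)
  qed
  obtain w where w: "w \<noteq> 0" "\<And>z. z \<in> S \<Longrightarrow> 0 \<le> w \<bullet> z"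
    using separating_hyperplane_set_0[OF convS zS] by blast
  obtain \<mu> \<beta> where w_eq: "w = (\<mu>, \<beta>)" by (cases w)
  have nz: "(\<mu>, \<beta>) \<noteq> 0" using w(1) w_eq by simp
  have sep: "0 \<le> \<mu> \<bullet> (y - F1 x h) + \<beta> * (s - v \<bullet> h)"
    if "a < s" "\<And>q. q \<in> Q \<Longrightarrow> q \<bullet> (F x + y) \<le> c + a" for y h s a
  proof -
    have "(y - F1 x h, s - v \<bullet> h) \<in> S" unfolding S_def using that by blast
    from w(2)[OF this] show ?thesis by (simp add: w_eq)
  qed
  have F10: "F1 x 0 = 0" using linear_0[OF linear_F1[OF xU]] .
  have "0 \<le> \<beta>" using sep[of 0 1 0 0] cq F10 by simp
  have dir: "\<mu> \<bullet> F1 x h + \<beta> * (v \<bullet> h) = 0" for h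
  proof -
    have le: "\<mu> \<bullet> F1 x h + \<beta> * (v \<bullet> h) \<le> 0" for h
    proof (rule field_le_epsilon)
      fix e :: real assume "e > 0"
      have "0 \<le> \<mu> \<bullet> (0 - F1 x h) + \<beta> * (e / (\<beta> + 1) - v \<bullet> h)"
        using \<open>e > 0\<close> \<open>0 \<le> \<beta>\<close> cq by (intro sep[of 0]) auto
      moreover have "\<beta> * (e / (\<beta> + 1)) \<le> e"
        using \<open>e > 0\<close> \<open>0 \<le> \<beta>\<close> by (simp add: divide_simps)
      ultimately show "\<mu> \<bullet> F1 x h + \<beta> * (v \<bullet> h) \<le> 0 + e" by (simp add: right_diff_distrib)
    qed
    show ?thesis using le[of h] le[of "- h"] by (simp add: linear_neg[OF linear_F1[OF xU]])
  qed
  have "\<beta> \<noteq> 0"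
  proof
    assume "\<beta> = 0"
    have "- \<mu> \<bullet> d \<le> 0" if "d \<in> N" for d
    proof -
      have "q \<bullet> (F x + d) \<le> c + lam \<bullet> d" if "q \<in> Q" for q
        using cq[OF that] mem_normal_coneD[OF \<open>d \<in> N\<close> that] by (simp add: inner_add_right)
      then show ?thesis using sep[of "lam \<bullet> d" "lam \<bullet> d + 1" d 0] \<open>\<beta> = 0\<close> F10 by simp
    qed
    then have "norm (- \<mu>) \<le> C * norm (adjoint (F1 x) (- \<mu>))" by (rule multiplier_bound[OF x])
    moreover have "adjoint (F1 x) (- \<mu>) = 0"
    proof -
      have "h \<bullet> adjoint (F1 x) (- \<mu>) = 0" for h
        using dir[of h] \<open>\<beta> = 0\<close> by (simp add: adjoint_F1_works[OF xU] inner_commute)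
      then show ?thesis using inner_eq_zero_iff by blast
    qed
    ultimately show False using nz \<open>\<beta> = 0\<close> by (simp add: zero_prod_def)
  qed
  with \<open>0 \<le> \<beta>\<close> have "\<beta> > 0" by simp
  define q where "q = - (\<mu> /\<^sub>R \<beta>)"
  \<comment> \<open>Thus \<open>q\<close> is a convex subgradient of the support function at
    \<open>F x\<close>. Membership in \<open>Q\<close> and normality of \<open>F x\<close> are then
    read off from suitable choices of \<open>y\<close>.\<close>
  have qd: "q \<bullet> y \<le> a" if "\<And>q'. q' \<in> Q \<Longrightarrow> q' \<bullet> (F x + y) \<le> c + a" for y a
  proof (rule field_le_epsilon)
    fix e :: real assume "e > 0"
    then have "0 \<le> \<mu> \<bullet> (y - F1 x 0) + \<beta> * ((a + e) - v \<bullet> 0)" using that by (intro sep[of a]) auto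
    then have "- (\<mu> \<bullet> y) \<le> \<beta> * (a + e)" by (simp add: F10)
    then have "(- (\<mu> \<bullet> y)) / \<beta> \<le> a + e" using \<open>\<beta> > 0\<close> by (subst pos_divide_le_eq) (simp_all add: mult.commute)
    then show "q \<bullet> y \<le> a + e" by (simp add: q_def divide_inverse mult.commute)
  qed
  have "q \<in> Q"
  proof (rule ccontr)
    assume "q \<notin> Q"
    then obtain w b where w: "w \<bullet> q < b" "\<And>q'. q' \<in> Q \<Longrightarrow> w \<bullet> q' > b"
      using separating_hyperplane_closed_point[OF convex_Q closed_Q] by blast
    have "q \<bullet> (- w) \<le> - b"
    proof (rule qd)
      fix q' assume "q' \<in> Q"
      then show "q' \<bullet> (F x + - w) \<le> c + - b"
        using cq[of q'] w(2)[of q'] by (simp add: inner_diff_right inner_commute)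
    qed
    then show False using w(1) by (simp add: inner_commute)
  qed
  moreover have "F x \<bullet> (q' - q) \<le> 0" if "q' \<in> Q" for q'
    using qd[of "- F x" "- c"] cq[OF that] by (simp add: inner_diff_right inner_commute)
  ultimately have "F x \<in> normal_cone Q q" by (simp add: normal_cone_def)
  moreover have "v = adjoint (F1 x) q"
  proof -
    have "h \<bullet> (adjoint (F1 x) q - v) = 0" for h
    proof -
      have "F1 x h \<bullet> q = - (\<mu> \<bullet> F1 x h) / \<beta>" by (simp add: q_def divide_inverse inner_commute)
      also have "\<dots> = v \<bullet> h" using dir[of h] \<open>\<beta> > 0\<close> by (simp add: field_simps)
      finally show ?thesis by (simp add: inner_diff_right adjoint_F1_works[OF xU] inner_commute)
    qed
    then show ?thesis by (metis eq_iff_diff_eq_0 inner_eq_zero_iff)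
  qed
  ultimately show thesis by (rule that)
qed

text \<open>By definition of \<open>N\<close>, the difference \<open>q - lam\<close> pairs
  nonpositively with all of \<open>N\<close>, so \<open>multiplier_bound\<close> applies to
  it.\<close>

lemma multiplier_estimate:
  assumes "x \<in> ball xbar r" "q \<in> Q"
  shows "norm (q - lam) \<le> C * norm (adjoint (F1 x) (q - lam))"
  using assms mem_normal_coneD
  by (intro multiplier_bound) (auto simp: inner_diff_left)

text \<open>Multipliers of regular subgradients at nearby points stay bounded by
  \<open>multiplier_estimate\<close>, and their cluster points are multipliers of the limit because
  the normality relation is closed. Conversely, a multiplier even yields a regular
  subgradient.\<close>

lemma limiting_subdifferential_eq:
  assumes x: "x \<in> ball xbar r"
  shows "limiting_subdifferential phi x = {adjoint (F1 x) q |q. F x \<in> normal_cone Q q}"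
proof (intro equalityI subsetI)
  have xU: "x \<in> U" using x ball_domainD by blast
  fix v assume "v \<in> limiting_subdifferential phi x"
  then obtain xs vs where xs: "xs \<longlonglongrightarrow> x" and vs: "vs \<longlonglongrightarrow> v"
    and reg: "\<And>k. vs k \<in> regular_subdifferential phi (xs k)"
    unfolding limiting_subdifferential_def by blast
  have "\<forall>\<^sub>F k in sequentially. xs k \<in> ball xbar r"
    using xs x by (intro topological_tendstoD) auto
  then obtain K where K: "\<And>k. k \<ge> K \<Longrightarrow> xs k \<in> ball xbar r" by (auto simp: eventually_sequentially)
  have xs': "(\<lambda>k. xs (k + K)) \<longlonglongrightarrow> x" and vs': "(\<lambda>k. vs (k + K)) \<longlonglongrightarrow> v"
    using xs vs by (auto intro: LIMSEQ_ignore_initial_segment)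
  have "\<exists>q. F (xs (k + K)) \<in> normal_cone Q q \<and> vs (k + K) = adjoint (F1 (xs (k + K))) q" for k
    using regular_subgradient_multiplier[OF K reg] by (metis le_add2)
  then obtain qs where qs: "\<And>k. F (xs (k + K)) \<in> normal_cone Q (qs k)"
    "\<And>k. vs (k + K) = adjoint (F1 (xs (k + K))) (qs k)" by metis
  have qsQ: "qs k \<in> Q" for k using qs(1)[of k] by (simp add: normal_cone_def)
  have le: "norm (qs k) \<le> norm lam + C * norm (vs (k + K) - adjoint (F1 (xs (k + K))) lam)" for k
  proof -
    have "norm (qs k - lam) \<le> C * norm (adjoint (F1 (xs (k + K))) (qs k - lam))"
      using K qsQ by (intro multiplier_estimate) auto
    then show ?thesis
      using linear_diff[OF linear_adjoint_F1[OF ball_domainD[OF K[of "k + K"]]], of "qs k" lam]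
        norm_triangle_ineq2[of "qs k" lam] by (simp add: qs(2))
  qed
  have lim: "(\<lambda>k. norm lam + C * norm (vs (k + K) - adjoint (F1 (xs (k + K))) lam)) \<longlonglongrightarrow>
      norm lam + C * norm (v - adjoint (F1 x) lam)"
    by (intro tendsto_intros tendsto_adjoint_F1 xs' vs' xU)
  obtain B where B: "\<And>k. norm (norm lam + C * norm (vs (k + K) - adjoint (F1 (xs (k + K))) lam)) \<le> B"
    using BseqD[OF convergent_imp_Bseq[OF convergentI[OF lim]]] by blast
  have "norm (qs k) \<le> B" for k using le[of k] B[of k] unfolding real_norm_def by linarith
  then have "bounded (range qs)" by (auto simp: bounded_iff)
  then obtain \<sigma> q where \<sigma>: "strict_mono \<sigma>" and q: "(\<lambda>k. qs (\<sigma> k)) \<longlonglongrightarrow> q"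
    using bounded_imp_convergent_subsequence[of qs] by (auto simp: o_def)
  have xsub: "(\<lambda>k. xs (\<sigma> k + K)) \<longlonglongrightarrow> x" and vsub: "(\<lambda>k. vs (\<sigma> k + K)) \<longlonglongrightarrow> v"
    using LIMSEQ_subseq_LIMSEQ[OF xs' \<sigma>] LIMSEQ_subseq_LIMSEQ[OF vs' \<sigma>] by (simp_all add: o_def)
  have "q \<in> Q" using closed_sequentially[OF closed_Q _ q] qsQ by blast
  moreover have "F x \<bullet> (q' - q) \<le> 0" if "q' \<in> Q" for q'
  proof (rule tendsto_upperbound[OF _ _ sequentially_bot])
    have "isCont F x" using has_derivative_continuous[OF has_derivative_F[OF xU]] .
    then show "(\<lambda>k. F (xs (\<sigma> k + K)) \<bullet> (q' - qs (\<sigma> k))) \<longlonglongrightarrow> F x \<bullet> (q' - q)"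
      by (intro tendsto_intros q isCont_tendsto_compose[OF _ xsub])
    show "\<forall>\<^sub>F k in sequentially. F (xs (\<sigma> k + K)) \<bullet> (q' - qs (\<sigma> k)) \<le> 0"
      using qs(1) that by (auto simp: normal_cone_def)
  qed
  moreover have "v = adjoint (F1 x) q"
  proof (rule LIMSEQ_unique[OF vsub])
    show "(\<lambda>k. vs (\<sigma> k + K)) \<longlonglongrightarrow> adjoint (F1 x) q"
      unfolding qs(2) by (intro tendsto_adjoint_F1 xsub q xU)
  qed
  ultimately show "v \<in> {adjoint (F1 x) q |q. F x \<in> normal_cone Q q}"
    by (auto simp: normal_cone_def)
next
  fix v assume "v \<in> {adjoint (F1 x) q |q. F x \<in> normal_cone Q q}"
  then show "v \<in> limiting_subdifferential phi x"
    using normal_imp_regular_subgradient[OF ball_domainD[OF x]] regular_imp_limiting by blast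
qed

lemma limiting_subdifferential_xbar: "limiting_subdifferential phi xbar = adjoint (F1 xbar) ` Q"
  using limiting_subdifferential_eq[of xbar] r_pos by (auto simp: F_xbar normal_cone_def)

text \<open>By \<open>multiplier_estimate\<close> no other point of \<open>Q\<close> has the same
  image as \<open>lam\<close>, and taking relative interiors of convex sets commutes with linear
  images.\<close>

lemma subgradient_rel_interior_iff:
  "adjoint (F1 xbar) lam \<in> rel_interior (limiting_subdifferential phi xbar) \<longleftrightarrow> lam \<in> rel_interior Q"
proof -
  have lin: "linear (adjoint (F1 xbar))" using linear_adjoint_F1[OF xbar_domain] .
  have "lam = q" if "q \<in> Q" "adjoint (F1 xbar) lam = adjoint (F1 xbar) q" for q
    using multiplier_estimate[of xbar q] that r_pos by (simp add: linear_diff[OF lin])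
  moreover have "rel_interior (adjoint (F1 xbar) ` Q) = adjoint (F1 xbar) ` rel_interior Q"
    using rel_interior_convex_linear_image[OF lin convex_Q] by simp
  ultimately show ?thesis
    using rel_interior_subset[of Q] unfolding limiting_subdifferential_xbar by fast
qed

end

section \<open>Strict twice epi-differentiability\<close>

text \<open>The orthogonal complement of the linear space parallel to
  \<open>affine hull Q\<close>.\<close>

definition annihilator :: "'b::euclidean_space set \<Rightarrow> 'b set" where
  "annihilator Q = {w. \<forall>q1\<in>Q. \<forall>q2\<in>Q. w \<bullet> q1 = w \<bullet> q2}"

lemma annihilatorD: "w \<in> annihilator Q \<Longrightarrow> q1 \<in> Q \<Longrightarrow> q2 \<in> Q \<Longrightarrow> w \<bullet> q1 = w \<bullet> q2"
  unfolding annihilator_def by blast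

lemma annihilator_add: "v \<in> annihilator Q \<Longrightarrow> w \<in> annihilator Q \<Longrightarrow> v + w \<in> annihilator Q"
  unfolding annihilator_def mem_Collect_eq inner_add_left by metis

lemma annihilator_scale: "v \<in> annihilator Q \<Longrightarrow> a *\<^sub>R v \<in> annihilator Q"
  unfolding annihilator_def mem_Collect_eq inner_scaleR_left by metis

lemma annihilator_subset_normal_cone: "q \<in> Q \<Longrightarrow> annihilator Q \<subseteq> normal_cone Q q"
  unfolding normal_cone_def by (auto simp: inner_diff_right dest: annihilatorD)

text \<open>A segment from any \<open>q'\<close> in \<open>Q\<close> to a relatively interior
  \<open>q\<close> can be prolonged beyond \<open>q\<close> within \<open>Q\<close>, so a linear
  function maximized at \<open>q\<close> is constant on \<open>Q\<close>.\<close>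

lemma normal_cone_rel_interior:
  assumes "convex Q" "q \<in> rel_interior Q"
  shows "normal_cone Q q = annihilator Q"
proof
  have qQ: "q \<in> Q" using assms rel_interior_subset by blast
  then have ne: "Q \<noteq> {}" by blast
  from qQ show "annihilator Q \<subseteq> normal_cone Q q" by (rule annihilator_subset_normal_cone)
  show "normal_cone Q q \<subseteq> annihilator Q"
  proof
    fix w assume w: "w \<in> normal_cone Q q"
    have eq: "w \<bullet> q' = w \<bullet> q" if q': "q' \<in> Q" for q'
    proof -
      obtain e where e: "e > 1" "(1 - e) *\<^sub>R q' + e *\<^sub>R q \<in> Q"
        using convex_rel_interior_iff[OF assms(1) ne] assms(2) q' by blast
      have "w \<bullet> q' \<le> w \<bullet> q" using mem_normal_coneD[OF w q'] by (simp add: inner_commute)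
      moreover have "(1 - e) * (w \<bullet> q') + e * (w \<bullet> q) \<le> w \<bullet> q"
        using mem_normal_coneD[OF w e(2)] by (simp add: inner_add_left inner_commute[of w])
      then have "(e - 1) * (w \<bullet> q) \<le> (e - 1) * (w \<bullet> q')" by (simp add: algebra_simps)
      then have "w \<bullet> q \<le> w \<bullet> q'" using e(1) by simp
      ultimately show ?thesis by simp
    qed
    show "w \<in> annihilator Q" unfolding annihilator_def
    proof (intro CollectI ballI)
      fix q1 q2 assume "q1 \<in> Q" "q2 \<in> Q"
      then show "w \<bullet> q1 = w \<bullet> q2" by (simp only: eq)
    qed
  qed
qed

lemma rel_interior_nearE:
  fixes Q :: "'a::euclidean_space set"
  assumes "q \<in> rel_interior Q"
  obtains e where "e > 0" "\<And>q'. q' \<in> affine hull Q \<Longrightarrow> dist q' q < e \<Longrightarrow> q' \<in> rel_interior Q"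
  using openin_rel_interior[of Q] assms unfolding openin_euclidean_subtopology_iff by blast

text \<open>The Frechet error is a small multiple of the step length, uniformly in the direction, so
  directions may converge along with the steps.\<close>

lemma has_derivative_directional_limit:
  assumes "(f has_derivative D) (at x)" "ts \<longlonglongrightarrow> 0" "\<And>k. ts k > 0" "hs \<longlonglongrightarrow> h"
  shows "(\<lambda>k. (f (x + ts k *\<^sub>R hs k) - f x) /\<^sub>R ts k) \<longlonglongrightarrow> D h"
proof -
  have bl: "bounded_linear D" using assms(1) by (rule has_derivative_bounded_linear)
  have "(\<lambda>k. (f (x + ts k *\<^sub>R hs k) - f x) /\<^sub>R ts k - D (hs k)) \<longlonglongrightarrow> 0"
    unfolding tendsto_iff
  proof (intro allI impI)
    fix \<epsilon> :: real assume "\<epsilon> > 0"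
    define e where "e = \<epsilon> / (norm h + 2)"
    have n: "norm h + 2 > 0" using norm_ge_zero[of h] by linarith
    have "e > 0" using \<open>\<epsilon> > 0\<close> n by (simp add: e_def)
    then obtain d where d: "d > 0"
      "\<And>y. norm (y - x) < d \<Longrightarrow> norm (f y - f x - D (y - x)) \<le> e * norm (y - x)"
      using assms(1) unfolding has_derivative_at_alt by blast
    have "(\<lambda>k. norm (ts k *\<^sub>R hs k)) \<longlonglongrightarrow> norm (0 *\<^sub>R h)" by (intro tendsto_intros assms)
    then have "\<forall>\<^sub>F k in sequentially. norm (ts k *\<^sub>R hs k) < d" using d(1) by (auto dest: order_tendstoD(2))
    moreover have "(\<lambda>k. norm (hs k)) \<longlonglongrightarrow> norm h" by (intro tendsto_intros assms)
    then have "\<forall>\<^sub>F k in sequentially. norm (hs k) < norm h + 1" by (rule order_tendstoD(2)) simp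
    ultimately show "\<forall>\<^sub>F k in sequentially. dist ((f (x + ts k *\<^sub>R hs k) - f x) /\<^sub>R ts k - D (hs k)) 0 < \<epsilon>"
    proof eventually_elim
      case (elim k)
      have t: "ts k > 0" by (rule assms)
      have "(f (x + ts k *\<^sub>R hs k) - f x) /\<^sub>R ts k - D (hs k)
          = (f (x + ts k *\<^sub>R hs k) - f x - D (ts k *\<^sub>R hs k)) /\<^sub>R ts k"
        using t by (simp add: scaleR_diff_right linear_cmul[OF bounded_linear.linear[OF bl]])
      then have "norm ((f (x + ts k *\<^sub>R hs k) - f x) /\<^sub>R ts k - D (hs k))
          = norm (f (x + ts k *\<^sub>R hs k) - f x - D (ts k *\<^sub>R hs k)) / ts k"
        using t by (simp add: divide_inverse)
      also have "\<dots> \<le> (e * norm (ts k *\<^sub>R hs k)) / ts k"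
        using d(2)[of "x + ts k *\<^sub>R hs k"] elim t by (intro divide_right_mono) auto
      also have "\<dots> = e * norm (hs k)" using t by simp
      also have "\<dots> \<le> e * (norm h + 1)" using elim \<open>e > 0\<close> by (intro mult_left_mono) auto
      also have "\<dots> < e * (norm h + 2)" using \<open>e > 0\<close> by (intro mult_strict_left_mono) auto
      also have "\<dots> = \<epsilon>" using n by (simp add: e_def)
      finally show ?case by (simp add: dist_norm)
    qed
  qed
  moreover have "(\<lambda>k. D (hs k)) \<longlonglongrightarrow> D h" by (rule bounded_linear.tendsto[OF bl assms(4)])
  ultimately show ?thesis using tendsto_add by fastforce
qed

context regular_decomposition
begin

text \<open>Otherwise a supporting hyperplane yields \<open>a\<close> with
  \<open>- a \<in> N\<close>. Solving \<open>- a = F1 xbar h - w\<close> puts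
  \<open>F1 xbar h = w - a\<close> into \<open>N\<close>, and this vector pairs strictly negatively
  with \<open>q - lam\<close> for relatively interior \<open>q\<close>.\<close>

lemma rel_interior_criterion:
  assumes "\<And>h q. F1 xbar h \<in> N \<Longrightarrow> q \<in> Q \<Longrightarrow> F1 xbar h \<bullet> (q - lam) = 0"
  shows "lam \<in> rel_interior Q"
proof (rule ccontr)
  assume "lam \<notin> rel_interior Q"
  then obtain a where a: "\<And>y. y \<in> Q \<Longrightarrow> a \<bullet> lam \<le> a \<bullet> y" "\<And>y. y \<in> rel_interior Q \<Longrightarrow> a \<bullet> lam < a \<bullet> y"
    using supporting_hyperplane_rel_boundary[OF convex_Q lam_Q] by metis
  have "- a \<in> {F1 xbar h - w |h w. w \<in> N}" unfolding nondegenerate ..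
  then obtain h w where hw: "- a = F1 xbar h - w" "w \<in> N" by blast
  have "- a \<in> N" using a(1) lam_Q by (auto simp: normal_cone_def inner_diff_right)
  with hw have hN: "F1 xbar h \<in> N" using normal_cone_add[of "- a" Q lam w] by simp
  obtain q where q: "q \<in> rel_interior Q"
    using rel_interior_eq_empty[OF convex_Q] lam_Q by blast
  then have qQ: "q \<in> Q" using rel_interior_subset by blast
  have "F1 xbar h = w - a" using hw(1) by (simp add: algebra_simps)
  then have "(w - a) \<bullet> (q - lam) = 0" using assms[OF hN qQ] by simp
  moreover have "w \<bullet> (q - lam) \<le> 0" using hw(2) qQ by (auto simp: normal_cone_def)
  ultimately show False using a(2)[OF q] by (simp add: inner_diff_left inner_diff_right)
qed

text \<open>The multiplier \<open>q\<close> gives the exact value at the base point, while any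
  \<open>q'\<close> in \<open>Q\<close> gives a lower bound at the displaced point. The freedom to
  take \<open>q'\<close> different from \<open>q\<close> is what later makes quotients
  explode.\<close>

lemma second_diff_quot_ge:
  assumes "x \<in> U" "F x \<in> normal_cone Q q" "x + t *\<^sub>R h \<in> U" "q' \<in> Q" "t > 0"
  shows "ereal (2 / t\<^sup>2 * (q' \<bullet> F (x + t *\<^sub>R h) - q \<bullet> F x - t * (v \<bullet> h))) \<le> second_diff_quot phi t x v h"
proof -
  have "ereal (q' \<bullet> F (x + t *\<^sub>R h) - q \<bullet> F x - t * (v \<bullet> h)) =
    ereal (phi0 + q' \<bullet> F (x + t *\<^sub>R h)) - phi x - ereal (t * (v \<bullet> h))"
    by (simp add: phi_normal[OF assms(1,2)])
  also have "\<dots> \<le> phi (x + t *\<^sub>R h) - phi x - ereal (t * (v \<bullet> h))"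
    by (intro ereal_minus_mono phi_ge assms order_refl)
  finally have "ereal (q' \<bullet> F (x + t *\<^sub>R h) - q \<bullet> F x - t * (v \<bullet> h)) / ereal (1 / 2 * t\<^sup>2)
     \<le> second_diff_quot phi t x v h"
    unfolding second_diff_quot_def using assms(5) by (intro ereal_divide_right_mono) auto
  then show ?thesis using assms(5) by (simp add: mult.commute)
qed

lemma second_diff_quot_eq:
  assumes "x \<in> U" "F x \<in> normal_cone Q q" "x + t *\<^sub>R h \<in> U" "F (x + t *\<^sub>R h) \<in> normal_cone Q q'" "t > 0"
  shows "second_diff_quot phi t x v h = ereal (2 / t\<^sup>2 * (q' \<bullet> F (x + t *\<^sub>R h) - q \<bullet> F x - t * (v \<bullet> h)))"
  unfolding second_diff_quot_def phi_normal[OF assms(1,2)] phi_normal[OF assms(3,4)]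
  using assms(5) by (simp add: mult.commute)

text \<open>Pairing the adjoint image with \<open>hs k\<close> amounts to pairing
  \<open>qs k\<close> with the linear Taylor term, so only the second-order remainder is left, and
  it may be paired with convergent multipliers.\<close>

lemma second_order_limit:
  assumes "xs \<longlonglongrightarrow> x" "x \<in> U" "ts \<longlonglongrightarrow> 0" "\<And>k. ts k > 0" "hs \<longlonglongrightarrow> h" "qs \<longlonglongrightarrow> q"
  shows "(\<lambda>k. 2 / (ts k)\<^sup>2 * (qs k \<bullet> F (xs k + ts k *\<^sub>R hs k) - qs k \<bullet> F (xs k)
      - ts k * (adjoint (F1 (xs k)) (qs k) \<bullet> hs k))) \<longlonglongrightarrow> q \<bullet> F2 x h h"
proof -
  have lim: "(\<lambda>k. qs k \<bullet> ((2 / (ts k)\<^sup>2) *\<^sub>R (F (xs k + ts k *\<^sub>R hs k) - F (xs k) - ts k *\<^sub>R F1 (xs k) (hs k))))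
      \<longlonglongrightarrow> q \<bullet> F2 x h h"
    by (intro tendsto_inner Taylor_limit assms)
  have "\<forall>\<^sub>F k in sequentially. xs k \<in> U"
    using assms open_domain topological_tendstoD by blast
  then have "\<forall>\<^sub>F k in sequentially.
      qs k \<bullet> ((2 / (ts k)\<^sup>2) *\<^sub>R (F (xs k + ts k *\<^sub>R hs k) - F (xs k) - ts k *\<^sub>R F1 (xs k) (hs k))) =
      2 / (ts k)\<^sup>2 * (qs k \<bullet> F (xs k + ts k *\<^sub>R hs k) - qs k \<bullet> F (xs k) - ts k * (adjoint (F1 (xs k)) (qs k) \<bullet> hs k))"
  proof eventually_elim
    case (elim k)
    have "adjoint (F1 (xs k)) (qs k) \<bullet> hs k = qs k \<bullet> F1 (xs k) (hs k)"
      by (metis adjoint_F1_works[OF elim] inner_commute)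
    then show ?case by (simp only: inner_scaleR_right inner_diff_right)
  qed
  from tendsto_cong[OF this] lim show ?thesis by blast
qed

lemma eventually_domain:
  assumes "xs \<longlonglongrightarrow> x" "x \<in> ball xbar r" "ts \<longlonglongrightarrow> 0" "hs \<longlonglongrightarrow> h"
  shows "\<forall>\<^sub>F k in sequentially. xs k \<in> ball xbar r \<and> xs k + ts k *\<^sub>R hs k \<in> ball xbar r"
proof (rule eventually_conj)
  show "\<forall>\<^sub>F k in sequentially. xs k \<in> ball xbar r"
    using assms by (intro topological_tendstoD) auto
  have "(\<lambda>k. xs k + ts k *\<^sub>R hs k) \<longlonglongrightarrow> x + 0 *\<^sub>R h" by (intro tendsto_intros assms)
  then show "\<forall>\<^sub>F k in sequentially. xs k + ts k *\<^sub>R hs k \<in> ball xbar r"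
    using assms(2) by (intro topological_tendstoD) auto
qed

text \<open>Multipliers of subgradients close to the given one are close to \<open>q\<close> and
  therefore have the same normal cone \<open>annihilator Q\<close>. Tangential directions are
  governed by the Taylor expansion; all others make the quotients explode.\<close>

lemma strictly_twice_epi_differentiable_rel_interior:
  assumes lam_ri: "lam \<in> rel_interior Q"
    and x: "x \<in> ball xbar r" and q_ri: "q \<in> rel_interior Q" and Fx: "F x \<in> normal_cone Q q"
  shows "strictly_twice_epi_differentiable phi x (adjoint (F1 x) q)"
proof -
  let ?K = "annihilator Q"
  define \<theta> where "\<theta> h = (if F1 x h \<in> ?K then ereal (q \<bullet> F2 x h h) else \<infinity>)" for h
  have xU: "x \<in> U" using x ball_domainD by blast
  have qQ: "q \<in> Q" using q_ri rel_interior_subset by blast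
  have NK: "N = ?K" using normal_cone_rel_interior[OF convex_Q lam_ri] .
  obtain e where e: "e > 0" "\<And>q'. q' \<in> affine hull Q \<Longrightarrow> dist q' q < e \<Longrightarrow> q' \<in> rel_interior Q"
    using rel_interior_nearE[OF q_ri] by blast
  have "epi_converges (\<lambda>k. second_diff_quot phi (ts k) (xs k) (vs k)) \<theta>"
    if ts: "\<And>k. ts k > 0" "ts \<longlonglongrightarrow> 0" and vs: "\<And>k. vs k \<in> limiting_subdifferential phi (xs k)"
      and xs: "xs \<longlonglongrightarrow> x" and vlim: "vs \<longlonglongrightarrow> adjoint (F1 x) q" for ts xs vs
  proof -
    have evb: "\<forall>\<^sub>F k in sequentially. xs k \<in> ball xbar r"
      using xs x by (intro topological_tendstoD) auto
    have "\<forall>k. \<exists>l. xs k \<in> ball xbar r \<longrightarrow> F (xs k) \<in> normal_cone Q l \<and> vs k = adjoint (F1 (xs k)) l"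
      using vs limiting_subdifferential_eq by blast
    then obtain ls where ls: "\<And>k. xs k \<in> ball xbar r \<Longrightarrow> F (xs k) \<in> normal_cone Q (ls k)"
      "\<And>k. xs k \<in> ball xbar r \<Longrightarrow> vs k = adjoint (F1 (xs k)) (ls k)" by metis
    have lsQ: "ls k \<in> Q" if "xs k \<in> ball xbar r" for k
      using ls(1)[OF that] by (simp add: normal_cone_def)
    have lslim: "ls \<longlonglongrightarrow> q"
    proof (rule LIM_zero_cancel, rule Lim_null_comparison)
      show "\<forall>\<^sub>F k in sequentially. norm (ls k - q) \<le> C * norm (vs k - adjoint (F1 (xs k)) q)"
        using evb
      proof eventually_elim
        case (elim k)
        \<comment> \<open>The pairing is in fact zero, as \<open>d\<close> takes the same value at
          all points of \<open>Q\<close>. So \<open>multiplier_bound\<close> applies although the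
          reference multiplier is \<open>q\<close> instead of \<open>lam\<close>.\<close>
        have "(ls k - q) \<bullet> d \<le> 0" if "d \<in> N" for d
          using annihilatorD[of d Q "ls k" q] that lsQ[OF elim] qQ NK
          by (simp add: inner_commute[of "ls k - q" d] inner_diff_right)
        then have "norm (ls k - q) \<le> C * norm (adjoint (F1 (xs k)) (ls k - q))"
          by (rule multiplier_bound[OF elim])
        then show ?case using ls(2)[OF elim] linear_diff[OF linear_adjoint_F1[OF ball_domainD[OF elim]]]
          by simp
      qed
      have "(\<lambda>k. C * norm (vs k - adjoint (F1 (xs k)) q)) \<longlonglongrightarrow> C * norm (adjoint (F1 x) q - adjoint (F1 x) q)"
        by (intro tendsto_intros vlim tendsto_adjoint_F1 xs xU)
      then show "(\<lambda>k. C * norm (vs k - adjoint (F1 (xs k)) q)) \<longlonglongrightarrow> 0" by simp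
    qed
    \<comment> \<open>The radius is half of \<open>e\<close> in order to leave room for shifting
      \<open>ls k\<close> by \<open>d *\<^sub>R \<eta>\<close> below.\<close>
    have near: "\<forall>\<^sub>F k in sequentially. xs k \<in> ball xbar r \<and> dist (ls k) q < e / 2"
      using e(1) by (intro eventually_conj evb tendstoD[OF lslim]) simp
    have ri: "ls k \<in> rel_interior Q" if "xs k \<in> ball xbar r \<and> dist (ls k) q < e / 2" for k
      using that lsQ e hull_subset[of Q affine] by (intro e(2)) auto
    have FK: "F (xs k) \<in> ?K" if "xs k \<in> ball xbar r \<and> dist (ls k) q < e / 2" for k
      using ls(1)[of k] normal_cone_rel_interior[OF convex_Q ri[OF that]] that by blast
    define G where "G hs k = 2 / (ts k)\<^sup>2 * (ls k \<bullet> F (xs k + ts k *\<^sub>R hs k) - ls k \<bullet> F (xs k)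
      - ts k * (adjoint (F1 (xs k)) (ls k) \<bullet> hs k))" for hs k
    have Glim: "G hs \<longlonglongrightarrow> q \<bullet> F2 x h h" if "hs \<longlonglongrightarrow> h" for hs h
      unfolding G_def by (rule second_order_limit[OF xs xU ts(2,1) that lslim])
    have lower: "\<theta> h \<le> liminf (\<lambda>k. second_diff_quot phi (ts k) (xs k) (vs k) (hs k))"
      if hs: "hs \<longlonglongrightarrow> h" for hs h
    proof (cases "F1 x h \<in> ?K")
      case True
      have "\<forall>\<^sub>F k in sequentially. ereal (G hs k) \<le> second_diff_quot phi (ts k) (xs k) (vs k) (hs k)"
        using eventually_domain[OF xs x ts(2) hs]
      proof eventually_elim
        case (elim k)
        then show ?case unfolding G_def
          using second_diff_quot_ge[OF _ ls(1) _ lsQ ts(1)] ls(2) ball_domainD by metis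
      qed
      then have "liminf (\<lambda>k. ereal (G hs k)) \<le> liminf (\<lambda>k. second_diff_quot phi (ts k) (xs k) (vs k) (hs k))"
        by (rule Liminf_mono)
      moreover have "liminf (\<lambda>k. ereal (G hs k)) = ereal (q \<bullet> F2 x h h)"
        using Glim[OF hs] by (intro lim_imp_Liminf) auto
      ultimately show ?thesis using True by (simp add: \<theta>_def)
    next
      case False
      then obtain p1 p2 where p12: "p1 \<in> Q" "p2 \<in> Q" "F1 x h \<bullet> p1 \<noteq> F1 x h \<bullet> p2"
        unfolding annihilator_def by blast
      obtain q1 q2 where q12: "q1 \<in> Q" "q2 \<in> Q" "F1 x h \<bullet> q1 > F1 x h \<bullet> q2"
      proof (cases "F1 x h \<bullet> p1 < F1 x h \<bullet> p2")
        case True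
        then show ?thesis using that[of p2 p1] p12 by blast
      next
        case False
        then show ?thesis using that[of p1 p2] p12 by linarith
      qed
      define \<eta> where "\<eta> = q1 - q2"
      have \<eta>: "\<eta> \<bullet> F1 x h > 0" using q12(3) by (simp add: \<eta>_def inner_diff_left inner_commute)
      define d where "d = e / (2 * (norm \<eta> + 1))"
      have n: "norm \<eta> + 1 > 0" using norm_ge_zero[of \<eta>] by linarith
      have d: "d > 0" "d * norm \<eta> < e / 2" using e(1) n by (simp_all add: d_def divide_simps)
      have inQ: "ls k + d *\<^sub>R \<eta> \<in> Q" if "xs k \<in> ball xbar r \<and> dist (ls k) q < e / 2" for k
      proof -
        have "ls k + d *\<^sub>R \<eta> \<in> affine hull Q"
          unfolding \<eta>_def using lsQ[of k] that q12 hull_subset[of Q affine]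
          by (intro mem_affine_3_minus) auto
        moreover have "dist (ls k + d *\<^sub>R \<eta>) q < e"
        proof -
          have "dist (ls k + d *\<^sub>R \<eta>) q \<le> dist (ls k) q + norm (d *\<^sub>R \<eta>)"
            using norm_triangle_ineq[of "ls k - q" "d *\<^sub>R \<eta>"] by (simp add: dist_norm algebra_simps)
          then show ?thesis using that d by simp
        qed
        ultimately show ?thesis using e(2) rel_interior_subset by blast
      qed
      \<comment> \<open>As \<open>F (xs k)\<close> lies in \<open>annihilator Q\<close>, using
        \<open>ls k + d *\<^sub>R \<eta>\<close> in place of \<open>ls k\<close> at the displaced
        point raises the lower bound by exactly \<open>2 * d * H k / ts k\<close>. This tends to
        infinity because \<open>H\<close> has a positive limit.\<close>
      define H where "H k = \<eta> \<bullet> ((F (xs k + ts k *\<^sub>R hs k) - F (xs k)) /\<^sub>R ts k)" for k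
      have Hlim: "H \<longlonglongrightarrow> \<eta> \<bullet> F1 x h"
        unfolding H_def by (intro tendsto_intros first_order_limit[OF xs xU ts(2,1) hs])
      have "filterlim (\<lambda>k. inverse (ts k)) at_top sequentially"
        by (rule filterlim_inverse_at_top[OF ts(2)]) (use ts in simp)
      then have "filterlim (\<lambda>k. (2 * d * H k) * inverse (ts k)) at_top sequentially"
        using \<eta> d(1) by (intro filterlim_tendsto_pos_mult_at_top[OF tendsto_mult[OF tendsto_const Hlim]]) auto
      then have "filterlim (\<lambda>k. G hs k + (2 * d * H k) * inverse (ts k)) at_top sequentially"
        by (rule filterlim_tendsto_add_at_top[OF Glim[OF hs]])
      then have "(\<lambda>k. ereal (G hs k + (2 * d * H k) * inverse (ts k))) \<longlonglongrightarrow> \<infinity>"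
        by (simp add: tendsto_PInfty_eq_at_top)
      then have inf: "liminf (\<lambda>k. ereal (G hs k + (2 * d * H k) * inverse (ts k))) = \<infinity>"
        by (intro lim_imp_Liminf) auto
      have "\<forall>\<^sub>F k in sequentially. ereal (G hs k + (2 * d * H k) * inverse (ts k))
          \<le> second_diff_quot phi (ts k) (xs k) (vs k) (hs k)"
        using eventually_domain[OF xs x ts(2) hs] near
      proof eventually_elim
        case (elim k)
        let ?y = "xs k + ts k *\<^sub>R hs k"
        have t: "ts k > 0" by (rule ts)
        have "\<eta> \<bullet> F (xs k) = 0"
          using annihilatorD[OF FK[OF elim(2)] q12(1,2)]
          by (simp add: \<eta>_def inner_commute[of "q1 - q2"] inner_diff_right)
        then have "H k = (\<eta> \<bullet> F ?y) * inverse (ts k)" by (simp add: H_def inner_diff_right)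
        then have Hk: "(2 * d * H k) * inverse (ts k) = 2 / (ts k)\<^sup>2 * (d * (\<eta> \<bullet> F ?y))"
          by (simp add: power2_eq_square divide_inverse)
        have vk: "adjoint (F1 (xs k)) (ls k) = vs k" using ls(2) elim by simp
        have alg: "c * (A - B - D) + c * E = c * (A + E - B - D)" for c A B D E :: real
          by (simp add: algebra_simps)
        have "G hs k + (2 * d * H k) * inverse (ts k) =
            2 / (ts k)\<^sup>2 * ((ls k + d *\<^sub>R \<eta>) \<bullet> F ?y - ls k \<bullet> F (xs k) - ts k * (vs k \<bullet> hs k))"
          unfolding G_def Hk vk inner_add_left inner_scaleR_left by (rule alg)
        then show ?case
          using second_diff_quot_ge[OF ball_domainD ls(1) ball_domainD inQ t] elim by auto
      qed
      from Liminf_mono[OF this] show ?thesis unfolding inf by simp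
    qed
    have upper: "\<exists>hs. hs \<longlonglongrightarrow> h \<and> limsup (\<lambda>k. second_diff_quot phi (ts k) (xs k) (vs k) (hs k)) \<le> \<theta> h" for h
    proof (cases "F1 x h \<in> ?K")
      case False
      then show ?thesis by (auto simp: \<theta>_def)
    next
      case True
      obtain hs where hs: "hs \<longlonglongrightarrow> h"
        and feas: "\<forall>\<^sub>F k in sequentially. F (xs k + ts k *\<^sub>R hs k) - F (xs k) - ts k *\<^sub>R F1 x h \<in> N"
        using feasible_directions[OF xs x ts(2,1)] .
      have "\<forall>\<^sub>F k in sequentially. second_diff_quot phi (ts k) (xs k) (vs k) (hs k) = ereal (G hs k)"
        using feas near eventually_domain[OF xs x ts(2) hs]
      proof eventually_elim
        case (elim k)
        let ?y = "xs k + ts k *\<^sub>R hs k"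
        \<comment> \<open>Since \<open>annihilator Q\<close> is a subspace, the correction term, the
          base value and the tangential increment add up within it.\<close>
        have "(F ?y - F (xs k) - ts k *\<^sub>R F1 x h) + (F (xs k) + ts k *\<^sub>R F1 x h) \<in> ?K"
          using elim(1) NK by (intro annihilator_add annihilator_scale True FK elim) auto
        then have "F ?y \<in> ?K" by (simp add: algebra_simps)
        then have "F ?y \<in> normal_cone Q (ls k)"
          using normal_cone_rel_interior[OF convex_Q ri[OF elim(2)]] by blast
        then show ?case unfolding G_def
          using second_diff_quot_eq[OF ball_domainD ls(1) ball_domainD _ ts(1)] ls(2) elim by metis
      qed
      moreover have "limsup (\<lambda>k. ereal (G hs k)) = ereal (q \<bullet> F2 x h h)"
        using Glim[OF hs] by (intro lim_imp_Limsup) auto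
      ultimately have "limsup (\<lambda>k. second_diff_quot phi (ts k) (xs k) (vs k) (hs k)) = \<theta> h"
        using True by (subst Limsup_eq) (auto simp: \<theta>_def)
      then show ?thesis using hs by auto
    qed
    show ?thesis unfolding epi_converges_def using lower upper by blast
  qed
  moreover have "adjoint (F1 x) q \<in> limiting_subdifferential phi x"
    using limiting_subdifferential_eq[OF x] Fx by blast
  ultimately show ?thesis unfolding strictly_twice_epi_differentiable_def by blast
qed

text \<open>Both families of subgradients compared here keep the base point \<open>xbar\<close>,
  where every point of \<open>Q\<close> is a multiplier because \<open>F xbar = 0\<close>.
  Strictness forces them to share one epi-limit.\<close>

lemma strictly_twice_epi_differentiable_imp_rel_interior:
  assumes "strictly_twice_epi_differentiable phi xbar (adjoint (F1 xbar) lam)"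
  shows "lam \<in> rel_interior Q"
proof (rule rel_interior_criterion, rule ccontr)
  fix h q assume h: "F1 xbar h \<in> N" and q: "q \<in> Q" and "F1 xbar h \<bullet> (q - lam) \<noteq> 0"
  then have neg: "F1 xbar h \<bullet> (q - lam) < 0" by (force simp: normal_cone_def)
  have xb: "xbar \<in> ball xbar r" using r_pos by simp
  obtain \<theta> where \<theta>: "\<And>ts xs vs. (\<And>k. ts k > 0) \<Longrightarrow> ts \<longlonglongrightarrow> 0 \<Longrightarrow>
      (\<And>k. vs k \<in> limiting_subdifferential phi (xs k)) \<Longrightarrow> xs \<longlonglongrightarrow> xbar \<Longrightarrow> vs \<longlonglongrightarrow> adjoint (F1 xbar) lam \<Longrightarrow>
      (\<lambda>k. phi (xs k)) \<longlonglongrightarrow> phi xbar \<Longrightarrow> epi_converges (\<lambda>k. second_diff_quot phi (ts k) (xs k) (vs k)) \<theta>"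
    using assms unfolding strictly_twice_epi_differentiable_def by blast
  define s where "s k = 1 / real (Suc k)" for k
  have s: "s \<longlonglongrightarrow> 0" "\<And>k. s k > 0" "\<And>k. s k \<le> 1"
    unfolding s_def using LIMSEQ_inverse_real_of_nat by (simp_all add: inverse_eq_divide field_simps)
  define ts where "ts k = (s k)\<^sup>2" for k
  have ts: "\<And>k. ts k > 0" "ts \<longlonglongrightarrow> 0"
  proof -
    show "ts k > 0" for k using s(2)[of k] by (simp add: ts_def)
    have "ts \<longlonglongrightarrow> 0\<^sup>2" unfolding ts_def by (intro tendsto_intros s)
    then show "ts \<longlonglongrightarrow> 0" by simp
  qed
  have sub: "adjoint (F1 xbar) l \<in> limiting_subdifferential phi xbar" if "l \<in> Q" for l
    using limiting_subdifferential_xbar that by blast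
  have F0: "F xbar \<in> normal_cone Q l" if "l \<in> Q" for l using normal_cone_zero[OF that] by (simp add: F_xbar)

  have fin: "\<theta> h \<le> ereal (lam \<bullet> F2 xbar h h)"
  proof -
    obtain hs where hs: "hs \<longlonglongrightarrow> h"
      and feas: "\<forall>\<^sub>F k in sequentially. F (xbar + ts k *\<^sub>R hs k) - F xbar - ts k *\<^sub>R F1 xbar h \<in> N"
      using feasible_directions[OF tendsto_const xb ts(2,1)] .
    define G where "G k = 2 / (ts k)\<^sup>2 * (lam \<bullet> F (xbar + ts k *\<^sub>R hs k) - lam \<bullet> F xbar
      - ts k * (adjoint (F1 xbar) lam \<bullet> hs k))" for k
    have "G \<longlonglongrightarrow> lam \<bullet> F2 xbar h h" unfolding G_def
      by (rule second_order_limit[OF tendsto_const xbar_domain ts(2,1) hs tendsto_const])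
    then have limG: "liminf (\<lambda>k. ereal (G k)) = ereal (lam \<bullet> F2 xbar h h)" by (intro lim_imp_Liminf) auto
    have ev: "\<forall>\<^sub>F k in sequentially. second_diff_quot phi (ts k) xbar (adjoint (F1 xbar) lam) (hs k) = ereal (G k)"
      using feas eventually_domain[OF tendsto_const xb ts(2) hs]
    proof eventually_elim
      case (elim k)
      have "(F (xbar + ts k *\<^sub>R hs k) - F xbar - ts k *\<^sub>R F1 xbar h) + ts k *\<^sub>R F1 xbar h \<in> N"
        using elim(1) h ts(1)[of k] by (intro normal_cone_add normal_cone_scale) auto
      then have "F (xbar + ts k *\<^sub>R hs k) \<in> N" by (simp add: F_xbar)
      then show ?case unfolding G_def
        using elim(2) by (intro second_diff_quot_eq xbar_domain F0 lam_Q ball_domainD ts) auto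
    qed
    have "epi_converges (\<lambda>k. second_diff_quot phi (ts k) xbar (adjoint (F1 xbar) lam)) \<theta>"
      by (intro \<theta> ts sub lam_Q tendsto_const)
    then have le: "\<theta> h \<le> liminf (\<lambda>k. second_diff_quot phi (ts k) xbar (adjoint (F1 xbar) lam) (hs k))"
      using hs unfolding epi_converges_def by blast
    from le show ?thesis unfolding Liminf_eq[OF ev] limG .
  qed

  txt \<open>Tilting \<open>lam\<close> towards \<open>q\<close> by \<open>s k\<close> while \<open>ts k = (s k)\<^sup>2\<close> makes the quotients explode in direction \<open>h\<close>.\<close>
  define ls where "ls k = lam + s k *\<^sub>R (q - lam)" for k
  have lsQ: "ls k \<in> Q" for k
  proof -
    have "(1 - s k) *\<^sub>R lam + s k *\<^sub>R q \<in> Q"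
      using s(2,3)[of k] by (intro convexD[OF convex_Q lam_Q q]) auto
    then show ?thesis by (simp add: ls_def algebra_simps)
  qed
  have "ls \<longlonglongrightarrow> lam + 0 *\<^sub>R (q - lam)" unfolding ls_def by (intro tendsto_intros s)
  then have "(\<lambda>k. adjoint (F1 xbar) (ls k)) \<longlonglongrightarrow> adjoint (F1 xbar) lam"
    by (intro tendsto_adjoint_F1[OF tendsto_const _ xbar_domain]) simp
  then have "epi_converges (\<lambda>k. second_diff_quot phi (ts k) xbar (adjoint (F1 xbar) (ls k))) \<theta>"
    by (intro \<theta> ts sub lsQ tendsto_const)
  then obtain hs where hs: "hs \<longlonglongrightarrow> h"
    and sup: "limsup (\<lambda>k. second_diff_quot phi (ts k) xbar (adjoint (F1 xbar) (ls k)) (hs k)) \<le> \<theta> h"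
    unfolding epi_converges_def by blast
  define G where "G k = 2 / (ts k)\<^sup>2 * (lam \<bullet> F (xbar + ts k *\<^sub>R hs k) - lam \<bullet> F xbar
      - ts k * (adjoint (F1 xbar) lam \<bullet> hs k))" for k
  have Glim: "G \<longlonglongrightarrow> lam \<bullet> F2 xbar h h" unfolding G_def
    by (rule second_order_limit[OF tendsto_const xbar_domain ts(2,1) hs tendsto_const])
  \<comment> \<open>The value at the displaced point is bounded below with \<open>lam\<close> rather
    than \<open>ls k\<close>, so the tilt enters only through the subgradient. After division by
    half the squared step it contributes \<open>H k / s k\<close>, where \<open>H\<close> has a
    positive limit by \<open>neg\<close>.\<close>
  define H where "H k = - 2 * ((q - lam) \<bullet> F1 xbar (hs k))" for k
  have Hlim: "H \<longlonglongrightarrow> - 2 * ((q - lam) \<bullet> F1 xbar h)"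
    unfolding H_def by (intro tendsto_intros tendsto_F1 hs xbar_domain)
  have "filterlim (\<lambda>k. inverse (s k)) at_top sequentially"
    by (rule filterlim_inverse_at_top[OF s(1)]) (use s in simp)
  then have "filterlim (\<lambda>k. H k * inverse (s k)) at_top sequentially"
    using neg by (intro filterlim_tendsto_pos_mult_at_top[OF Hlim]) (auto simp: inner_commute)
  then have "filterlim (\<lambda>k. G k + H k * inverse (s k)) at_top sequentially"
    by (rule filterlim_tendsto_add_at_top[OF Glim])
  then have "(\<lambda>k. ereal (G k + H k * inverse (s k))) \<longlonglongrightarrow> \<infinity>"
    by (simp add: tendsto_PInfty_eq_at_top)
  then have inf: "limsup (\<lambda>k. ereal (G k + H k * inverse (s k))) = \<infinity>"
    by (intro lim_imp_Limsup) auto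
  have "\<forall>\<^sub>F k in sequentially. ereal (G k + H k * inverse (s k))
      \<le> second_diff_quot phi (ts k) xbar (adjoint (F1 xbar) (ls k)) (hs k)"
    using eventually_domain[OF tendsto_const xb ts(2) hs]
  proof eventually_elim
    case (elim k)
    have adj: "adjoint (F1 xbar) l \<bullet> hs k = l \<bullet> F1 xbar (hs k)" for l
      by (metis adjoint_F1_works[OF xbar_domain] inner_commute)
    have eq: "2 / (ts k)\<^sup>2 * (ts k * (s k * z)) = 2 * z * inverse (s k)" for z
      using s(2)[of k] by (simp add: ts_def field_simps power2_eq_square)
    have alg: "c * (A - t * B) + c * (t * (\<sigma> * - D)) = c * (A - t * (B + \<sigma> * D))" for c A B D t \<sigma> :: real
      by (simp add: algebra_simps)
    from eq have "H k * inverse (s k) = 2 / (ts k)\<^sup>2 * (ts k * (s k * - ((q - lam) \<bullet> F1 xbar (hs k))))"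
      by (simp add: H_def)
    then have "G k + H k * inverse (s k) = 2 / (ts k)\<^sup>2 * (lam \<bullet> F (xbar + ts k *\<^sub>R hs k) - ls k \<bullet> F xbar
      - ts k * (adjoint (F1 xbar) (ls k) \<bullet> hs k))"
      unfolding G_def adj ls_def F_xbar inner_add_left inner_scaleR_left inner_zero_right
      by (simp only: alg diff_0_right)
    then show ?case
      using second_diff_quot_ge[OF xbar_domain F0[OF lsQ] ball_domainD lam_Q ts(1)] elim by metis
  qed
  from Limsup_mono[OF this] have "\<theta> h = \<infinity>" using sup unfolding inf by simp
  with fin show False by simp
qed

end

section \<open>The proximity operator\<close>

text \<open>Compare the prox objective at its minimizer \<open>y\<close> with its value at
  \<open>x\<close> and insert the prox-regularity minorant; expanding the square leaves this
  inequality.\<close>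

lemma prox_strong_minimality:
  assumes "tau > 0" and c: "phi x = ereal c"
    and reg: "\<And>y. phi x + ereal (v \<bullet> (y - x) - rho / 2 * (norm (y - x))\<^sup>2) \<le> phi y"
    and y: "y \<in> prox tau phi z"
  shows "(1 - tau * rho) / 2 * (norm (y - x))\<^sup>2 \<le> (z - (x + tau *\<^sub>R v)) \<bullet> (y - x)"
proof -
  have "phi y + ereal (1 / (2 * tau) * (norm (y - z))\<^sup>2) \<le> phi x + ereal (1 / (2 * tau) * (norm (x - z))\<^sup>2)"
    using y by (simp add: prox_def is_arg_min_def not_less)
  moreover have "ereal (c + (v \<bullet> (y - x) - rho / 2 * (norm (y - x))\<^sup>2)) \<le> phi y"
    using reg[of y] by (simp add: c)
  ultimately have "ereal (c + (v \<bullet> (y - x) - rho / 2 * (norm (y - x))\<^sup>2)) + ereal (1 / (2 * tau) * (norm (y - z))\<^sup>2)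
      \<le> ereal c + ereal (1 / (2 * tau) * (norm (x - z))\<^sup>2)"
    unfolding c by (meson add_right_mono order_trans)
  then have "v \<bullet> (y - x) - rho / 2 * (norm (y - x))\<^sup>2 + 1 / (2 * tau) * (norm (y - z))\<^sup>2
      \<le> 1 / (2 * tau) * (norm (x - z))\<^sup>2" by simp
  then have "tau * (v \<bullet> (y - x) - rho / 2 * (norm (y - x))\<^sup>2 + 1 / (2 * tau) * (norm (y - z))\<^sup>2)
      \<le> tau * (1 / (2 * tau) * (norm (x - z))\<^sup>2)" using assms(1) by (intro mult_left_mono) auto
  then have le: "tau * (v \<bullet> (y - x)) - tau * rho / 2 * (norm (y - x))\<^sup>2 + (norm (y - z))\<^sup>2 / 2
      \<le> (norm (x - z))\<^sup>2 / 2" using assms(1) by (simp add: algebra_simps)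
  have "y - z = (y - x) + (x - z)" by simp
  then have "(norm (y - z))\<^sup>2 = (norm (y - x))\<^sup>2 + 2 * ((x - z) \<bullet> (y - x)) + (norm (x - z))\<^sup>2"
    by (simp only: power2_norm_eq_inner inner_add_left inner_add_right inner_commute)
  moreover have "(z - (x + tau *\<^sub>R v)) \<bullet> (y - x) = - ((x - z) \<bullet> (y - x)) - tau * (v \<bullet> (y - x))"
    by (simp add: inner_diff_left inner_add_left)
  ultimately show ?thesis using le by argo
qed

text \<open>The minorant bounds the objective at \<open>y\<close> from below by its value at
  \<open>x\<close> plus a nonnegative multiple of the squared distance, so \<open>x\<close> is a
  minimizer. Uniqueness is the preceding inequality at
  \<open>z = x + tau *\<^sub>R v\<close>.\<close>

lemma prox_eq_singleton:
  fixes phi :: "'a::euclidean_space \<Rightarrow> ereal"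
  assumes "tau > 0" "tau * rho < 1" and c: "phi x = ereal c"
    and reg: "\<And>y. phi x + ereal (v \<bullet> (y - x) - rho / 2 * (norm (y - x))\<^sup>2) \<le> phi y"
  shows "prox tau phi (x + tau *\<^sub>R v) = {x}"
proof (intro equalityI subsetI)
  fix y assume "y \<in> prox tau phi (x + tau *\<^sub>R v)"
  from prox_strong_minimality[OF assms(1) c reg this]
  have "(1 - tau * rho) / 2 * (norm (y - x))\<^sup>2 \<le> 0" by simp
  then have "(norm (y - x))\<^sup>2 \<le> 0" using assms(2) by (simp add: mult_le_0_iff)
  then show "y \<in> {x}" by simp
next
  fix y assume "y \<in> {x}"
  moreover have "phi x + ereal (1 / (2 * tau) * (norm (x - (x + tau *\<^sub>R v)))\<^sup>2)
      \<le> phi y + ereal (1 / (2 * tau) * (norm (y - (x + tau *\<^sub>R v)))\<^sup>2)" for y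
  proof -
    have gen: "(norm (d - w))\<^sup>2 = (norm d)\<^sup>2 - 2 * (w \<bullet> d) + (norm w)\<^sup>2" for d w :: 'a
      by (simp add: power2_norm_eq_inner inner_diff_left inner_diff_right inner_commute)
    have eq: "y - (x + tau *\<^sub>R v) = (y - x) - tau *\<^sub>R v" "norm (x - (x + tau *\<^sub>R v)) = norm (tau *\<^sub>R v)"
      by (simp_all add: norm_minus_commute)
    have "(norm (y - (x + tau *\<^sub>R v)))\<^sup>2 = (norm (y - x))\<^sup>2 - 2 * (tau * (v \<bullet> (y - x))) + (norm (x - (x + tau *\<^sub>R v)))\<^sup>2"
      unfolding eq gen inner_scaleR_left ..
    then have "1 / (2 * tau) * (norm (y - (x + tau *\<^sub>R v)))\<^sup>2 =
        1 / (2 * tau) * (norm (y - x))\<^sup>2 - v \<bullet> (y - x) + 1 / (2 * tau) * (norm (x - (x + tau *\<^sub>R v)))\<^sup>2"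
      using assms(1) by (simp add: distrib_left right_diff_distrib add_divide_distrib diff_divide_distrib)
    moreover have "rho / 2 * (norm (y - x))\<^sup>2 \<le> 1 / (2 * tau) * (norm (y - x))\<^sup>2"
      using assms(1,2) by (intro mult_right_mono) (simp_all add: field_simps)
    ultimately have "c + 1 / (2 * tau) * (norm (x - (x + tau *\<^sub>R v)))\<^sup>2 \<le>
        (c + (v \<bullet> (y - x) - rho / 2 * (norm (y - x))\<^sup>2)) + 1 / (2 * tau) * (norm (y - (x + tau *\<^sub>R v)))\<^sup>2"
      by linarith
    then have "phi x + ereal (1 / (2 * tau) * (norm (x - (x + tau *\<^sub>R v)))\<^sup>2) \<le>
        (phi x + ereal (v \<bullet> (y - x) - rho / 2 * (norm (y - x))\<^sup>2)) + ereal (1 / (2 * tau) * (norm (y - (x + tau *\<^sub>R v)))\<^sup>2)"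
      by (simp only: c plus_ereal.simps ereal_less_eq)
    also have "\<dots> \<le> phi y + ereal (1 / (2 * tau) * (norm (y - (x + tau *\<^sub>R v)))\<^sup>2)"
      by (intro add_right_mono reg)
    finally show ?thesis .
  qed
  ultimately show "y \<in> prox tau phi (x + tau *\<^sub>R v)"
    by (simp add: prox_def is_arg_min_def not_less)
qed

text \<open>
  With \<open>\<pi>\<close> the orthogonal projection onto \<open>span E\<close>, one equation encodes that
  \<open>y\<close> is orthogonal to \<open>E\<close> and that \<open>\<mu> \<in> span E\<close>. This turns the description of the graph of the subdifferential
  into a square system, to which the inverse function theorem applies.
\<close>

lemma orthogonal_splitting_map:
  fixes E :: "'b::euclidean_space set"
  obtains \<pi> :: "'b \<Rightarrow> 'b" where "linear \<pi>"
    "\<And>y \<mu>. \<pi> y + \<mu> - \<pi> \<mu> = 0 \<Longrightarrow> (\<forall>e\<in>E. y \<bullet> e = 0) \<and> \<mu> \<in> span E"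
proof -
  obtain B where B: "B \<subseteq> span E" "pairwise orthogonal B" "\<And>x. x \<in> B \<Longrightarrow> norm x = 1"
    "independent B" "span B = span E"
    using orthonormal_basis_subspace[OF subspace_span, of E] by metis
  have fin: "finite B" using B(4) by (rule independent_imp_finite)
  define \<pi> where "\<pi> y = (\<Sum>b\<in>B. (y \<bullet> b) *\<^sub>R b)" for y
  have \<pi>b: "\<pi> y \<bullet> b = y \<bullet> b" if "b \<in> B" for y b
  proof -
    have "\<pi> y \<bullet> b = (\<Sum>c\<in>B. (y \<bullet> c) * (c \<bullet> b))" by (simp add: \<pi>_def inner_sum_left)
    also have "\<dots> = (\<Sum>c\<in>B. if c = b then y \<bullet> b else 0)"
      using B(2,3) that by (intro sum.cong refl)
        (auto simp: pairwise_def orthogonal_def dot_square_norm)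
    finally show ?thesis using fin that by simp
  qed
  show thesis
  proof
    show "linear \<pi>" unfolding \<pi>_def
      by (rule linearI) (simp_all add: inner_add_left scaleR_add_left sum.distrib scaleR_sum_right)
    fix y \<mu> assume eq: "\<pi> y + \<mu> - \<pi> \<mu> = 0"
    have yb: "y \<bullet> b = 0" if "b \<in> B" for b
    proof -
      have "(\<pi> y + \<mu> - \<pi> \<mu>) \<bullet> b = y \<bullet> b"
        using \<pi>b[OF that] by (simp add: inner_add_left inner_diff_left)
      then show ?thesis using eq by simp
    qed
    then have "\<pi> y = 0" by (simp add: \<pi>_def)
    then have "\<mu> = \<pi> \<mu>" using eq by simp
    moreover have "\<pi> \<mu> \<in> span E" unfolding \<pi>_def
      by (intro span_sum span_scale) (use B(1) in blast)
    moreover have "y \<bullet> e = 0" if "e \<in> E" for e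
    proof -
      have "e \<in> span B" using that B(5) span_base by blast
      then have "orthogonal y e"
        by (rule orthogonal_to_span) (simp add: orthogonal_def yb)
      then show ?thesis by (simp add: orthogonal_def)
    qed
    ultimately show "(\<forall>e\<in>E. y \<bullet> e = 0) \<and> \<mu> \<in> span E" by metis
  qed
qed

text \<open>Let \<open>w z\<close> solve \<open>L z (w z) = h\<close>. Then \<open>L z\<close> maps
  \<open>w z - w z0\<close> to \<open>- ((L z - L z0) (w z0))\<close>, and the lower bound
  \<open>B\<close> of \<open>L z0\<close> persists as \<open>B / 2\<close> for nearby
  \<open>L z\<close>, so the difference of solutions tends to zero.\<close>

lemma continuous_on_inv_blinfun:
  fixes L :: "'c::topological_space \<Rightarrow> ('a::euclidean_space \<Rightarrow>\<^sub>L 'a)"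
  assumes cont: "continuous_on S L" and bij: "\<And>z. z \<in> S \<Longrightarrow> bij (blinfun_apply (L z))"
  shows "continuous_on S (\<lambda>z. inv (blinfun_apply (L z)) h)"
  unfolding continuous_on_def
proof
  fix z0 assume z0: "z0 \<in> S"
  define w where "w z = inv (blinfun_apply (L z)) h" for z
  have Lw: "L z (w z) = h" if "z \<in> S" for z
    using bij[OF that] by (simp add: w_def bij_is_surj surj_f_inv_f)
  have "linear (blinfun_apply (L z0))" by (simp add: blinfun.bounded_linear_right bounded_linear.linear)
  then obtain B where B: "B > 0" "\<And>u. B * norm u \<le> norm (L z0 u)"
    using linear_inj_bounded_below_pos bij[OF z0] by (metis bij_is_inj)
  have lim: "(L \<longlongrightarrow> L z0) (at z0 within S)" using cont z0 by (simp add: continuous_on_def)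
  then have d: "((\<lambda>z. norm (L z - L z0)) \<longlongrightarrow> 0) (at z0 within S)"
    by (simp add: LIM_zero tendsto_norm_zero)
  have "((\<lambda>z. w z - w z0) \<longlongrightarrow> 0) (at z0 within S)"
  proof (rule Lim_null_comparison)
    have "\<forall>\<^sub>F z in at z0 within S. norm (L z - L z0) < B / 2"
      using d B(1) by (intro order_tendstoD) auto
    moreover have "\<forall>\<^sub>F z in at z0 within S. z \<in> S" by (simp add: eventually_at_filter)
    ultimately show "\<forall>\<^sub>F z in at z0 within S. norm (w z - w z0) \<le> 2 / B * (norm (L z - L z0) * norm (w z0))"
    proof eventually_elim
      case (elim z)
      let ?u = "w z - w z0"
      have "L z ?u = - ((L z - L z0) (w z0))"
        using Lw[OF elim(2)] Lw[OF z0] by (simp add: blinfun.diff_right blinfun.diff_left)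
      then have 1: "norm (L z ?u) \<le> norm (L z - L z0) * norm (w z0)"
        using norm_blinfun[of "L z - L z0" "w z0"] by simp
      have "L z0 ?u = L z ?u - (L z - L z0) ?u" by (simp add: blinfun.diff_left)
      then have "norm (L z0 ?u) \<le> norm (L z ?u) + norm ((L z - L z0) ?u)"
        by (metis norm_triangle_ineq4)
      also have "norm ((L z - L z0) ?u) \<le> norm (L z - L z0) * norm ?u" by (rule norm_blinfun)
      also have "\<dots> \<le> B / 2 * norm ?u" using elim(1) by (intro mult_right_mono) auto
      finally have "B * norm ?u \<le> norm (L z ?u) + B / 2 * norm ?u" using B(2)[of ?u] by linarith
      then have "B * norm ?u \<le> 2 * (norm (L z - L z0) * norm (w z0))" using 1 by linarith
      then show ?case using B(1) by (simp add: field_simps)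
    qed
    have "((\<lambda>z. 2 / B * (norm (L z - L z0) * norm (w z0))) \<longlongrightarrow> 2 / B * (0 * norm (w z0))) (at z0 within S)"
      by (intro tendsto_intros d)
    then show "((\<lambda>z. 2 / B * (norm (L z - L z0) * norm (w z0))) \<longlongrightarrow> 0) (at z0 within S)" by simp
  qed
  then show "((\<lambda>z. inv (blinfun_apply (L z)) h) \<longlongrightarrow> inv (blinfun_apply (L z0)) h) (at z0 within S)"
    unfolding w_def by (rule LIM_zero_cancel)
qed

section \<open>Prox-regularity in terms of multipliers\<close>

locale prox_regular_decomposition = regular_decomposition F U phi xbar lam Q C r
  for F :: "'a::euclidean_space \<Rightarrow> 'b::euclidean_space" and U phi xbar lam Q C r +
  fixes tau rho e :: real
  assumes tau_pos: "tau > 0" and tau_rho: "tau * rho < 1" and e_pos: "e > 0"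
    and prox_regular: "v \<in> limiting_subdifferential phi x \<Longrightarrow> norm (x - xbar) < e \<Longrightarrow>
      norm (v - adjoint (F1 xbar) lam) < e \<Longrightarrow> phi x < phi xbar + ereal e \<Longrightarrow>
      phi x + ereal (v \<bullet> (y - x) - rho / 2 * (norm (y - x))\<^sup>2) \<le> phi y"
begin

abbreviation "vbar \<equiv> adjoint (F1 xbar) lam"
abbreviation "zbar \<equiv> xbar + tau *\<^sub>R vbar"

text \<open>The closeness conditions of prox-regularity, expressed by a multiplier:
  \<open>q \<bullet> F x < e\<close> stands for \<open>phi x < phi xbar + ereal e\<close> as soon as
  \<open>F x\<close> is normal to \<open>Q\<close> at \<open>q\<close>.\<close>

definition graph_near :: "'a \<Rightarrow> 'b \<Rightarrow> bool" where
  "graph_near x q \<longleftrightarrow> x \<in> ball xbar r \<and> norm (x - xbar) < e \<and>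
     norm (adjoint (F1 x) q - vbar) < e \<and> q \<bullet> F x < e"

lemma xbar_ball: "xbar \<in> ball xbar r" using r_pos by simp

lemma xbar_normal: "q \<in> Q \<Longrightarrow> F xbar \<in> normal_cone Q q"
  by (simp add: F_xbar normal_cone_zero)

lemma graph_near_eventually:
  assumes "(f \<longlongrightarrow> xbar) G" "(g \<longlongrightarrow> lam) G"
  shows "eventually (\<lambda>i. graph_near (f i) (g i)) G"
proof -
  have "eventually (\<lambda>i. f i \<in> ball xbar r) G"
    using assms(1) xbar_ball by (intro topological_tendstoD) auto
  moreover have "((\<lambda>i. norm (f i - xbar)) \<longlongrightarrow> norm (xbar - xbar)) G" by (intro tendsto_intros assms)
  then have "eventually (\<lambda>i. norm (f i - xbar) < e) G" by (rule order_tendstoD(2)) (simp add: e_pos)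
  moreover have "((\<lambda>i. norm (adjoint (F1 (f i)) (g i) - vbar)) \<longlongrightarrow> norm (vbar - vbar)) G"
    by (intro tendsto_intros tendsto_adjoint_F1 assms xbar_domain)
  then have "eventually (\<lambda>i. norm (adjoint (F1 (f i)) (g i) - vbar) < e) G"
    by (rule order_tendstoD(2)) (simp add: e_pos)
  moreover have "isCont F xbar" using has_derivative_continuous[OF has_derivative_F[OF xbar_domain]] .
  then have "((\<lambda>i. g i \<bullet> F (f i)) \<longlongrightarrow> lam \<bullet> F xbar) G"
    by (intro tendsto_intros assms isCont_tendsto_compose[OF _ assms(1)])
  then have "eventually (\<lambda>i. g i \<bullet> F (f i) < e) G"
    by (rule order_tendstoD(2)) (simp add: e_pos F_xbar)
  ultimately show ?thesis unfolding graph_near_def by eventually_elim simp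
qed

lemma
  assumes "graph_near x q" "F x \<in> normal_cone Q q"
  shows graph_near_prox_regular:
      "phi x + ereal (adjoint (F1 x) q \<bullet> (y - x) - rho / 2 * (norm (y - x))\<^sup>2) \<le> phi y"
    and graph_near_prox: "prox tau phi (x + tau *\<^sub>R adjoint (F1 x) q) = {x}"
proof -
  have near: "x \<in> ball xbar r" "norm (x - xbar) < e" "norm (adjoint (F1 x) q - vbar) < e" "q \<bullet> F x < e"
    using assms(1) unfolding graph_near_def by blast+
  have px: "phi x = ereal (phi0 + q \<bullet> F x)" using phi_normal[OF ball_domainD[OF near(1)] assms(2)] .
  have reg: "phi x + ereal (adjoint (F1 x) q \<bullet> (y - x) - rho / 2 * (norm (y - x))\<^sup>2) \<le> phi y" for y
  proof (rule prox_regular[OF _ near(2,3)])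
    show "adjoint (F1 x) q \<in> limiting_subdifferential phi x"
      using limiting_subdifferential_eq[OF near(1)] assms(2) by blast
    show "phi x < phi xbar + ereal e" using near(4) by (simp add: px phi_xbar)
  qed
  show "phi x + ereal (adjoint (F1 x) q \<bullet> (y - x) - rho / 2 * (norm (y - x))\<^sup>2) \<le> phi y" by (rule reg)
  show "prox tau phi (x + tau *\<^sub>R adjoint (F1 x) q) = {x}"
    by (rule prox_eq_singleton[OF tau_pos tau_rho px reg])
qed

lemma graph_near_xbar: "graph_near xbar lam"
  using e_pos xbar_ball by (simp add: graph_near_def F_xbar)

text \<open>Along feasible directions \<open>phi\<close> coincides with
  \<open>phi0 + lam \<bullet> F\<close>. Dividing the prox-regularity inequality at
  \<open>xbar\<close> by half the squared step gives the bound in the limit.\<close>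

lemma curvature_bound:
  assumes "F1 xbar h \<in> N"
  shows "- rho * (norm h)\<^sup>2 \<le> lam \<bullet> F2 xbar h h"
proof -
  define ts where "ts k = 1 / real (Suc k)" for k
  have ts: "ts \<longlonglongrightarrow> 0" "\<And>k. ts k > 0"
    unfolding ts_def using LIMSEQ_inverse_real_of_nat by (simp_all add: inverse_eq_divide)
  obtain hs where hs: "hs \<longlonglongrightarrow> h"
    and feas: "\<forall>\<^sub>F k in sequentially. F (xbar + ts k *\<^sub>R hs k) - F xbar - ts k *\<^sub>R F1 xbar h \<in> N"
    using feasible_directions[OF tendsto_const xbar_ball ts] .
  show ?thesis
  proof (rule tendsto_le[OF sequentially_bot])
    show "(\<lambda>k. 2 / (ts k)\<^sup>2 * (lam \<bullet> F (xbar + ts k *\<^sub>R hs k) - lam \<bullet> F xbar - ts k * (vbar \<bullet> hs k)))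
        \<longlonglongrightarrow> lam \<bullet> F2 xbar h h"
      by (rule second_order_limit[OF tendsto_const xbar_domain ts hs tendsto_const])
    show "(\<lambda>k. - rho * (norm (hs k))\<^sup>2) \<longlonglongrightarrow> - rho * (norm h)\<^sup>2" by (intro tendsto_intros hs)
    show "\<forall>\<^sub>F k in sequentially. - rho * (norm (hs k))\<^sup>2 \<le>
        2 / (ts k)\<^sup>2 * (lam \<bullet> F (xbar + ts k *\<^sub>R hs k) - lam \<bullet> F xbar - ts k * (vbar \<bullet> hs k))"
      using feas eventually_domain[OF tendsto_const xbar_ball ts(1) hs]
    proof eventually_elim
      case (elim k)
      have t: "ts k > 0" by (rule ts)
      have "(F (xbar + ts k *\<^sub>R hs k) - F xbar - ts k *\<^sub>R F1 xbar h) + ts k *\<^sub>R F1 xbar h \<in> N"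
        using elim(1) assms t by (intro normal_cone_add normal_cone_scale) auto
      then have "F (xbar + ts k *\<^sub>R hs k) \<in> N" by (simp add: F_xbar)
      then have "phi (xbar + ts k *\<^sub>R hs k) = ereal (phi0 + lam \<bullet> F (xbar + ts k *\<^sub>R hs k))"
        using elim by (intro phi_normal ball_domainD) auto
      then have "ts k * (vbar \<bullet> hs k) - rho / 2 * (ts k * norm (hs k))\<^sup>2 \<le> lam \<bullet> F (xbar + ts k *\<^sub>R hs k)"
        using graph_near_prox_regular[OF graph_near_xbar xbar_normal[OF lam_Q], of "xbar + ts k *\<^sub>R hs k"] t
        by (simp add: phi_xbar)
      then have "2 / (ts k)\<^sup>2 * (- rho / 2 * (ts k * norm (hs k))\<^sup>2) \<le>
        2 / (ts k)\<^sup>2 * (lam \<bullet> F (xbar + ts k *\<^sub>R hs k) - lam \<bullet> F xbar - ts k * (vbar \<bullet> hs k))"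
        by (intro mult_left_mono) (simp_all add: F_xbar)
      moreover have "2 / (ts k)\<^sup>2 * (- rho / 2 * (ts k * norm (hs k))\<^sup>2) = - rho * (norm (hs k))\<^sup>2"
        using t by (simp add: power_mult_distrib)
      ultimately show ?case by simp
    qed
  qed
qed

lemma differentiable_prox_imp_rel_interior:
  assumes "differentiable_at_point (prox tau phi) zbar"
  shows "lam \<in> rel_interior Q"
proof (rule rel_interior_criterion)
  fix h q assume h: "F1 xbar h \<in> N" and q: "q \<in> Q"
  obtain W P where W: "open W" "zbar \<in> W" and P: "\<And>z. z \<in> W \<Longrightarrow> prox tau phi z = {P z}"
    and "P differentiable (at zbar)"
    using assms unfolding differentiable_at_point_def by blast
  then obtain D where D: "(P has_derivative D) (at zbar)" unfolding differentiable_def by blast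
  have lin: "linear D" using D by (rule has_derivative_linear)
  have P0: "P zbar = xbar"
    using graph_near_prox[OF graph_near_xbar xbar_normal[OF lam_Q]] P[OF W(2)] by simp
  define ts where "ts k = 1 / real (Suc k)" for k
  have ts: "ts \<longlonglongrightarrow> 0" "\<And>k. ts k > 0" "\<And>k. ts k \<le> 1"
    unfolding ts_def using LIMSEQ_inverse_real_of_nat by (simp_all add: inverse_eq_divide field_simps)
  have evW: "\<forall>\<^sub>F k in sequentially. zbar + ts k *\<^sub>R ws k \<in> W" if "ws \<longlonglongrightarrow> w" for ws w
  proof -
    have "(\<lambda>k. zbar + ts k *\<^sub>R ws k) \<longlonglongrightarrow> zbar + 0 *\<^sub>R w" by (intro tendsto_intros ts that)
    then show ?thesis using W by (intro topological_tendstoD) auto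
  qed

  obtain hs where hs: "hs \<longlonglongrightarrow> h"
    and feas: "\<forall>\<^sub>F k in sequentially. F (xbar + ts k *\<^sub>R hs k) - F xbar - ts k *\<^sub>R F1 xbar h \<in> N"
    using feasible_directions[OF tendsto_const xbar_ball ts(1,2)] .
  define xs where "xs k = xbar + ts k *\<^sub>R hs k" for k
  \<comment> \<open>\<open>u\<close> is the velocity of
    \<open>x + tau *\<^sub>R adjoint (F1 x) lam\<close> when \<open>x\<close> leaves
    \<open>xbar\<close> in direction \<open>h\<close>. The \<open>us\<close> are the corresponding
    difference quotients, so that eventually the prox maps \<open>zbar + ts k *\<^sub>R us k\<close>
    exactly to \<open>xs k\<close>.\<close>
  define u where "u = h + tau *\<^sub>R (\<Sum>b\<in>Basis. (F2 xbar b h \<bullet> lam) *\<^sub>R b)"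
  define us where "us k = hs k + tau *\<^sub>R (\<Sum>b\<in>Basis. (((F1 (xs k) b - F1 xbar b) /\<^sub>R ts k) \<bullet> lam) *\<^sub>R b)" for k
  have "us \<longlonglongrightarrow> u" unfolding us_def u_def xs_def
    by (intro tendsto_intros hs has_derivative_directional_limit[OF has_derivative_F1[OF xbar_domain] ts(1,2) hs])
  have "(\<lambda>k. xbar + ts k *\<^sub>R hs k) \<longlonglongrightarrow> xbar + 0 *\<^sub>R h" by (intro tendsto_intros ts hs)
  then have xslim: "xs \<longlonglongrightarrow> xbar" by (simp add: xs_def[abs_def])
  have Du: "D u = h"
  proof (rule LIMSEQ_unique)
    show "(\<lambda>k. (P (zbar + ts k *\<^sub>R us k) - P zbar) /\<^sub>R ts k) \<longlonglongrightarrow> D u"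
      by (rule has_derivative_directional_limit[OF D ts(1,2) \<open>us \<longlonglongrightarrow> u\<close>])
    have "\<forall>\<^sub>F k in sequentially. (P (zbar + ts k *\<^sub>R us k) - P zbar) /\<^sub>R ts k = hs k"
      using feas evW[OF \<open>us \<longlonglongrightarrow> u\<close>] graph_near_eventually[OF xslim tendsto_const]
    proof eventually_elim
      case (elim k)
      have t: "ts k > 0" by (rule ts)
      have xU: "xs k \<in> U" using elim(3) ball_domainD unfolding graph_near_def by blast
      have "(F (xs k) - F xbar - ts k *\<^sub>R F1 xbar h) + ts k *\<^sub>R F1 xbar h \<in> N"
        using elim(1) h t unfolding xs_def by (intro normal_cone_add normal_cone_scale) auto
      then have FN: "F (xs k) \<in> N" by (simp add: F_xbar)
      have cancel: "ts k * ((w /\<^sub>R ts k) \<bullet> lam) = w \<bullet> lam" for w using t by simp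
      have eqS: "ts k *\<^sub>R (\<Sum>b\<in>Basis. (((F1 (xs k) b - F1 xbar b) /\<^sub>R ts k) \<bullet> lam) *\<^sub>R b)
         = adjoint (F1 (xs k)) lam - vbar"
        unfolding adjoint_F1_expand[OF xU] adjoint_F1_expand[OF xbar_domain] scaleR_sum_right sum_subtractf[symmetric]
        by (intro sum.cong refl) (simp only: scaleR_scaleR cancel inner_diff_left scaleR_diff_left)
      have "ts k *\<^sub>R us k = ts k *\<^sub>R hs k + tau *\<^sub>R (adjoint (F1 (xs k)) lam - vbar)"
        unfolding us_def scaleR_add_right scaleR_left_commute[of "ts k" tau] eqS ..
      then have "zbar + ts k *\<^sub>R us k = xs k + tau *\<^sub>R adjoint (F1 (xs k)) lam"
        by (simp add: xs_def scaleR_diff_right)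
      then have "P (zbar + ts k *\<^sub>R us k) = xs k"
        using graph_near_prox[OF elim(3) FN] P[OF elim(2)] by simp
      then show ?case using t by (simp add: P0 xs_def)
    qed
    from tendsto_cong[OF this] hs
    show "(\<lambda>k. (P (zbar + ts k *\<^sub>R us k) - P zbar) /\<^sub>R ts k) \<longlonglongrightarrow> h" by blast
  qed

  txt \<open>
    The proximal map is constant along \<open>a\<close>, so that \<open>D\<close> maps \<open>u + c *\<^sub>R a\<close> to \<open>h\<close> for all \<open>c\<close>; monotonicity of \<open>D\<close>
    then forces \<open>a \<bullet> h = 0\<close>.
  \<close>
  define a where "a = adjoint (F1 xbar) (q - lam)"
  have adj_lin: "linear (adjoint (F1 xbar))" by (rule linear_adjoint_F1[OF xbar_domain])
  have Da: "D (tau *\<^sub>R a) = 0"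
  proof (rule LIMSEQ_unique)
    show "(\<lambda>k. (P (zbar + ts k *\<^sub>R (tau *\<^sub>R a)) - P zbar) /\<^sub>R ts k) \<longlonglongrightarrow> D (tau *\<^sub>R a)"
      by (rule has_derivative_directional_limit[OF D ts(1,2) tendsto_const])
    define ls where "ls k = lam + ts k *\<^sub>R (q - lam)" for k
    have lsQ: "ls k \<in> Q" for k
    proof -
      have "(1 - ts k) *\<^sub>R lam + ts k *\<^sub>R q \<in> Q"
        using ts(2,3)[of k] by (intro convexD[OF convex_Q lam_Q q]) auto
      then show ?thesis by (simp add: ls_def algebra_simps)
    qed
    have "(\<lambda>k. lam + ts k *\<^sub>R (q - lam)) \<longlonglongrightarrow> lam + 0 *\<^sub>R (q - lam)" by (intro tendsto_intros ts)
    then have "ls \<longlonglongrightarrow> lam" by (simp add: ls_def[abs_def])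
    from graph_near_eventually[OF tendsto_const this] evW[OF tendsto_const[of "tau *\<^sub>R a"]]
    have "\<forall>\<^sub>F k in sequentially. (P (zbar + ts k *\<^sub>R (tau *\<^sub>R a)) - P zbar) /\<^sub>R ts k = 0"
    proof eventually_elim
      case (elim k)
      have "adjoint (F1 xbar) (ls k) = vbar + ts k *\<^sub>R a"
        by (simp add: ls_def a_def linear_add[OF adj_lin] linear_cmul[OF adj_lin])
      then have eqz: "zbar + ts k *\<^sub>R (tau *\<^sub>R a) = xbar + tau *\<^sub>R adjoint (F1 xbar) (ls k)"
        by (simp add: scaleR_add_right mult.commute)
      have "P (zbar + ts k *\<^sub>R (tau *\<^sub>R a)) = xbar"
        using graph_near_prox[OF elim(1) xbar_normal[OF lsQ]] P[OF elim(2)] unfolding eqz by simp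
      then show ?case by (simp add: P0)
    qed
    then show "(\<lambda>k. (P (zbar + ts k *\<^sub>R (tau *\<^sub>R a)) - P zbar) /\<^sub>R ts k) \<longlonglongrightarrow> 0"
      by (rule tendsto_eventually)
  qed

  \<comment> \<open>\<open>prox_strong_minimality\<close> at the base pair shows that displacements
    of the prox from \<open>xbar\<close> pair nonnegatively with displacements of its argument from
    \<open>zbar\<close>.\<close>
  have mono: "0 \<le> w \<bullet> D w" for w
  proof (rule tendsto_lowerbound[OF _ _ sequentially_bot])
    show "(\<lambda>k. w \<bullet> ((P (zbar + ts k *\<^sub>R w) - P zbar) /\<^sub>R ts k)) \<longlonglongrightarrow> w \<bullet> D w"
      by (intro tendsto_intros has_derivative_directional_limit[OF D ts(1,2) tendsto_const])
    show "\<forall>\<^sub>F k in sequentially. 0 \<le> w \<bullet> ((P (zbar + ts k *\<^sub>R w) - P zbar) /\<^sub>R ts k)"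
      using evW[OF tendsto_const[of w]]
    proof eventually_elim
      case (elim k)
      have t: "ts k > 0" by (rule ts)
      let ?y = "P (zbar + ts k *\<^sub>R w)"
      have "0 \<le> (1 - tau * rho) / 2 * (norm (?y - xbar))\<^sup>2" using tau_rho by simp
      also have "\<dots> \<le> (zbar + ts k *\<^sub>R w - zbar) \<bullet> (?y - xbar)"
        by (rule prox_strong_minimality[where phi = phi])
          (use tau_pos phi_xbar graph_near_prox_regular[OF graph_near_xbar xbar_normal[OF lam_Q]] P[OF elim] in auto)
      finally have "0 \<le> ts k * (w \<bullet> (?y - xbar))" by simp
      then have "0 \<le> w \<bullet> (?y - xbar)" using t by (simp add: zero_le_mult_iff)
      then show ?case using t by (simp add: P0)
    qed
  qed

  have "a \<bullet> h = 0"
  proof (rule ccontr)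
    assume nz: "a \<bullet> h \<noteq> 0"
    \<comment> \<open>With this value the quadratic form of \<open>D\<close> at
      \<open>u + c *\<^sub>R (tau *\<^sub>R a)\<close> equals \<open>-1\<close>.\<close>
    define c where "c = - (u \<bullet> h + 1) / (tau * (a \<bullet> h))"
    have "D (u + c *\<^sub>R (tau *\<^sub>R a)) = h"
      using Du Da by (simp only: linear_add[OF lin] linear_cmul[OF lin]) simp
    then have "0 \<le> u \<bullet> h + c * (tau * (a \<bullet> h))"
      using mono[of "u + c *\<^sub>R (tau *\<^sub>R a)"] by (simp add: inner_add_left)
    moreover have "c * (tau * (a \<bullet> h)) = - (u \<bullet> h + 1)"
      using nz tau_pos by (simp add: c_def)
    ultimately show False by simp
  qed
  then show "F1 xbar h \<bullet> (q - lam) = 0"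
    by (metis a_def adjoint_F1_works[OF xbar_domain] inner_commute)
qed

end

section \<open>Inverting the optimality system\<close>

text \<open>Freezing the second right-hand side at \<open>0\<close> and keeping the first component
  of the local inverse \<open>g\<close> gives the solution map of the optimality system. Its
  derivative is continuous because inversion of linear maps is.\<close>

lemma Ck_on_1_comp_inverse:
  fixes g :: "'a::euclidean_space \<times> 'b::euclidean_space \<Rightarrow> 'a \<times> 'b"
  assumes "continuous_on V g" "continuous_on (g ` V) L"
    and g': "\<And>y. y \<in> V \<Longrightarrow> (g has_derivative g' y) (at y)"
    and inv: "\<And>y. y \<in> V \<Longrightarrow> g' y = inv (blinfun_apply (L (g y)))"
    and bij: "\<And>y. y \<in> V \<Longrightarrow> bij (blinfun_apply (L (g y)))"
  shows "Ck_on 1 (\<lambda>z. fst (g (z, 0))) {z. (z, 0) \<in> V}"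
proof -
  let ?p = "\<lambda>z. fst (g (z, 0))"
  have der: "(?p has_derivative (\<lambda>h. fst (g' (z, 0) (h, 0)))) (at z)" if "(z, 0) \<in> V" for z
  proof -
    have "((\<lambda>z. (z, 0)) has_derivative (\<lambda>h. (h, 0))) (at z)"
      by (intro derivative_intros)
    from has_derivative_compose[OF this g'[OF that]]
    show ?thesis by (rule has_derivative_fst)
  qed
  have "continuous_on V (\<lambda>y. L (g y))"
    using continuous_on_compose[OF assms(1,2)] by (simp add: o_def)
  then have "continuous_on V (\<lambda>y. inv (blinfun_apply (L (g y))) k)" for k
    using bij by (rule continuous_on_inv_blinfun)
  then have cont: "continuous_on V (\<lambda>y. g' y k)" for k
    using inv by (simp cong: continuous_on_cong)
  have "continuous_on {z. (z, 0) \<in> V} (\<lambda>z. g' (z, 0) (h, 0))" for h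
    by (rule continuous_on_compose2[OF cont, where f = "\<lambda>z. (z, 0)"]) (auto intro!: continuous_intros)
  then have "continuous_on {z. (z, 0) \<in> V} (\<lambda>z. fst (g' (z, 0) (h, 0)))" for h
    by (rule continuous_on_fst)
  note cont' = this
  have eq: "fst (g' (z, 0) (h, 0)) = frechet_derivative ?p (at z) h" if "(z, 0) \<in> V" for z h
    using frechet_derivative_at[OF der[OF that]] by metis
  have "continuous_on {z. (z, 0) \<in> V} (\<lambda>z. frechet_derivative ?p (at z) h)" for h
    by (rule continuous_on_eq[OF cont'[of h]]) (simp add: eq)
  then show ?thesis using der unfolding One_nat_def Ck_on.simps differentiable_def by blast
qed

section \<open>Smoothness of the prox and stability near the base pair\<close>

context prox_regular_decomposition
begin

lemma rel_interior_imp_C1_prox: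
  assumes ri: "lam \<in> rel_interior Q"
  shows "C1_around (prox tau phi) zbar"
proof -
  let ?E = "(\<lambda>q. - lam + q) ` Q"
  obtain \<pi> where lin_\<pi>: "linear \<pi>"
    and split: "\<And>y \<mu>. \<pi> y + \<mu> - \<pi> \<mu> = 0 \<Longrightarrow> (\<forall>e\<in>?E. y \<bullet> e = 0) \<and> \<mu> \<in> span ?E"
    using orthogonal_splitting_map[of ?E] by blast
  have bl_\<pi>: "bounded_linear \<pi>" using lin_\<pi> by (simp add: linear_conv_bounded_linear)
  have ann: "y \<in> annihilator Q" if "\<forall>e\<in>?E. y \<bullet> e = 0" for y
  proof -
    have "y \<bullet> q = y \<bullet> lam" if "q \<in> Q" for q
    proof -
      have "y \<bullet> (- lam + q) = 0" using \<open>\<forall>e\<in>?E. y \<bullet> e = 0\<close> that by blast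
      then show ?thesis by (simp add: inner_diff_right)
    qed
    then show ?thesis unfolding annihilator_def by (intro CollectI ballI) metis
  qed
  have NK: "N = annihilator Q" using normal_cone_rel_interior[OF convex_Q ri] .
  obtain d where d: "d > 0" "\<And>q. q \<in> affine hull Q \<Longrightarrow> dist q lam < d \<Longrightarrow> q \<in> rel_interior Q"
    using rel_interior_nearE[OF ri] by blast
  have near_ri: "q \<in> rel_interior Q" if "q - lam \<in> span ?E" "dist q lam < d" for q
  proof (rule d(2)[OF _ that(2)])
    have "lam + (q - lam) \<in> (+) lam ` span ?E" using that(1) by blast
    moreover have "lam \<in> affine hull Q" using lam_Q hull_inc by metis
    ultimately show "q \<in> affine hull Q" using affine_hull_span_gen by fastforce
  qed

  \<comment> \<open>The first component is \<open>x + tau *\<^sub>R adjoint (F1 x) l\<close> in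
    coordinates. Vanishing of the second forces \<open>F x\<close> into \<open>annihilator Q\<close>
    and \<open>l - lam\<close> into the space parallel to \<open>affine hull Q\<close>.\<close>
  define \<Psi> where "\<Psi> z = (fst z + tau *\<^sub>R (\<Sum>b\<in>Basis. (F1 (fst z) b \<bullet> snd z) *\<^sub>R b),
    \<pi> (F (fst z)) + (snd z - lam) - \<pi> (snd z - lam))" for z
  define D where "D z w = (fst w + tau *\<^sub>R (\<Sum>b\<in>Basis. (F1 (fst z) b \<bullet> snd w + F2 (fst z) b (fst w) \<bullet> snd z) *\<^sub>R b),
    \<pi> (F1 (fst z) (fst w)) + snd w - \<pi> (snd w))" for z w
  have der: "(\<Psi> has_derivative D z) (at z)" if "fst z \<in> U" for z
  proof -
    have 1: "((\<lambda>z. F1 (fst z) b) has_derivative (\<lambda>w. F2 (fst z) b (fst w))) (at z)" for b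
      by (rule has_derivative_compose[OF has_derivative_fst[OF has_derivative_ident] has_derivative_F1[OF that]])
    have 2: "((\<lambda>z. F (fst z)) has_derivative (\<lambda>w. F1 (fst z) (fst w))) (at z)"
      by (rule has_derivative_compose[OF has_derivative_fst[OF has_derivative_ident] has_derivative_F[OF that]])
    have 3: "((\<lambda>z. snd z - lam) has_derivative snd) (at z)"
      by (auto intro!: derivative_eq_intros)
    show ?thesis unfolding \<Psi>_def[abs_def] D_def[abs_def]
      by (intro has_derivative_Pair has_derivative_add has_derivative_diff has_derivative_scaleR_right
          has_derivative_sum has_derivative_scaleR_left has_derivative_inner 1 3
          has_derivative_fst has_derivative_snd has_derivative_ident
          bounded_linear.has_derivative[OF bl_\<pi> 2] bounded_linear.has_derivative[OF bl_\<pi> 3])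
  qed
  have blD: "bounded_linear (D z)" if "fst z \<in> U" for z
    using der[OF that] by (rule has_derivative_bounded_linear)
  define L where "L z = Blinfun (D z)" for z
  have L: "blinfun_apply (L z) = D z" if "fst z \<in> U" for z
    unfolding L_def using blD[OF that] by (rule bounded_linear_Blinfun_apply)

  let ?z0 = "(xbar, lam)"
  have "\<forall>\<^sub>F z in nhds ?z0. graph_near (fst z) (snd z) \<and> dist (snd z) lam < d"
  proof (rule eventually_conj)
    show "\<forall>\<^sub>F z in nhds ?z0. graph_near (fst z) (snd z)"
      using tendsto_fst[OF filterlim_ident, of ?z0] tendsto_snd[OF filterlim_ident, of ?z0]
      by (intro graph_near_eventually) simp_all
    show "\<forall>\<^sub>F z in nhds ?z0. dist (snd z) lam < d"
      using tendsto_snd[OF filterlim_ident, of ?z0] d(1) by (intro tendstoD) simp_all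
  qed
  then obtain S where S: "open S" "?z0 \<in> S"
    "\<And>z. z \<in> S \<Longrightarrow> graph_near (fst z) (snd z) \<and> dist (snd z) lam < d"
    unfolding eventually_nhds by blast
  have SU: "fst z \<in> U" if "z \<in> S" for z
    using S(3)[OF that] ball_domainD unfolding graph_near_def by blast
  have contL: "continuous_on S L"
  proof (rule continuous_on_blinfun_componentwise)
    fix w :: "'a \<times> 'b"
    have "continuous_on S (\<lambda>z. D z w)"
      unfolding continuous_on_def D_def
    proof
      fix z assume z: "z \<in> S"
      show "((\<lambda>z. (fst w + tau *\<^sub>R (\<Sum>b\<in>Basis. (F1 (fst z) b \<bullet> snd w + F2 (fst z) b (fst w) \<bullet> snd z) *\<^sub>R b),
          \<pi> (F1 (fst z) (fst w)) + snd w - \<pi> (snd w))) \<longlongrightarrow>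
          (fst w + tau *\<^sub>R (\<Sum>b\<in>Basis. (F1 (fst z) b \<bullet> snd w + F2 (fst z) b (fst w) \<bullet> snd z) *\<^sub>R b),
          \<pi> (F1 (fst z) (fst w)) + snd w - \<pi> (snd w))) (at z within S)"
        using SU[OF z] by (intro tendsto_intros tendsto_F1 tendsto_F2 bounded_linear.tendsto[OF bl_\<pi>])
    qed
    then show "continuous_on S (\<lambda>z. L z w)"
      using L SU by (simp cong: continuous_on_cong)
  qed
  have linD: "linear (D ?z0)" using blD xbar_domain by (simp add: bounded_linear.linear)
  \<comment> \<open>Pairing the first equation with \<open>h\<close> removes the multiplier part by
    orthogonality, and \<open>curvature_bound\<close> together with \<open>tau * rho < 1\<close>
    yields \<open>h = 0\<close>. What remains is \<open>adjoint (F1 xbar) \<mu> = 0\<close>, so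
    \<open>multiplier_bound\<close> gives \<open>\<mu> = 0\<close>.\<close>
  have inj: "inj (D ?z0)"
  proof (rule linear_injective_0[OF linD, THEN iffD2], intro allI impI)
    fix w assume "D ?z0 w = 0"
    then obtain h \<mu> where w: "w = (h, \<mu>)"
      and 1: "h + tau *\<^sub>R (\<Sum>b\<in>Basis. (F1 xbar b \<bullet> \<mu> + F2 xbar b h \<bullet> lam) *\<^sub>R b) = 0"
      and 2: "\<pi> (F1 xbar h) + \<mu> - \<pi> \<mu> = 0"
      by (cases w) (simp add: D_def zero_prod_def)
    have s: "\<forall>e\<in>?E. F1 xbar h \<bullet> e = 0" "\<mu> \<in> span ?E" using split[OF 2] by auto
    have hN: "F1 xbar h \<in> N" using ann[OF s(1)] NK by simp
    have "F1 xbar h \<bullet> \<mu> = 0"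
      using orthogonal_to_span[OF s(2), of "F1 xbar h"] s(1) by (simp add: orthogonal_def)
    moreover have "h \<bullet> (\<Sum>b\<in>Basis. (F1 xbar b \<bullet> \<mu>) *\<^sub>R b) = F1 xbar h \<bullet> \<mu>"
      using adjoint_F1_works[OF xbar_domain, of h \<mu>] adjoint_F1_expand[OF xbar_domain, of \<mu>] by simp
    moreover have "h \<bullet> (\<Sum>b\<in>Basis. (F2 xbar b h \<bullet> lam) *\<^sub>R b) = lam \<bullet> F2 xbar h h"
    proof -
      have "F2 xbar h h = (\<Sum>b\<in>Basis. (h \<bullet> b) *\<^sub>R F2 xbar b h)"
        by (rule F2_expand_left[OF xbar_domain])
      then show ?thesis by (simp add: inner_sum_right inner_commute mult.commute)
    qed
    moreover have "h \<bullet> (h + tau *\<^sub>R (\<Sum>b\<in>Basis. (F1 xbar b \<bullet> \<mu> + F2 xbar b h \<bullet> lam) *\<^sub>R b)) =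
      (norm h)\<^sup>2 + tau * (h \<bullet> (\<Sum>b\<in>Basis. (F1 xbar b \<bullet> \<mu>) *\<^sub>R b) + h \<bullet> (\<Sum>b\<in>Basis. (F2 xbar b h \<bullet> lam) *\<^sub>R b))"
      by (simp only: scaleR_add_left sum.distrib inner_add_right inner_scaleR_right power2_norm_eq_inner)
    ultimately have "(norm h)\<^sup>2 + tau * (lam \<bullet> F2 xbar h h) = 0" using 1 by simp
    moreover have "tau * (- rho * (norm h)\<^sup>2) \<le> tau * (lam \<bullet> F2 xbar h h)"
      using curvature_bound[OF hN] tau_pos by (intro mult_left_mono) auto
    ultimately have "(1 - tau * rho) * (norm h)\<^sup>2 \<le> 0" by (simp add: algebra_simps)
    then have h0: "h = 0" using tau_rho by (simp add: mult_le_0_iff)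
    have F20: "F2 xbar b 0 = 0" for b using linear_0[OF linear_F2_right[OF xbar_domain]] .
    have "tau *\<^sub>R adjoint (F1 xbar) \<mu> = 0"
      using 1 unfolding h0 F20 inner_zero_left add_0_right add_0_left
      unfolding adjoint_F1_expand[OF xbar_domain] .
    then have "adjoint (F1 xbar) \<mu> = 0" using tau_pos by simp
    moreover have "norm \<mu> \<le> C * norm (adjoint (F1 xbar) \<mu>)"
    proof (rule multiplier_bound[OF xbar_ball])
      fix v assume "v \<in> N"
      then have v: "v \<in> annihilator Q" using NK by simp
      have "v \<bullet> (- lam + q) = 0" if "q \<in> Q" for q
        using annihilatorD[OF v that lam_Q] by (simp add: inner_diff_right)
      then have "\<forall>e\<in>?E. v \<bullet> e = 0" by blast
      then have "orthogonal v \<mu>" by (intro orthogonal_to_span[OF s(2)]) (unfold orthogonal_def, blast)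
      then show "\<mu> \<bullet> v \<le> 0" by (simp add: orthogonal_def inner_commute)
    qed
    ultimately show "w = 0" by (simp add: w h0 zero_prod_def)
  qed
  obtain G where G: "linear G" "G \<circ> D ?z0 = id"
    using linear_injective_left_inverse[OF linD inj] by blast
  have blG: "bounded_linear G" using G(1) by (simp add: linear_conv_bounded_linear)
  have invG: "Blinfun G o\<^sub>L L ?z0 = id_blinfun"
  proof (rule blinfun_eqI)
    fix w
    have "G (D ?z0 w) = w" using G(2) by (metis comp_apply id_apply)
    then show "blinfun_apply (Blinfun G o\<^sub>L L ?z0) w = blinfun_apply id_blinfun w"
      using L[of ?z0] xbar_domain by (simp add: bounded_linear_Blinfun_apply[OF blG])
  qed
  have derL: "(\<Psi> has_derivative blinfun_apply (L z)) (at z)" if "z \<in> S" for z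
    using der[OF SU[OF that]] L[OF SU[OF that]] by simp
  obtain U' V g g' where U': "open U'" "U' \<subseteq> S" "?z0 \<in> U'" and V: "open V" "\<Psi> ?z0 \<in> V"
    and hom: "homeomorphism U' V \<Psi> g"
    and g': "\<And>y. y \<in> V \<Longrightarrow> (g has_derivative (g' y)) (at y)"
      "\<And>y. y \<in> V \<Longrightarrow> g' y = inv (blinfun_apply (L (g y)))"
      "\<And>y. y \<in> V \<Longrightarrow> bij (blinfun_apply (L (g y)))"
    using inverse_function_theorem[OF S(1) derL contL S(2) invG] by metis
  have \<Psi>_adj: "\<Psi> z = (fst z + tau *\<^sub>R adjoint (F1 (fst z)) (snd z),
      \<pi> (F (fst z)) + (snd z - lam) - \<pi> (snd z - lam))" if "z \<in> S" for z
    by (simp add: \<Psi>_def adjoint_F1_expand[OF SU[OF that]])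
  define W where "W = {z. (z, 0) \<in> V}"
  define P where "P z = fst (g (z, 0))" for z
  have "\<Psi> ?z0 = (zbar, 0)"
    using \<Psi>_adj[OF S(2)] linear_0[OF lin_\<pi>] by (simp add: F_xbar)
  then have "zbar \<in> W" using V(2) by (simp add: W_def)
  moreover have "open W"
  proof -
    have "open ((\<lambda>z. (z, 0)) -` V)" by (intro open_vimage V continuous_intros)
    then show ?thesis by (simp add: W_def vimage_def)
  qed
  moreover have "prox tau phi z = {P z}" if "z \<in> W" for z
  proof -
    have zV: "(z, 0) \<in> V" using that by (simp add: W_def)
    define x where "x = fst (g (z, 0))"
    define l where "l = snd (g (z, 0))"
    have gxl: "g (z, 0) = (x, l)" by (simp add: x_def l_def)
    have "g (z, 0) \<in> U'" using hom zV by (auto simp: homeomorphism_def)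
    then have xlS: "(x, l) \<in> S" using U'(2) gxl by auto
    have "\<Psi> (x, l) = (z, 0)" using hom zV gxl by (metis homeomorphism_apply2)
    then have z: "z = x + tau *\<^sub>R adjoint (F1 x) l" and 0: "\<pi> (F x) + (l - lam) - \<pi> (l - lam) = 0"
      using \<Psi>_adj[OF xlS] by simp_all
    have near: "graph_near x l" "dist l lam < d" using S(3)[OF xlS] by auto
    \<comment> \<open>The second equation places \<open>l\<close> in \<open>affine hull Q\<close>,
      and \<open>S\<close> keeps it close to \<open>lam\<close>.\<close>
    have "l \<in> rel_interior Q" using split[OF 0] near(2) by (intro near_ri) auto
    moreover have "F x \<in> annihilator Q" using split[OF 0] by (intro ann) auto
    ultimately have "F x \<in> normal_cone Q l" using normal_cone_rel_interior[OF convex_Q] by blast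
    then have "prox tau phi z = {x}" unfolding z by (rule graph_near_prox[OF near(1)])
    then show ?thesis by (simp add: P_def x_def)
  qed
  moreover have "Ck_on 1 P W"
    unfolding P_def[abs_def] W_def
  proof (rule Ck_on_1_comp_inverse[OF _ _ g'])
    show "continuous_on V g" using hom by (simp add: homeomorphism_def)
    have "g ` V \<subseteq> S" using hom U'(2) by (auto simp: homeomorphism_def)
    then show "continuous_on (g ` V) L" using contL continuous_on_subset by blast
  qed
  ultimately show ?thesis unfolding C1_around_def by blast
qed

text \<open>By \<open>multiplier_estimate\<close>, subgradients near \<open>vbar\<close> at points
  near \<open>xbar\<close> have multipliers in \<open>Q\<close> near \<open>lam\<close>. These are
  relatively interior, so the pointwise result applies to each such pair.\<close>

lemma rel_interior_imp_epi_around: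
  assumes ri: "lam \<in> rel_interior Q"
  shows "\<exists>S. open S \<and> (xbar, vbar) \<in> S \<and> (\<forall>x v. (x, v) \<in> S \<and> v \<in> limiting_subdifferential phi x \<longrightarrow>
    strictly_twice_epi_differentiable phi x v)"
proof -
  let ?z0 = "(xbar, vbar)"
  obtain d where d: "d > 0" "\<And>q. q \<in> affine hull Q \<Longrightarrow> dist q lam < d \<Longrightarrow> q \<in> rel_interior Q"
    using rel_interior_nearE[OF ri] by blast
  have fst: "(fst \<longlongrightarrow> xbar) (nhds ?z0)" and snd: "(snd \<longlongrightarrow> vbar) (nhds ?z0)"
    using tendsto_fst[OF filterlim_ident, of ?z0] tendsto_snd[OF filterlim_ident, of ?z0] by simp_all
  have "((\<lambda>z. C * norm (snd z - adjoint (F1 (fst z)) lam)) \<longlongrightarrow> C * norm (vbar - vbar)) (nhds ?z0)"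
    by (intro tendsto_intros tendsto_adjoint_F1 fst snd xbar_domain)
  then have "\<forall>\<^sub>F z in nhds ?z0. C * norm (snd z - adjoint (F1 (fst z)) lam) < d"
    by (rule order_tendstoD(2)) (simp add: d)
  moreover have "\<forall>\<^sub>F z in nhds ?z0. fst z \<in> ball xbar r"
    using fst xbar_ball by (intro topological_tendstoD) auto
  ultimately have "\<forall>\<^sub>F z in nhds ?z0. C * norm (snd z - adjoint (F1 (fst z)) lam) < d \<and> fst z \<in> ball xbar r"
    by (rule eventually_conj)
  then obtain S where S: "open S" "?z0 \<in> S"
    "\<And>z. z \<in> S \<Longrightarrow> C * norm (snd z - adjoint (F1 (fst z)) lam) < d \<and> fst z \<in> ball xbar r"
    unfolding eventually_nhds by blast
  have "strictly_twice_epi_differentiable phi x v" if xv: "(x, v) \<in> S" and v: "v \<in> limiting_subdifferential phi x" for x v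
  proof -
    have x: "x \<in> ball xbar r" and le: "C * norm (v - adjoint (F1 x) lam) < d" using S(3)[OF xv] by auto
    obtain q where q: "v = adjoint (F1 x) q" "F x \<in> normal_cone Q q"
      using v limiting_subdifferential_eq[OF x] by blast
    have qQ: "q \<in> Q" using q(2) by (simp add: normal_cone_def)
    have "norm (q - lam) < d"
      using multiplier_estimate[OF x qQ] le linear_diff[OF linear_adjoint_F1[OF ball_domainD[OF x]]]
      by (simp add: q(1))
    then have "q \<in> rel_interior Q" using qQ hull_inc by (intro d(2)) (auto simp: dist_norm hull_inc)
    then show ?thesis
      using strictly_twice_epi_differentiable_rel_interior[OF ri x _ q(2)] q(1) by simp
  qed
  then show ?thesis using S(1,2) by blast
qed

end

lemma C1_around_imp_differentiable_at_point:
  assumes "C1_around P z"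
  shows "differentiable_at_point P z"
proof -
  obtain W f where W: "open W" "z \<in> W" "\<forall>x\<in>W. P x = {f x}" and "Ck_on 1 f W"
    using assms unfolding C1_around_def by blast
  then have "f differentiable (at z)" unfolding One_nat_def Ck_on.simps by blast
  with W show ?thesis unfolding differentiable_at_point_def by blast
qed

theorem theorem3p11:
  fixes phi :: "real ^ 'n \<Rightarrow> ereal"
    and phid :: "real ^ 'm \<Rightarrow> ereal"
    and F :: "real ^ 'n \<Rightarrow> real ^ 'm"
    and Q :: "(real ^ 'm) set"
    and xbar vbar :: "real ^ 'n"
    and lam :: "real ^ 'm"
    and tau rho :: real
  assumes "proper_fun phi" and "lsc phi"
    and "tau > 0"
    and "Ck_strictly_decomposable 2 phi xbar lam phid F Q"
    and "vbar = adjoint (frechet_derivative F (at xbar)) lam"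
    and "rho \<ge> 0"
    and "globally_prox_regular phi xbar vbar rho"
    and "tau * rho < 1"
  shows
    "(strictly_twice_epi_differentiable phi xbar vbar \<longleftrightarrow>
        (\<exists>U. open U \<and> (xbar, vbar) \<in> U \<and>
           (\<forall>x v. (x, v) \<in> U \<and> v \<in> limiting_subdifferential phi x \<longrightarrow>
                  strictly_twice_epi_differentiable phi x v))) \<and>
     (strictly_twice_epi_differentiable phi xbar vbar \<longleftrightarrow>
        vbar \<in> rel_interior (limiting_subdifferential phi xbar)) \<and>
     (strictly_twice_epi_differentiable phi xbar vbar \<longleftrightarrow> lam \<in> rel_interior Q) \<and>
     (strictly_twice_epi_differentiable phi xbar vbar \<longleftrightarrow>
        C1_around (prox tau phi) (xbar + tau *\<^sub>R vbar)) \<and>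
     (strictly_twice_epi_differentiable phi xbar vbar \<longleftrightarrow>
        differentiable_at_point (prox tau phi) (xbar + tau *\<^sub>R vbar))"
proof -
  have dec: "Ck_decomposable 2 phi xbar phid F Q" and lam: "lam \<in> Q"
    and nondeg: "{frechet_derivative F (at xbar) h - w |h w. w \<in> normal_cone Q lam} = UNIV"
    using assms(4) unfolding Ck_strictly_decomposable_def by blast+
  obtain U where U: "open U" "xbar \<in> U" "Ck_on 2 F U" "\<And>x. x \<in> U \<Longrightarrow> phi x = phi xbar + phid (F x)"
    using dec unfolding Ck_decomposable_def by blast
  have Q: "F xbar = 0" "closed Q" "convex Q" "phid = support_function Q" "phi xbar < \<infinity>"
    using dec unfolding Ck_decomposable_def by blast+
  have fin: "\<bar>phi xbar\<bar> \<noteq> \<infinity>" using Q(5) assms(1) by (auto simp: proper_fun_def)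
  have decomp: "\<And>x. x \<in> U \<Longrightarrow> phi x = phi xbar + support_function Q (F x)"
    using U(4) unfolding Q(4) .
  interpret strict_decomposition F U phi xbar lam Q
    by unfold_locales (fact U Q lam nondeg fin | erule decomp)+
  obtain C r where C: "C > 0" "r > 0" "ball xbar r \<subseteq> U"
    "\<And>y u. y \<in> ball xbar r \<Longrightarrow> norm u < r \<Longrightarrow> \<exists>g. norm g \<le> C * norm u \<and> F (y + g) - (F y - u) \<in> N"
    "\<And>x \<mu>. x \<in> ball xbar r \<Longrightarrow> (\<And>d. d \<in> N \<Longrightarrow> \<mu> \<bullet> d \<le> 0) \<Longrightarrow> norm \<mu> \<le> C * norm (adjoint (F1 x) \<mu>)"
    using metric_regularity by blast
  interpret regular_decomposition F U phi xbar lam Q C r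
    by unfold_locales (use C in auto)
  have vbar_sub: "vbar \<in> limiting_subdifferential phi xbar"
    using assms(7) unfolding globally_prox_regular_def by blast
  obtain e where e: "e > 0" "\<forall>x v. norm (x - xbar) < e \<and> norm (v - vbar) < e \<and>
        v \<in> limiting_subdifferential phi x \<and> phi x < phi xbar + ereal e \<longrightarrow>
        (\<forall>x'. phi x' \<ge> phi x + ereal (v \<bullet> (x' - x) - rho / 2 * (norm (x' - x))\<^sup>2))"
    using assms(7) unfolding globally_prox_regular_def by blast
  interpret prox_regular_decomposition F U phi xbar lam Q C r tau rho e
  proof
    fix v x y
    assume "v \<in> limiting_subdifferential phi x" "norm (x - xbar) < e"
      "norm (v - adjoint (F1 xbar) lam) < e" "phi x < phi xbar + ereal e"
    then show "phi x + ereal (v \<bullet> (y - x) - rho / 2 * (norm (y - x))\<^sup>2) \<le> phi y"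
      using e(2) unfolding assms(5) by blast
  qed (use assms e in auto)
  \<comment> \<open>Everything is compared with \<open>lam \<in> rel_interior Q\<close>. The
    neighborhood statement specializes to the base pair through \<open>vbar_sub\<close>.\<close>
  have "strictly_twice_epi_differentiable phi xbar vbar \<longleftrightarrow> lam \<in> rel_interior Q"
    using strictly_twice_epi_differentiable_imp_rel_interior
      strictly_twice_epi_differentiable_rel_interior[OF _ xbar_ball _ xbar_normal[OF lam]]
    unfolding assms(5) by blast
  moreover have "lam \<in> rel_interior Q \<Longrightarrow> \<exists>U. open U \<and> (xbar, vbar) \<in> U \<and>
           (\<forall>x v. (x, v) \<in> U \<and> v \<in> limiting_subdifferential phi x \<longrightarrow>
                  strictly_twice_epi_differentiable phi x v)"
    using rel_interior_imp_epi_around unfolding assms(5) .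
  moreover have "vbar \<in> rel_interior (limiting_subdifferential phi xbar) \<longleftrightarrow> lam \<in> rel_interior Q"
    using subgradient_rel_interior_iff unfolding assms(5) .
  moreover have "lam \<in> rel_interior Q \<Longrightarrow> C1_around (prox tau phi) (xbar + tau *\<^sub>R vbar)"
    using rel_interior_imp_C1_prox unfolding assms(5) .
  moreover have "differentiable_at_point (prox tau phi) (xbar + tau *\<^sub>R vbar) \<Longrightarrow> lam \<in> rel_interior Q"
    using differentiable_prox_imp_rel_interior unfolding assms(5) .
  ultimately show ?thesis
    using C1_around_imp_differentiable_at_point[of "prox tau phi" "xbar + tau *\<^sub>R vbar"] vbar_sub
    by blast
qed

end
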